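(* Let $\Pi$ be an LCL problem in rooted regular trees (without inputs). Then $\Pi$ has locality $n^{\Omega(1)}$ in the LOCAL model if and only if it has locality $n^{\Omega(1)}$ in the online-LOCAL model.
   Context: An LCL problem in rooted trees is a triple $\Pi=(\delta,\Gamma,C)$ where $\delta\ge 1$ is the number of allowed children, $\Gamma$ is a finite set of output labels, and $C\subseteq\Gamma^{\delta+1}$ is a set of allowed configurations $(a : b_1 b_2\dots b_\delta)$, meaning that a node labeled $a$ may have children labeled $b_1,\dots,b_\delta$ in some order. The inputs are rooted trees in which every non-leaf node has exactly $\delta$ children (no input labels); a labeling is feasible if every node with $\delta$ children, together with its children, forms an allowed configuration. $n$ is the number of nodes, known to algorithms; $B(v,T)$ is the set of nodes within distance $T$ of $v$. LOCAL model with locality $T$: the adversary assigns unique identifiers from $\{1,\dots,\mathrm{poly}(n)\}$; each node outputs a function of its radius-$T$ neighborhood. Online-LOCAL model with locality $T$: the adversary chooses an ordering $v_1,\dots,v_n$ of the nodes; with $G_i = G\bigl[\bigcup_{j\le i}B(v_j,T)\bigr]$, when $v_i$ is presented the algorithm, with unbounded memory, must irrevocably output the label of $v_i$ based on $v_1,\dots,v_i$ and $G_i$. An algorithm solves $\Pi$ if for every input and every adversarial choice the output is feasible. The locality of $\Pi$ in a model is the pointwise smallest function $T(n)$ such that some algorithm in that model solves $\Pi$ with locality at most $T$. "Locality $n^{\Omega(1)}$" means locality $\Omega(n^{\alpha})$ for some constant $\alpha>0$. *)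

theory Defs
  imports Complex_Main "HOL-Library.Landau_Symbols" "HOL-Library.Extended_Real"
begin

section \<open>Rooted trees\<close>

text \<open>Edges point from parent to child.\<close>

record 'v digraph =
  verts :: "'v set"
  edges :: "('v \<times> 'v) set"

definition children :: "'v digraph \<Rightarrow> 'v \<Rightarrow> 'v set" where
  "children G v = {u. (v, u) \<in> edges G}"

definition rooted_tree :: "'v digraph \<Rightarrow> bool" where
  "rooted_tree G \<longleftrightarrow>
     finite (verts G) \<and>
     edges G \<subseteq> verts G \<times> verts G \<and>
     (\<forall>u u' v. (u, v) \<in> edges G \<longrightarrow> (u', v) \<in> edges G \<longrightarrow> u = u') \<and>
     (\<exists>r\<in>verts G. (\<forall>u. (u, r) \<notin> edges G) \<and> (\<forall>v\<in>verts G. (r, v) \<in> (edges G)\<^sup>*))"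

definition regular_tree :: "nat \<Rightarrow> 'v digraph \<Rightarrow> bool" where
  "regular_tree d G \<longleftrightarrow>
     rooted_tree G \<and> (\<forall>v\<in>verts G. children G v \<noteq> {} \<longrightarrow> card (children G v) = d)"

text \<open>Distances are those of the underlying undirected graph.\<close>

definition nbhd :: "'v digraph \<Rightarrow> nat \<Rightarrow> 'v \<Rightarrow> 'v set" where
  "nbhd G T v = {u \<in> verts G. \<exists>k\<le>T. (v, u) \<in> (edges G \<union> (edges G)\<inverse>) ^^ k}"

definition induced :: "'v digraph \<Rightarrow> 'v set \<Rightarrow> 'v digraph" where
  "induced G S = \<lparr>verts = verts G \<inter> S, edges = edges G \<inter> S \<times> S\<rparr>"

definition rename :: "('v \<Rightarrow> 'w) \<Rightarrow> 'v digraph \<Rightarrow> 'w digraph" where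
  "rename f G = \<lparr>verts = f ` verts G, edges = map_prod f f ` edges G\<rparr>"


section \<open>LCL problems in rooted regular trees\<close>

text \<open>The configuration \<open>(a : b\<^sub>1 \<dots> b\<^sub>\<delta>)\<close> is the pair \<open>(a, [b\<^sub>1, \<dots>, b\<^sub>\<delta>])\<close>.\<close>

record 'l lcl =
  arity :: nat
  labels :: "'l set"
  configs :: "('l \<times> 'l list) set"

definition is_lcl :: "'l lcl \<Rightarrow> bool" where
  "is_lcl P \<longleftrightarrow>
     arity P \<ge> 1 \<and> finite (labels P) \<and>
     configs P \<subseteq> labels P \<times> {bs. set bs \<subseteq> labels P \<and> length bs = arity P}"

definition feasible :: "'l lcl \<Rightarrow> 'v digraph \<Rightarrow> ('v \<Rightarrow> 'l) \<Rightarrow> bool" where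
  "feasible P G f \<longleftrightarrow>
     f ` verts G \<subseteq> labels P \<and>
     (\<forall>v\<in>verts G. card (children G v) = arity P \<longrightarrow>
        (\<exists>us. distinct us \<and> set us = children G v \<and> (f v, map f us) \<in> configs P))"


section \<open>The LOCAL model\<close>

text \<open>
  An algorithm receives the number of nodes, the identifier of the node that has to produce its
  output, and the radius-\<open>T\<close> neighborhood of this node. Nodes of this neighborhood are visible
  only through their identifiers. The parameter \<open>N\<close> bounds the identifiers.
\<close>

type_synonym 'l local_alg = "nat \<Rightarrow> nat \<Rightarrow> nat digraph \<Rightarrow> 'l"

definition local_output ::
  "'l local_alg \<Rightarrow> nat \<Rightarrow> 'v digraph \<Rightarrow> ('v \<Rightarrow> nat) \<Rightarrow> 'v \<Rightarrow> 'l" where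
  "local_output A T G ident v =
     A (card (verts G)) (ident v) (rename ident (induced G (nbhd G T v)))"

definition solves_local ::
  "(nat \<Rightarrow> nat) \<Rightarrow> 'l lcl \<Rightarrow> 'l local_alg \<Rightarrow> (nat \<Rightarrow> nat) \<Rightarrow> bool" where
  "solves_local N P A T \<longleftrightarrow>
     (\<forall>(G :: nat digraph) ident.
        regular_tree (arity P) G \<longrightarrow>
        inj_on ident (verts G) \<longrightarrow>
        ident ` verts G \<subseteq> {1..N (card (verts G))} \<longrightarrow>
        feasible P G (local_output A (T (card (verts G))) G ident))"


section \<open>The online-LOCAL model\<close>

text \<open>
  An algorithm receives the number of nodes, the sequence \<open>v\<^sub>1, \<dots>, v\<^sub>i\<close> and the graph \<open>G\<^sub>i\<close>.
  It is deterministic, so its memory (previous graphs and outputs) is a function of these data,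
  and an adaptive adversary is no stronger than one fixing tree and ordering in advance.
  The names of the nodes merely let the algorithm recognize nodes it has already seen: they are
  arbitrary natural numbers chosen by the adversary.
\<close>

type_synonym 'l online_alg = "nat \<Rightarrow> nat list \<Rightarrow> nat digraph \<Rightarrow> 'l"

text \<open>If \<open>v = v\<^sub>i\<close>, then the list \<open>ps\<close> below is \<open>[v\<^sub>1, \<dots>, v\<^sub>i]\<close>.\<close>

definition online_output ::
  "'l online_alg \<Rightarrow> nat \<Rightarrow> nat digraph \<Rightarrow> nat list \<Rightarrow> nat \<Rightarrow> 'l" where
  "online_output A T G vs v =
     (let ps = takeWhile (\<lambda>u. u \<noteq> v) vs @ [v]
      in A (card (verts G)) ps (induced G (\<Union>u\<in>set ps. nbhd G T u)))"

definition solves_online :: "'l lcl \<Rightarrow> 'l online_alg \<Rightarrow> (nat \<Rightarrow> nat) \<Rightarrow> bool" where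
  "solves_online P A T \<longleftrightarrow>
     (\<forall>G vs.
        regular_tree (arity P) G \<longrightarrow>
        distinct vs \<longrightarrow> set vs = verts G \<longrightarrow>
        feasible P G (online_output A (T (card (verts G))) G vs))"


section \<open>Locality\<close>

text \<open>
  Pointwise infima. Algorithms know the number of nodes, so the infimum is attained whenever some
  algorithm solves the problem; otherwise the locality is \<open>\<infinity>\<close>.
\<close>

definition locality_local :: "(nat \<Rightarrow> nat) \<Rightarrow> 'l lcl \<Rightarrow> nat \<Rightarrow> enat" where
  "locality_local N P = (INF T\<in>{T. \<exists>A. solves_local N P A T}. (\<lambda>n. enat (T n)))"

definition locality_online :: "'l lcl \<Rightarrow> nat \<Rightarrow> enat" where
  "locality_online P = (INF T\<in>{T. \<exists>A. solves_online P A T}. (\<lambda>n. enat (T n)))"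

text \<open>
  There are inputs with \<open>n\<close> nodes only for \<open>n\<close> congruent to 1 modulo \<open>\<delta>\<close>, and for all other \<open>n\<close>
  the locality is vacuously 0 if the problem is solvable. The asymptotic lower bound therefore
  ranges over the possible input sizes.
\<close>

definition input_sizes :: "'l lcl \<Rightarrow> nat set" where
  "input_sizes P = {card (verts G) | G :: nat digraph. regular_tree (arity P) G}"

definition polynomial_locality :: "'l lcl \<Rightarrow> (nat \<Rightarrow> enat) \<Rightarrow> bool" where
  "polynomial_locality P L \<longleftrightarrow>
     (\<exists>\<alpha>>0. \<exists>c>0. \<forall>\<^sub>F n in inf at_top (principal (input_sizes P)).
        ereal (c * real n powr \<alpha>) \<le> ereal_of_enat (L n))"

end

theory Submission
  imports Defs "HOL-Library.Countable_Set"
begin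

text \<open>
  An online algorithm can simulate a LOCAL algorithm by numbering the nodes in the order in which
  it sees them, so the online locality is at most the LOCAL locality. For the converse, repeatedly
  remove the labels that are inflexible: those \<open>a\<close> for which the automaton with steps from the
  label of a node to the label of a child lacks closed walks at \<open>a\<close> of arbitrarily large lengths.

  If some labels survive, then a rake-and-compress decomposition cuts the tree at anchors on long
  unary chains. Between anchors the labels are chosen from the top downwards, and the flexibility
  of the labels makes it possible to hit a fixed label at each anchor. With a ruling set computed from the
  bits of the identifiers, this takes \<open>O(log\<^sup>2 n)\<close> rounds.

  If no label survives, an adversary for the online model reveals nodes in separate fragments of an
  infinite forest of hierarchical caterpillars. Every revealed label is lost in some round \<open>i\<close> of
  the pruning. If two fragments contain the same label lost in round \<open>i\<close>, then the adversary
  joins them by a path of a length without closed walk and reveals this path together with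
  all children of its nodes. Then one of these nodes must have a label that is lost in an
  earlier round. After boundedly many joins there is no earlier round left, a contradiction as long
  as the revealed part, of size polynomial in \<open>T\<close>, fits into a tree with \<open>n\<close> nodes.
\<close>

text \<open>Everything that the adversary reveals must fit into \<open>n\<close> nodes, so the balls
  of its forest have to be polynomial in \<open>T\<close>; in a full \<open>\<delta>\<close>-ary
  tree they are exponential, hence the caterpillars. Joining fragments could spoil this, so a
  potential bounded by \<open>C\<close> is carried along. A join doubles \<open>C\<close>, but the
  number of joins depends on the problem only. Fragments are joined by exchanging subtrees in an
  infinite forest, which preserves all numbers of children. A finite tree with exactly
  \<open>n\<close> nodes is built only afterwards, around the revealed balls. Labels given earlier
  persist, because the exchanged edges lie outside these balls. On the algorithmic side, flexibility
  of the single labels is not yet enough: all anchors need one common label that is reachable from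
  every label in use. It comes from a strongly connected set of surviving labels that no step
  leaves. Anchors are kept so sparse that no node sees two of them closely below it; therefore the
  walks demanded by different children of a node never compete.\<close>

lemma nbhd_induced:
  assumes E: "edges G \<subseteq> verts G \<times> verts G" and v: "v \<in> verts G"
    and S: "nbhd G T v \<subseteq> S" and "t \<le> T"
  shows "nbhd (induced G S) t v = nbhd G t v"
proof -
  let ?r = "edges G \<union> (edges G)\<inverse>"
  let ?H = "induced G S"
  let ?s = "edges ?H \<union> (edges ?H)\<inverse>"
  have sub: "?s \<subseteq> ?r"
    by (auto simp: induced_def)
  have fwd: "(v, u) \<in> ?r ^^ k \<Longrightarrow> k \<le> T \<Longrightarrow> (v, u) \<in> ?s ^^ k \<and> u \<in> nbhd G T v" for k u
  proof (induction k arbitrary: u)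
    case 0
    then show ?case using v by (auto simp: nbhd_def)
  next
    case (Suc k)
    obtain w where w: "(v, w) \<in> ?r ^^ k" and wu: "(w, u) \<in> ?r"
      using Suc.prems(1) by auto
    have IH: "(v, w) \<in> ?s ^^ k" "w \<in> nbhd G T v"
      using Suc.IH[OF w] Suc.prems(2) by auto
    have "u \<in> verts G" using wu E by auto
    then have u: "u \<in> nbhd G T v"
      using Suc.prems by (auto simp: nbhd_def simp del: relpow.simps)
    have "(w, u) \<in> ?s"
      using wu u IH(2) S by (auto simp: induced_def)
    then show ?case using IH(1) u by auto
  qed
  have bwd: "(v, u) \<in> ?s ^^ k \<Longrightarrow> (v, u) \<in> ?r ^^ k" for k u
  proof (induction k arbitrary: u)
    case (Suc k)
    then show ?case using sub by (meson relpow_Suc_E relpow_Suc_I subsetD)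
  qed simp
  then show ?thesis
  proof (intro equalityI subsetI)
    fix u assume "u \<in> nbhd ?H t v"
    then show "u \<in> nbhd G t v"
      using bwd unfolding nbhd_def by (auto simp: induced_def)
  next
    fix u assume "u \<in> nbhd G t v"
    then obtain k where k: "k \<le> t" "(v, u) \<in> ?r ^^ k" by (auto simp: nbhd_def)
    then have "(v, u) \<in> ?s ^^ k" "u \<in> nbhd G T v" using fwd \<open>t \<le> T\<close> by auto
    moreover have "u \<in> verts ?H" using calculation(2) S by (auto simp: induced_def nbhd_def)
    ultimately show "u \<in> nbhd ?H t v" using k(1) unfolding nbhd_def by blast
  qed
qed

lemma rooted_tree_edges: "rooted_tree G \<Longrightarrow> edges G \<subseteq> verts G \<times> verts G"
  by (simp add: rooted_tree_def)

lemma rooted_tree_finite: "rooted_tree G \<Longrightarrow> finite (verts G)"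
  by (simp add: rooted_tree_def)

lemma regular_tree_rooted: "regular_tree d G \<Longrightarrow> rooted_tree G"
  by (simp add: regular_tree_def)

lemma rename_cong:
  assumes "edges G \<subseteq> verts G \<times> verts G" "\<And>v. v \<in> verts G \<Longrightarrow> f v = g v"
  shows "rename f G = rename g G"
proof -
  have "map_prod f f ` edges G = map_prod g g ` edges G"
    using assms by (intro image_cong) auto
  then show ?thesis using assms(2) by (simp add: rename_def)
qed

lemma nbhd_subset_verts: "nbhd G T v \<subseteq> verts G"
  by (auto simp: nbhd_def)

lemma self_in_nbhd: "v \<in> verts G \<Longrightarrow> v \<in> nbhd G T v"
  by (auto simp: nbhd_def intro!: exI[of _ 0])

lemma induced_induced: "A \<subseteq> S \<Longrightarrow> induced (induced G S) A = induced G A"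
  by (auto simp: induced_def)


section \<open>Simulating LOCAL algorithms in the online-LOCAL model\<close>

text \<open>Each ball contributes only its new nodes, at the end of the list, so a node keeps its
  position in all later steps.\<close>

definition seen :: "nat \<Rightarrow> nat digraph \<Rightarrow> nat list \<Rightarrow> nat list" where
  "seen T G ps = foldl (\<lambda>l v. l @ sorted_list_of_set (nbhd G T v - set l)) [] ps"

text \<open>Positions count from 1 because identifiers must lie in \<open>{1..N n}\<close>.\<close>

definition first_index :: "'a list \<Rightarrow> 'a \<Rightarrow> nat" where
  "first_index l x = Suc (length (takeWhile (\<lambda>y. y \<noteq> x) l))"

lemma seen_snoc:
  "seen T G (ps @ [v]) = seen T G ps @ sorted_list_of_set (nbhd G T v - set (seen T G ps))"
  by (simp add: seen_def)

lemma seen_prefix: "\<exists>l. seen T G (ps @ qs) = seen T G ps @ l"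
proof (induction qs rule: rev_induct)
  case (snoc q qs)
  then show ?case by (metis append.assoc seen_snoc)
qed simp

lemma distinct_seen:
  assumes "finite (verts G)"
  shows "distinct (seen T G ps) \<and> set (seen T G ps) = (\<Union>v\<in>set ps. nbhd G T v)"
proof (induction ps rule: rev_induct)
  case (snoc q qs)
  have "finite (nbhd G T q)" using assms nbhd_subset_verts finite_subset by metis
  then show ?case using snoc by (auto simp: seen_snoc)
qed (simp add: seen_def)

lemma seen_cong:
  "(\<And>v. v \<in> set ps \<Longrightarrow> nbhd G T v = nbhd H T v) \<Longrightarrow> seen T G ps = seen T H ps"
proof (induction ps rule: rev_induct)
  case (snoc q qs)
  then show ?case by (simp add: seen_snoc)
qed (simp add: seen_def)

lemma first_index_append: "x \<in> set l \<Longrightarrow> first_index (l @ m) x = first_index l x"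
  by (simp add: first_index_def)

lemma nth_first_index: "x \<in> set l \<Longrightarrow> l ! (first_index l x - 1) = x"
  by (induction l) (auto simp: first_index_def)

lemma inj_on_first_index: "inj_on (first_index l) (set l)"
  by (metis inj_onI nth_first_index)

lemma first_index_le: "x \<in> set l \<Longrightarrow> first_index l x \<in> {1..length l}"
  by (induction l) (auto simp: first_index_def)

text \<open>The final numbering is a legal identifier assignment into \<open>{1..n}\<close>, and the
  number of a node is settled once the node is seen. Hence all simulated calls, made at different
  times, refer to the same LOCAL run.\<close>

lemma online_simulates_local:
  fixes P :: "'l lcl"
  assumes A: "solves_local N P A T" and N: "\<And>n. n \<le> N n"
  shows "\<exists>B. solves_online P B T"
proof -
  define B :: "'l online_alg" where "B = (\<lambda>n ps H.
    let i = first_index (seen (T n) H ps)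
    in A n (i (last ps)) (rename i (induced H (nbhd H (T n) (last ps)))))"
  have "feasible P G (online_output B (T (card (verts G))) G vs)"
    if G: "regular_tree (arity P) G" and vs: "distinct vs" "set vs = verts G" for G vs
  proof -
    let ?n = "card (verts G)"
    let ?T = "T ?n"
    define ident where "ident = first_index (seen ?T G vs)"
    have fin: "finite (verts G)" and E: "edges G \<subseteq> verts G \<times> verts G"
      using G regular_tree_rooted rooted_tree_finite rooted_tree_edges by blast+
    have set_seen: "set (seen ?T G vs) = verts G"
      using distinct_seen[OF fin] vs nbhd_subset_verts self_in_nbhd by fast
    then have len: "length (seen ?T G vs) = ?n"
      using distinct_seen[OF fin] distinct_card by metis
    have inj: "inj_on ident (verts G)"
      using inj_on_first_index set_seen ident_def by metis
    have "ident ` verts G \<subseteq> {1..N ?n}"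
    proof
      fix y assume "y \<in> ident ` verts G"
      then have "y \<in> {1..?n}" using first_index_le set_seen len ident_def by (metis imageE)
      then show "y \<in> {1..N ?n}" using N[of ?n] by auto
    qed
    then have feas: "feasible P G (local_output A ?T G ident)"
      using A G inj by (simp add: solves_local_def)
    have eq: "online_output B ?T G vs v = local_output A ?T G ident v" if v: "v \<in> verts G" for v
    proof -
      define ps where "ps = takeWhile (\<lambda>u. u \<noteq> v) vs @ [v]"
      define S where "S = (\<Union>u\<in>set ps. nbhd G ?T u)"
      define H where "H = induced G S"
      have "v \<in> set vs" using v vs by simp
      then obtain as qs where as: "vs = as @ v # qs" "v \<notin> set as"
        using split_list_first by metis
      then have "takeWhile (\<lambda>u. u \<noteq> v) vs = as"
        by (subst as(1), subst takeWhile_append2) auto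
      then have qs: "vs = ps @ qs"
        using as by (simp add: ps_def)
      have sub: "set ps \<subseteq> verts G" using qs vs by auto
      have nb: "nbhd H ?T u = nbhd G ?T u" if "u \<in> set ps" for u
        unfolding H_def using that sub by (intro nbhd_induced[OF E, of _ ?T]) (auto simp: S_def)
      have "seen ?T H ps = seen ?T G ps" using nb by (rule seen_cong)
      moreover have "first_index (seen ?T G ps) u = ident u" if "u \<in> nbhd G ?T v" for u
      proof -
        have "u \<in> set (seen ?T G ps)"
          using distinct_seen[OF fin, of ?T ps] that by (auto simp: ps_def)
        then show ?thesis
          unfolding ident_def using seen_prefix[of ?T G ps qs] qs first_index_append by metis
      qed
      moreover have "v \<in> set ps" "last ps = v" by (auto simp: ps_def)
      moreover have "induced H (nbhd G ?T v) = induced G (nbhd G ?T v)"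
        unfolding H_def by (rule induced_induced) (auto simp: S_def ps_def)
      moreover have "rename (first_index (seen ?T G ps)) (induced G (nbhd G ?T v)) =
          rename ident (induced G (nbhd G ?T v))"
        using calculation(2) E by (intro rename_cong) (auto simp: induced_def)
      ultimately show ?thesis
        using nb self_in_nbhd[OF v]
        by (simp add: online_output_def local_output_def B_def Let_def
            flip: ps_def S_def H_def)
    qed
    have "online_output B ?T G vs ` verts G = local_output A ?T G ident ` verts G"
      using eq by (intro image_cong) auto
    moreover have "map (online_output B ?T G vs) us = map (local_output A ?T G ident) us"
      if "set us = children G v" for us v
      using that eq E by (auto simp: children_def)
    ultimately show ?thesis
      using feas eq unfolding feasible_def by metis
  qed
  then show ?thesis unfolding solves_online_def by blast
qed

lemma locality_online_le_local:
  fixes P :: "'l lcl"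
  assumes "\<And>n. n \<le> N n"
  shows "locality_online P \<le> locality_local N P"
proof -
  have "{T. \<exists>A. solves_local N P A T} \<subseteq> {T. \<exists>A. solves_online P A T}"
    using online_simulates_local[OF _ assms] by blast
  then have "(\<lambda>T n. enat (T n)) ` {T. \<exists>A. solves_local N P A T} \<subseteq>
      (\<lambda>T n. enat (T n)) ` {T. \<exists>A. solves_online P A T}"
    by (rule image_mono)
  then show ?thesis
    unfolding locality_online_def locality_local_def by (rule Inf_superset_mono)
qed

lemma polynomial_locality_mono:
  assumes "polynomial_locality P L" "L \<le> L'"
  shows "polynomial_locality P L'"
proof -
  have "ereal_of_enat (L n) \<le> ereal_of_enat (L' n)" for n
    using assms(2) by (simp add: le_fun_def)
  note le = order_trans[OF _ this]
  obtain \<alpha> c where "\<alpha> > 0" "c > 0"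
    "\<forall>\<^sub>F n in inf at_top (principal (input_sizes P)). ereal (c * real n powr \<alpha>) \<le> ereal_of_enat (L n)"
    using assms(1) unfolding polynomial_locality_def by blast
  moreover from this(3)
  have "\<forall>\<^sub>F n in inf at_top (principal (input_sizes P)). ereal (c * real n powr \<alpha>) \<le> ereal_of_enat (L' n)"
    by (rule eventually_mono) (rule le)
  ultimately show ?thesis unfolding polynomial_locality_def by blast
qed

section \<open>The automaton of an LCL problem\<close>

text \<open>The whole configuration has to lie in \<open>S\<close>, not only \<open>a\<close> and
  \<open>b\<close>: the siblings on a path need surviving labels as well.\<close>

definition steps :: "'l lcl \<Rightarrow> 'l set \<Rightarrow> ('l \<times> 'l) set" where
  "steps P S = {(a, b). a \<in> S \<and> (\<exists>bs. (a, bs) \<in> configs P \<and> set bs \<subseteq> S \<and> b \<in> set bs)}"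

definition flexible :: "('l \<times> 'l) set \<Rightarrow> 'l \<Rightarrow> bool" where
  "flexible r a \<longleftrightarrow> (\<exists>K. \<forall>j\<ge>K. (a, a) \<in> r ^^ j)"

primrec pruned :: "'l lcl \<Rightarrow> nat \<Rightarrow> 'l set" where
  "pruned P 0 = labels P"
| "pruned P (Suc i) = {a \<in> pruned P i. flexible (steps P (pruned P i)) a}"

lemma pruned_antimono: "i \<le> j \<Longrightarrow> pruned P j \<subseteq> pruned P i"
  by (induction j rule: dec_induct) auto

lemma pruned_labels: "pruned P i \<subseteq> labels P"
  using pruned_antimono[of 0 i P] by simp

lemma pruned_stabilizes:
  assumes "finite (labels P)"
  shows "\<exists>i. pruned P (Suc i) = pruned P i"
proof (rule ccontr)
  assume "\<not> ?thesis"
  then have "pruned P (Suc i) \<subset> pruned P i" for i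
    using pruned_antimono[of i "Suc i" P] by auto
  then have less: "card (pruned P (Suc i)) < card (pruned P i)" for i
    using assms pruned_labels by (metis finite_subset psubset_card_mono)
  have "card (pruned P i) + i \<le> card (labels P)" for i
  proof (induction i)
    case (Suc i)
    then show ?case using less[of i] by simp
  qed simp
  from this[of "Suc (card (labels P))"] show False by simp
qed

lemma relpow_add_I: "(a, b) \<in> r ^^ m \<Longrightarrow> (b, c) \<in> r ^^ n \<Longrightarrow> (a, c) \<in> r ^^ (m + n)"
  by (auto simp: relpow_add)

text \<open>If a window that is at least as long as some closed walk consists of lengths of closed
  walks, then so does everything beyond it.\<close>

lemma not_flexible_gap:
  assumes "\<not> flexible r a"
  shows "\<exists>c. \<forall>X. \<exists>m. X \<le> m \<and> m \<le> X + c \<and> (a, a) \<notin> r ^^ m"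
proof (cases "\<exists>l>0. (a, a) \<in> r ^^ l")
  case True
  then obtain l where l: "l > 0" "(a, a) \<in> r ^^ l" by blast
  have "\<exists>m. X \<le> m \<and> m \<le> X + l \<and> (a, a) \<notin> r ^^ m" for X
  proof (rule ccontr)
    assume "\<not> ?thesis"
    then have win: "(a, a) \<in> r ^^ m" if "X \<le> m" "m \<le> X + l" for m using that by blast
    have "(a, a) \<in> r ^^ m" if "X \<le> m" for m
      using that
    proof (induction m rule: less_induct)
      case (less m)
      show ?case
      proof (cases "m \<le> X + l")
        case False
        then have "(a, a) \<in> r ^^ (m - l)" using less l by auto
        from relpow_add_I[OF this l(2)] show ?thesis using False by simp
      qed (use win less in auto)
    qed
    then show False using assms by (auto simp: flexible_def)
  qed
  then show ?thesis by blast
next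
  case False
  \<comment> \<open>\<open>Suc X\<close>, because the empty walk makes length 0 closed even if
    \<open>X = 0\<close>.\<close>
  have "X \<le> Suc X \<and> Suc X \<le> X + 1 \<and> (a, a) \<notin> r ^^ Suc X" for X
    using False by (auto simp del: relpow.simps)
  then show ?thesis by blast
qed

lemma is_lclD:
  assumes "is_lcl P"
  shows "arity P \<ge> 1" "finite (labels P)"
    "(a, bs) \<in> configs P \<Longrightarrow> a \<in> labels P \<and> set bs \<subseteq> labels P \<and> length bs = arity P"
  using assms by (auto simp: is_lcl_def)

text \<open>\<open>s\<close> is the label reserved for anchors. At distance \<open>K\<close> or more
  above an anchor, every label of \<open>S\<close> is still possible.\<close>

definition certificate :: "'l lcl \<Rightarrow> 'l set \<Rightarrow> 'l \<Rightarrow> nat \<Rightarrow> bool" where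
  "certificate P S s K \<longleftrightarrow> s \<in> S \<and> S \<subseteq> labels P \<and>
     (\<forall>a\<in>S. \<exists>bs. (a, bs) \<in> configs P \<and> set bs \<subseteq> S) \<and>
     (\<forall>a\<in>S. \<forall>j\<ge>K. (a, s) \<in> steps P S ^^ j)"

text \<open>Take the labels reachable from a label \<open>s\<close> whose reachable set is minimal.\<close>

lemma certificate_exists:
  assumes P: "is_lcl P" and stable: "pruned P (Suc i) = pruned P i" and ne: "pruned P i \<noteq> {}"
  shows "\<exists>S s K. certificate P S s K"
proof -
  define U where "U = pruned P i"
  define r where "r = steps P U"
  have finU: "finite U"
    using is_lclD(2)[OF P] pruned_labels finite_subset unfolding U_def by metis
  have flex: "flexible r a" if "a \<in> U" for a
    using stable that by (auto simp: U_def r_def)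
  have rU: "r \<subseteq> U \<times> U" by (auto simp: r_def steps_def)
  define R where "R = (\<lambda>a. {b. (a, b) \<in> r\<^sup>*})"
  have RU: "R a \<subseteq> U" if "a \<in> U" for a
  proof
    fix b assume "b \<in> R a"
    then have "(a, b) \<in> r\<^sup>*" by (simp add: R_def)
    then show "b \<in> U" using that rU by (induction rule: rtrancl_induct) auto
  qed
  obtain s where s: "s \<in> U" and smin: "\<And>b. b \<in> U \<Longrightarrow> card (R s) \<le> card (R b)"
    using ne ex_has_least_nat[of "\<lambda>s. s \<in> U" _ "\<lambda>s. card (R s)"] U_def by blast
  define S where "S = R s"
  have SU: "S \<subseteq> U" using RU s by (simp add: S_def)
  have sS: "s \<in> S" by (simp add: S_def R_def)
  \<comment> \<open>By minimality no label of \<open>S\<close> reaches fewer labels than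
    \<open>s\<close> does, so each of them reaches \<open>s\<close> again.\<close>
  have ret: "(b, s) \<in> r\<^sup>*" if "b \<in> S" for b
  proof -
    have "R b \<subseteq> R s" using that by (auto simp: S_def R_def)
    moreover have "finite (R s)" using RU s finU finite_subset by metis
    ultimately have "R b = R s" using smin[of b] that SU card_subset_eq
      by (metis card_mono le_antisym subsetD)
    then show ?thesis using sS by (auto simp: S_def R_def)
  qed
  have closed: "b \<in> S" if "a \<in> S" "(a, b) \<in> r" for a b
    using that by (auto simp: S_def R_def)
  \<comment> \<open>No step of \<open>r\<close> leaves \<open>S\<close>, so a configuration at a
    label of \<open>S\<close> stays inside \<open>S\<close>, and walks of \<open>r\<close> from
    \<open>S\<close> are walks of \<open>steps P S\<close>.\<close>
  have conf: "set bs \<subseteq> S" if "a \<in> S" "(a, bs) \<in> configs P" "set bs \<subseteq> U" for a bs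
  proof
    fix b assume "b \<in> set bs"
    then have "(a, b) \<in> r" using that SU by (auto simp: r_def steps_def)
    then show "b \<in> S" using closed that by blast
  qed
  have step: "(a, b) \<in> steps P S" if "a \<in> S" "(a, b) \<in> r" for a b
    using that conf by (auto simp: r_def steps_def)
  have walk: "(a, b) \<in> steps P S ^^ j \<and> b \<in> S" if "(a, b) \<in> r ^^ j" "a \<in> S" for a b j
    using that
  proof (induction j arbitrary: b)
    case (Suc j)
    then obtain c where "(a, c) \<in> r ^^ j" "(c, b) \<in> r" by auto
    then show ?case using Suc.IH Suc.prems(2) step closed by (meson relpow_Suc_I)
  qed auto
  \<comment> \<open>A fixed walk from \<open>a\<close> to \<open>s\<close> is prolonged by closed
    walks at \<open>s\<close>, available for all large lengths.\<close>
  have "\<exists>K. \<forall>j\<ge>K. (a, s) \<in> r ^^ j" if a: "a \<in> S" for a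
  proof -
    obtain l where l: "(a, s) \<in> r ^^ l" using ret[OF a] rtrancl_power by metis
    obtain K where K: "\<And>j. j \<ge> K \<Longrightarrow> (s, s) \<in> r ^^ j"
      using flex[OF s] by (auto simp: flexible_def)
    have "(a, s) \<in> r ^^ j" if "j \<ge> l + K" for j
      using relpow_add_I[OF l K[of "j - l"]] that by simp
    then show ?thesis by blast
  qed
  then obtain K where K: "\<And>a j. a \<in> S \<Longrightarrow> j \<ge> K a \<Longrightarrow> (a, s) \<in> r ^^ j" by metis
  define M where "M = Max (K ` S)"
  have "K a \<le> M" if "a \<in> S" for a
    using that finU SU by (auto simp: M_def intro!: Max_ge finite_imageI intro: finite_subset)
  then have walks: "(a, s) \<in> steps P S ^^ j" if "a \<in> S" "j \<ge> M" for a j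
    using K walk that by (meson order_trans)
  have "\<exists>bs. (a, bs) \<in> configs P \<and> set bs \<subseteq> S" if a: "a \<in> S" for a
  proof -
    have "(a, s) \<in> r ^^ Suc (K a)" using K a le_SucI by blast
    then obtain b where "(a, b) \<in> r" by (meson relpow_Suc_D2)
    then show ?thesis using conf a by (auto simp: r_def steps_def)
  qed
  then show ?thesis
    using walks sS SU pruned_labels[of P i] unfolding certificate_def U_def
    by (intro exI[of _ S] exI[of _ s] exI[of _ M]) auto
qed


section \<open>Locally determined functions\<close>

definition parents :: "'v digraph \<Rightarrow> 'v \<Rightarrow> 'v set" where
  "parents G v = {u. (u, v) \<in> edges G}"

text \<open>Only adjacency is compared, not \<open>verts\<close>, since the constructions below
  depend on edges alone. The last conjunct makes monotonicity in \<open>t\<close> immediate.\<close>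

primrec agree :: "nat \<Rightarrow> 'v digraph \<Rightarrow> 'v digraph \<Rightarrow> 'v \<Rightarrow> bool" where
  "agree 0 G H v = True"
| "agree (Suc t) G H v = (children G v = children H v \<and> parents G v = parents H v \<and>
     (\<forall>u\<in>children G v \<union> parents G v. agree t G H u) \<and> agree t G H v)"

lemma agree_mono: "t \<le> t' \<Longrightarrow> agree t' G H v \<Longrightarrow> agree t G H v"
  by (induction t' rule: dec_induct) auto

lemma agree_relpow:
  assumes "agree (j + t) G H v"
  shows "(v, x) \<in> edges G ^^ j \<longleftrightarrow> (v, x) \<in> edges H ^^ j"
    and "(x, v) \<in> edges G ^^ j \<longleftrightarrow> (x, v) \<in> edges H ^^ j"
    and "(v, x) \<in> edges G ^^ j \<Longrightarrow> agree t G H x"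
    and "(x, v) \<in> edges G ^^ j \<Longrightarrow> agree t G H x"
  using assms
proof (induction j arbitrary: v)
  case (Suc j)
  {
    case 1
    then have "children G v = children H v" "\<And>u. u \<in> children G v \<Longrightarrow> agree (j + t) G H u"
      by auto
    then show ?case using Suc.IH(1) unfolding relpow_commute[symmetric] relpow.simps
      by (auto simp: children_def)
  next
    case 2
    then have "parents G v = parents H v" "\<And>u. u \<in> parents G v \<Longrightarrow> agree (j + t) G H u"
      by auto
    then show ?case using Suc.IH(2) by (auto simp: parents_def)
  next
    case 3
    then obtain u where "(v, u) \<in> edges G" "(u, x) \<in> edges G ^^ j"
      by (meson relpow_Suc_D2)
    then show ?case using Suc.IH(3)[of u] 3 by (auto simp: children_def)
  next
    case 4
    then obtain u where "(x, u) \<in> edges G ^^ j" "(u, v) \<in> edges G" by auto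
    then show ?case using Suc.IH(4)[of u] 4 by (auto simp: parents_def)
  }
qed auto

text \<open>A compositional notion of locality: radii add up when definitions are nested. Values may
  depend on node names, which play the role of identifiers.\<close>

definition local :: "nat \<Rightarrow> ('v digraph \<Rightarrow> 'v \<Rightarrow> 'b) \<Rightarrow> bool" where
  "local t f \<longleftrightarrow> (\<forall>G H v. agree t G H v \<longrightarrow> f G v = f H v)"

lemma localD: "local t f \<Longrightarrow> agree t' G H v \<Longrightarrow> t \<le> t' \<Longrightarrow> f G v = f H v"
  using agree_mono by (metis local_def)

lemma local_mono: "local t f \<Longrightarrow> t \<le> t' \<Longrightarrow> local t' f"
  using agree_mono unfolding local_def by metis

text \<open>A node at distance less than \<open>T\<close> from \<open>u\<close> keeps all its
  neighbors when the ball is cut out. This makes every \<open>local\<close> function computable from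
  a neighborhood.\<close>

lemma agree_induced_nbhd:
  assumes E: "edges G \<subseteq> verts G \<times> verts G" and v: "v \<in> nbhd G s u" and "s + t \<le> T"
  shows "agree t G (induced G (nbhd G T u)) v"
  using v \<open>s + t \<le> T\<close>
proof (induction t arbitrary: s v)
  case (Suc t)
  let ?r = "edges G \<union> (edges G)\<inverse>"
  obtain k where k: "k \<le> s" "(u, v) \<in> ?r ^^ k" and vG: "v \<in> verts G"
    using Suc.prems by (auto simp: nbhd_def)
  have near: "w \<in> nbhd G (Suc s) u" if "(v, w) \<in> ?r" for w
  proof -
    have "(u, w) \<in> ?r ^^ Suc k" using k that by auto
    then show ?thesis using k that E unfolding nbhd_def by (auto simp del: relpow.simps)
  qed
  have mono: "nbhd G s' u \<subseteq> nbhd G T u" if "s' \<le> T" for s'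
    using that unfolding nbhd_def by (auto intro: order_trans)
  have "v \<in> nbhd G T u" using Suc.prems mono[of s] by auto
  moreover have "w \<in> nbhd G T u" if "(v, w) \<in> ?r" for w
    using near[OF that] mono[of "Suc s"] Suc.prems by auto
  moreover have "agree t G (induced G (nbhd G T u)) w" if "(v, w) \<in> ?r" for w
    using Suc.IH[OF near[OF that]] Suc.prems by simp
  moreover have "agree t G (induced G (nbhd G T u)) v"
    using Suc.IH[OF Suc.prems(1)] Suc.prems by simp
  ultimately show ?case
    by (auto simp: children_def parents_def induced_def)
qed simp

section \<open>Rooted trees as relations\<close>

lemma single_valued_relpow_diff:
  assumes r: "single_valued r" and "(a, b) \<in> r ^^ i" "(a, c) \<in> r ^^ j" "i \<le> j"
  shows "(b, c) \<in> r ^^ (j - i)"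
  using assms(2-)
proof (induction i arbitrary: a j)
  case (Suc i)
  then obtain j' where j: "j = Suc j'" by (cases j) auto
  obtain b' where b': "(a, b') \<in> r" "(b', b) \<in> r ^^ i" using Suc.prems(1) by (meson relpow_Suc_D2)
  obtain c' where c': "(a, c') \<in> r" "(c', c) \<in> r ^^ j'" using Suc.prems(2) j by (meson relpow_Suc_D2)
  have "b' = c'" using r b' c' by (meson single_valuedD)
  then show ?case using Suc.IH[OF b'(2)] c' Suc.prems j by simp
qed auto

lemma relpow_converse_iff:
  fixes r :: "('a \<times> 'a) set"
  shows "(a, b) \<in> r\<inverse> ^^ j \<longleftrightarrow> (b, a) \<in> r ^^ j"
proof (induction j arbitrary: a)
  case (Suc j)
  have "(a, b) \<in> r\<inverse> ^^ Suc j \<longleftrightarrow> (\<exists>c. (a, c) \<in> r\<inverse> \<and> (c, b) \<in> r\<inverse> ^^ j)"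
    by (meson relpow_Suc_D2 relpow_Suc_I2)
  then show ?case using Suc by auto
qed auto

lemma injective_relpow_diff:
  assumes "single_valued (r\<inverse>)" and "(b, a) \<in> r ^^ i" "(c, a) \<in> r ^^ j" "i \<le> j"
  shows "(c, b) \<in> r ^^ (j - i)"
  using single_valued_relpow_diff[OF assms(1), of a b i c j] assms by (simp add: relpow_converse_iff)

lemma rooted_tree_single_valued: "rooted_tree G \<Longrightarrow> single_valued ((edges G)\<inverse>)"
  unfolding rooted_tree_def by (intro single_valuedI) auto

lemma rooted_tree_parent_unique: "rooted_tree G \<Longrightarrow> (u, v) \<in> edges G \<Longrightarrow> (u', v) \<in> edges G \<Longrightarrow> u = u'"
  unfolding rooted_tree_def by blast

lemma rooted_tree_ancestor_unique:
  "rooted_tree G \<Longrightarrow> (u, v) \<in> edges G ^^ j \<Longrightarrow> (u', v) \<in> edges G ^^ j \<Longrightarrow> u = u'"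
  using injective_relpow_diff[OF rooted_tree_single_valued, of G u v j u' j] by simp

lemma rooted_tree_ancestor_diff:
  "rooted_tree G \<Longrightarrow> (u, x) \<in> edges G ^^ i \<Longrightarrow> (v, x) \<in> edges G ^^ j \<Longrightarrow> i \<le> j \<Longrightarrow> (v, u) \<in> edges G ^^ (j - i)"
  by (rule injective_relpow_diff[OF rooted_tree_single_valued])

text \<open>Going round a cycle often enough gives an ascent from \<open>v\<close> that is longer
  than the depth of \<open>v\<close> and would pass above the root.\<close>

lemma rooted_tree_acyclic:
  assumes G: "rooted_tree G" and cyc: "(v, v) \<in> edges G ^^ j"
  shows "j = 0"
proof (rule ccontr)
  assume "j \<noteq> 0"
  obtain r where r: "\<And>u. (u, r) \<notin> edges G" and reach: "\<And>v. v \<in> verts G \<Longrightarrow> (r, v) \<in> (edges G)\<^sup>*"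
    using G unfolding rooted_tree_def by blast
  have "v \<in> verts G"
    using cyc \<open>j \<noteq> 0\<close> rooted_tree_edges[OF G] by (cases j) auto
  then obtain m where m: "(r, v) \<in> edges G ^^ m" using reach rtrancl_power by metis
  have "(v, v) \<in> edges G ^^ (j * k)" for k
    by (induction k) (use cyc relpow_add_I in fastforce)+
  then have "(v, v) \<in> edges G ^^ (j * Suc m)" .
  moreover have "m < j * Suc m" using \<open>j \<noteq> 0\<close> by (cases j) auto
  ultimately have "(v, r) \<in> edges G ^^ (j * Suc m - m)" "j * Suc m - m \<noteq> 0"
    using rooted_tree_ancestor_diff[OF G m] by auto
  then show False using r by (cases "j * Suc m - m") auto
qed


section \<open>Rake and compress\<close>

text \<open>Below, \<open>X\<close> is the set of nodes that remain after some rounds.\<close>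

definition unary :: "'v digraph \<Rightarrow> 'v set \<Rightarrow> 'v set" where
  "unary G X = {v \<in> X. \<exists>!u. u \<in> children G v \<and> u \<in> X}"

text \<open>The candidates for anchors: lower ends of unary paths with \<open>\<kappa> + 1\<close>
  nodes, as \<open>j = 0\<close> is included.\<close>

definition eligible :: "nat \<Rightarrow> 'v digraph \<Rightarrow> 'v set \<Rightarrow> 'v set" where
  "eligible \<kappa> G X = {x. \<forall>j\<le>\<kappa>. \<exists>v. (v, x) \<in> edges G ^^ j \<and> v \<in> unary G X}"

text \<open>In a rooted tree this is the union of all descending unary paths with
  \<open>\<kappa> + 1\<close> nodes; shorter unary chains stay.\<close>

definition compressed :: "nat \<Rightarrow> 'v digraph \<Rightarrow> 'v set \<Rightarrow> 'v set" where
  "compressed \<kappa> G X = {v. \<exists>j\<le>\<kappa>. \<exists>x. (v, x) \<in> edges G ^^ j \<and> x \<in> eligible \<kappa> G X}"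

text \<open>The first condition rakes, the second compresses. Starting from \<open>UNIV\<close>
  keeps the construction a function of the edges alone.\<close>

primrec remaining :: "nat \<Rightarrow> 'v digraph \<Rightarrow> nat \<Rightarrow> 'v set" where
  "remaining \<kappa> G 0 = UNIV"
| "remaining \<kappa> G (Suc i) = {v \<in> remaining \<kappa> G i. children G v \<inter> remaining \<kappa> G i \<noteq> {} \<and>
     v \<notin> compressed \<kappa> G (remaining \<kappa> G i)}"

definition near :: "nat \<Rightarrow> 'v digraph \<Rightarrow> 'v \<Rightarrow> 'v \<Rightarrow> bool" where
  "near \<kappa> G x y \<longleftrightarrow> (\<exists>j\<le>\<kappa>. (x, y) \<in> edges G ^^ j \<or> (y, x) \<in> edges G ^^ j)"

text \<open>A ruling set, obtained by resolving conflicts according to one bit of the identifiers at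
  a time.\<close>

primrec ruling :: "nat \<Rightarrow> nat digraph \<Rightarrow> nat set \<Rightarrow> nat \<Rightarrow> nat set" where
  "ruling \<kappa> G E 0 = E"
| "ruling \<kappa> G E (Suc t) = {x \<in> ruling \<kappa> G E t.
     bit x t \<longrightarrow> \<not> (\<exists>y\<in>ruling \<kappa> G E t. \<not> bit y t \<and> near \<kappa> G x y)}"

definition anchors :: "nat \<Rightarrow> nat \<Rightarrow> nat \<Rightarrow> nat digraph \<Rightarrow> nat set" where
  "anchors \<kappa> I b G = {x. \<exists>i<I. x \<in> ruling \<kappa> G (eligible \<kappa> G (remaining \<kappa> G i)) b}"

lemma remaining_antimono: "i \<le> j \<Longrightarrow> remaining \<kappa> G j \<subseteq> remaining \<kappa> G i"
  by (induction j rule: dec_induct) auto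

lemma ruling_antimono: "s \<le> t \<Longrightarrow> ruling \<kappa> G E t \<subseteq> ruling \<kappa> G E s"
  by (induction t rule: dec_induct) auto

lemma ruling_subset: "ruling \<kappa> G E t \<subseteq> E"
  using ruling_antimono[of 0 t] by simp

lemma local_desc:
  assumes "local t p" "j \<le> J"
  shows "local (t + J) (\<lambda>G v. \<exists>x. (v, x) \<in> edges G ^^ j \<and> p G x)"
proof -
  have "local (j + t) (\<lambda>G v. \<exists>x. (v, x) \<in> edges G ^^ j \<and> p G x)"
    unfolding local_def
  proof (intro allI impI)
    fix G H and v :: 'a assume ag: "agree (j + t) G H v"
    have "p G x = p H x" if "(v, x) \<in> edges G ^^ j" for x
      using assms(1) agree_relpow(3)[OF ag that] by (simp add: local_def)
    then show "(\<exists>x. (v, x) \<in> edges G ^^ j \<and> p G x) = (\<exists>x. (v, x) \<in> edges H ^^ j \<and> p H x)"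
      using agree_relpow(1)[OF ag] by blast
  qed
  then show ?thesis by (rule local_mono) (use assms in simp)
qed

lemma local_anc:
  assumes "local t p" "j \<le> J"
  shows "local (t + J) (\<lambda>G v. \<exists>x. (x, v) \<in> edges G ^^ j \<and> p G x)"
proof -
  have "local (j + t) (\<lambda>G v. \<exists>x. (x, v) \<in> edges G ^^ j \<and> p G x)"
    unfolding local_def
  proof (intro allI impI)
    fix G H and v :: 'a assume ag: "agree (j + t) G H v"
    have "p G x = p H x" if "(x, v) \<in> edges G ^^ j" for x
      using assms(1) agree_relpow(4)[OF ag that] by (simp add: local_def)
    then show "(\<exists>x. (x, v) \<in> edges G ^^ j \<and> p G x) = (\<exists>x. (x, v) \<in> edges H ^^ j \<and> p H x)"
      using agree_relpow(2)[OF ag] by blast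
  qed
  then show ?thesis by (rule local_mono) (use assms in simp)
qed

lemma local_ex: "(\<And>j. Q j \<Longrightarrow> local t (p j)) \<Longrightarrow> local t (\<lambda>G v. \<exists>j. Q j \<and> p j G v)"
  unfolding local_def by blast

lemma local_all: "(\<And>j. Q j \<Longrightarrow> local t (p j)) \<Longrightarrow> local t (\<lambda>G v. \<forall>j. Q j \<longrightarrow> p j G v)"
  unfolding local_def by blast

lemma local_unary:
  assumes "local t (\<lambda>G v. v \<in> X G)"
  shows "local (Suc t) (\<lambda>G v. v \<in> unary G (X G))"
  unfolding local_def
proof (intro allI impI)
  fix G H and v :: 'a assume ag: "agree (Suc t) G H v"
  then have "v \<in> X G \<longleftrightarrow> v \<in> X H" "children G v = children H v"
    "\<And>u. u \<in> children G v \<Longrightarrow> u \<in> X G \<longleftrightarrow> u \<in> X H"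
    using assms by (auto simp: local_def)
  then show "(v \<in> unary G (X G)) = (v \<in> unary H (X H))"
    unfolding unary_def by auto
qed

lemma local_eligible:
  assumes "local t (\<lambda>G v. v \<in> X G)"
  shows "local (Suc t + \<kappa>) (\<lambda>G v. v \<in> eligible \<kappa> G (X G))"
  unfolding eligible_def mem_Collect_eq
  by (intro local_all local_anc local_unary assms)

lemma local_compressed:
  assumes "local t (\<lambda>G v. v \<in> X G)"
  shows "local (Suc t + \<kappa> + \<kappa>) (\<lambda>G v. v \<in> compressed \<kappa> G (X G))"
  unfolding compressed_def mem_Collect_eq
  by (intro local_ex local_desc local_eligible assms)

text \<open>A round costs \<open>2 * \<kappa> + 1\<close>: up to \<open>\<kappa>\<close> steps down
  to an eligible node, \<open>\<kappa>\<close> steps up from there, and one to inspect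
  children.\<close>

lemma local_remaining: "local (i * (2 * \<kappa> + 1)) (\<lambda>G v. v \<in> remaining \<kappa> G i)"
proof (induction i)
  case (Suc i)
  show ?case unfolding local_def
  proof (intro allI impI)
    fix G H and v :: 'a assume ag: "agree (Suc i * (2 * \<kappa> + 1)) G H v"
    define m where "m = i * (2 * \<kappa> + 1)"
    have "agree (Suc m) G H v"
      using ag by (rule agree_mono[rotated]) (simp add: m_def)
    then have "v \<in> remaining \<kappa> G i \<longleftrightarrow> v \<in> remaining \<kappa> H i" "children G v = children H v"
      "\<And>u. u \<in> children G v \<Longrightarrow> u \<in> remaining \<kappa> G i \<longleftrightarrow> u \<in> remaining \<kappa> H i"
      using Suc unfolding m_def[symmetric] by (auto simp: local_def)
    moreover have "v \<in> compressed \<kappa> G (remaining \<kappa> G i) \<longleftrightarrow> v \<in> compressed \<kappa> H (remaining \<kappa> H i)"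
      by (rule localD[OF local_compressed[OF Suc] ag]) simp
    ultimately show "(v \<in> remaining \<kappa> G (Suc i)) = (v \<in> remaining \<kappa> H (Suc i))"
      by auto
  qed
qed (auto simp: local_def)

lemma local_ruling:
  assumes "local t (\<lambda>G v. v \<in> E G)"
  shows "local (t + s * \<kappa>) (\<lambda>G v. v \<in> ruling \<kappa> G (E G) s)"
proof (induction s)
  case (Suc s)
  let ?R = "\<lambda>G. ruling \<kappa> G (E G) s"
  let ?p = "\<lambda>G y. y \<in> ?R G \<and> \<not> bit y s"
  have p: "local (t + s * \<kappa>) ?p" using Suc unfolding local_def by blast
  have below: "local (t + s * \<kappa> + \<kappa>) (\<lambda>G x. (\<exists>j. j \<le> \<kappa> \<and> (\<exists>y. (x, y) \<in> edges G ^^ j \<and> ?p G y)))"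
    and above: "local (t + s * \<kappa> + \<kappa>) (\<lambda>G x. (\<exists>j. j \<le> \<kappa> \<and> (\<exists>y. (y, x) \<in> edges G ^^ j \<and> ?p G y)))"
    by (intro local_ex local_desc local_anc p; assumption)+
  have self: "local (t + s * \<kappa> + \<kappa>) (\<lambda>G v. v \<in> ?R G)"
    using Suc by (rule local_mono) simp
  have char: "x \<in> ruling \<kappa> G (E G) (Suc s) \<longleftrightarrow> x \<in> ?R G \<and> (bit x s \<longrightarrow>
      \<not> (\<exists>j. j \<le> \<kappa> \<and> (\<exists>y. (x, y) \<in> edges G ^^ j \<and> ?p G y)) \<and>
      \<not> (\<exists>j. j \<le> \<kappa> \<and> (\<exists>y. (y, x) \<in> edges G ^^ j \<and> ?p G y)))" for x G
    by (auto simp: near_def)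
  have "local (t + s * \<kappa> + \<kappa>) (\<lambda>G v. v \<in> ruling \<kappa> G (E G) (Suc s))"
    unfolding local_def
  proof (intro allI impI)
    fix G H :: "nat digraph" and v assume ag: "agree (t + s * \<kappa> + \<kappa>) G H v"
    note eqs = below[unfolded local_def, rule_format, OF ag]
      above[unfolded local_def, rule_format, OF ag] self[unfolded local_def, rule_format, OF ag]
    show "(v \<in> ruling \<kappa> G (E G) (Suc s)) = (v \<in> ruling \<kappa> H (E H) (Suc s))"
      unfolding char eqs ..
  qed
  then show ?case by (rule local_mono) simp
qed (use assms in simp)

lemma local_anchors:
  "local (I * (2 * \<kappa> + 1) + 1 + \<kappa> + b * \<kappa>) (\<lambda>G v. v \<in> anchors \<kappa> I b G)"
  unfolding anchors_def mem_Collect_eq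
proof (intro local_ex)
  fix i assume "i < I"
  have "local (Suc (i * (2 * \<kappa> + 1)) + \<kappa> + b * \<kappa>)
      (\<lambda>G v. v \<in> ruling \<kappa> G (eligible \<kappa> G (remaining \<kappa> G i)) b)"
    by (intro local_ruling local_eligible local_remaining)
  then show "local (I * (2 * \<kappa> + 1) + 1 + \<kappa> + b * \<kappa>)
      (\<lambda>G v. v \<in> ruling \<kappa> G (eligible \<kappa> G (remaining \<kappa> G i)) b)"
    by (rule local_mono) (use mult_le_mono1[of i I "2 * \<kappa> + 1"] \<open>i < I\<close> in simp)
qed

lemma compressed_subset_unary:
  assumes "rooted_tree G"
  shows "compressed \<kappa> G X \<subseteq> unary G X"
  using rooted_tree_ancestor_unique[OF assms] unfolding compressed_def eligible_def by blast

text \<open>Distinct identifiers below \<open>2 ^ b\<close> differ in some bit \<open>t < b\<close>,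
  and step \<open>t\<close> would have dropped the one whose bit is set.\<close>

lemma ruling_not_near:
  assumes x: "x \<in> ruling \<kappa> G E b" and y: "y \<in> ruling \<kappa> G E b"
    and b: "x < 2 ^ b" "y < 2 ^ b" and "near \<kappa> G x y"
  shows "x = y"
proof (rule ccontr)
  assume "x \<noteq> y"
  then obtain t where t: "bit x t \<noteq> bit y t" by (auto simp: bit_eq_iff)
  have "t < b"
  proof (rule ccontr)
    assume "\<not> t < b"
    then have "take_bit b x = x" "take_bit b y = y" using b by (simp_all add: take_bit_nat_eq_self)
    then show False using t \<open>\<not> t < b\<close> by (metis bit_take_bit_iff)
  qed
  then have "x \<in> ruling \<kappa> G E (Suc t)" "y \<in> ruling \<kappa> G E (Suc t)"
    using x y ruling_antimono[OF Suc_leI] by blast+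
  moreover have "near \<kappa> G y x" using \<open>near \<kappa> G x y\<close> by (auto simp: near_def)
  ultimately show False using t \<open>near \<kappa> G x y\<close> by auto
qed

text \<open>Between unary nodes of a rooted tree the edge relation is a partial injection: its
  components are paths, which can be followed uniquely in both directions.\<close>

definition chain :: "'v digraph \<Rightarrow> 'v set \<Rightarrow> ('v \<times> 'v) set" where
  "chain G X = {(u, v) \<in> edges G. u \<in> unary G X \<and> v \<in> unary G X}"

lemma chain_single_valued: "single_valued (chain G X)"
  by (rule single_valuedI) (auto simp: chain_def unary_def children_def)

lemma chain_injective: "rooted_tree G \<Longrightarrow> single_valued ((chain G X)\<inverse>)"
  using rooted_tree_parent_unique by (intro single_valuedI) (fastforce simp: chain_def)

lemma chain_relpow: "(u, v) \<in> chain G X ^^ j \<Longrightarrow> (u, v) \<in> edges G ^^ j"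
proof (induction j arbitrary: v)
  case (Suc j)
  then show ?case by (auto simp: chain_def)
qed auto

lemma chain_of_unary:
  assumes G: "rooted_tree G" and "(v, x) \<in> edges G ^^ j"
    and "\<And>i. i \<le> j \<Longrightarrow> \<exists>v. (v, x) \<in> edges G ^^ i \<and> v \<in> unary G X"
  shows "(v, x) \<in> chain G X ^^ j"
  using assms(2,3)
proof (induction j arbitrary: v)
  case (Suc j)
  then obtain w where w: "(v, w) \<in> edges G" "(w, x) \<in> edges G ^^ j" by (meson relpow_Suc_D2)
  obtain w' where "(w', x) \<in> edges G ^^ j" "w' \<in> unary G X" using Suc.prems(2)[of j] by auto
  then have "w \<in> unary G X" using rooted_tree_ancestor_unique[OF G w(2)] by simp
  moreover obtain v' where "(v', x) \<in> edges G ^^ Suc j" "v' \<in> unary G X"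
    using Suc.prems(2)[of "Suc j"] by blast
  then have "v \<in> unary G X" using rooted_tree_ancestor_unique[OF G Suc.prems(1)] by simp
  ultimately have "(v, w) \<in> chain G X" using w by (simp add: chain_def)
  moreover have "(w, x) \<in> chain G X ^^ j" using Suc.IH[OF w(2)] Suc.prems(2) by simp
  ultimately show ?case by (rule relpow_Suc_I2)
qed auto

lemma chain_of_eligible:
  assumes "rooted_tree G" "(v, x) \<in> edges G ^^ j" "j \<le> \<kappa>" "x \<in> eligible \<kappa> G X"
  shows "(v, x) \<in> chain G X ^^ j"
  using assms by (intro chain_of_unary) (auto simp: eligible_def)

text \<open>Nodes of one path are always comparable. For plain edges this fails when
  \<open>x\<close> and \<open>z\<close> lie in different branches below \<open>y\<close>.\<close>

lemma chain_comparable: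
  assumes G: "rooted_tree G"
    and 1: "(x, y) \<in> chain G X ^^ s \<or> (y, x) \<in> chain G X ^^ s"
    and 2: "(y, z) \<in> chain G X ^^ j \<or> (z, y) \<in> chain G X ^^ j"
  shows "\<exists>t\<le>s + j. (x, z) \<in> chain G X ^^ t \<or> (z, x) \<in> chain G X ^^ t"
proof -
  let ?r = "chain G X"
  note f = single_valued_relpow_diff[OF chain_single_valued[of G X]]
    and i = injective_relpow_diff[OF chain_injective[OF G, of X]]
  consider "(x, y) \<in> ?r ^^ s" "(y, z) \<in> ?r ^^ j" | "(x, y) \<in> ?r ^^ s" "(z, y) \<in> ?r ^^ j"
    | "(y, x) \<in> ?r ^^ s" "(y, z) \<in> ?r ^^ j" | "(y, x) \<in> ?r ^^ s" "(z, y) \<in> ?r ^^ j"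
    using 1 2 by blast
  then show ?thesis
  proof cases
    case 1
    then show ?thesis using relpow_add_I by (metis le_refl)
  next
    case 2
    show ?thesis
    proof (cases "s \<le> j")
      case True
      then show ?thesis using i[OF 2] by (intro exI[of _ "j - s"]) auto
    next
      case False
      then show ?thesis using i[OF 2(2,1)] by (intro exI[of _ "s - j"]) auto
    qed
  next
    case 3
    show ?thesis
    proof (cases "s \<le> j")
      case True
      then show ?thesis using f[OF 3] by (intro exI[of _ "j - s"]) auto
    next
      case False
      then show ?thesis using f[OF 3(2,1)] by (intro exI[of _ "s - j"]) auto
    qed
  next
    case 4
    then have "(z, x) \<in> ?r ^^ (j + s)" by (intro relpow_add_I)
    then show ?thesis by (metis add.commute le_refl)
  qed
qed

text \<open>A node dropped because of bit \<open>t\<close> has a nearby rival without this bit, and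
  that rival survives step \<open>t\<close>. So every bit costs at most \<open>\<kappa>\<close>
  further steps, all on the same chain.\<close>

lemma ruling_dominates:
  assumes G: "rooted_tree G" and x: "x \<in> eligible \<kappa> G X"
  shows "\<exists>y\<in>ruling \<kappa> G (eligible \<kappa> G X) t. \<exists>s\<le>\<kappa> * t.
    (x, y) \<in> chain G X ^^ s \<or> (y, x) \<in> chain G X ^^ s"
proof (induction t)
  case 0
  then show ?case using x by auto
next
  case (Suc t)
  let ?R = "ruling \<kappa> G (eligible \<kappa> G X)"
  obtain y s where y: "y \<in> ?R t" "s \<le> \<kappa> * t" "(x, y) \<in> chain G X ^^ s \<or> (y, x) \<in> chain G X ^^ s"
    using Suc by blast
  show ?case
  proof (cases "y \<in> ?R (Suc t)")
    case True
    then show ?thesis using y by (metis le_SucI mult_Suc_right trans_le_add2)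
  next
    case False
    then obtain z where z: "z \<in> ?R t" "\<not> bit z t" "near \<kappa> G y z" using y(1) by auto
    obtain j where j: "j \<le> \<kappa>" "(y, z) \<in> edges G ^^ j \<or> (z, y) \<in> edges G ^^ j"
      using z(3) by (auto simp: near_def)
    have "(y, z) \<in> chain G X ^^ j \<or> (z, y) \<in> chain G X ^^ j"
      using j chain_of_eligible[OF G] y(1) z(1) ruling_subset by (meson subsetD)
    then obtain s' where "s' \<le> s + j" "(x, z) \<in> chain G X ^^ s' \<or> (z, x) \<in> chain G X ^^ s'"
      using chain_comparable[OF G y(3)] by blast
    moreover have "z \<in> ?R (Suc t)" using z by simp
    ultimately show ?thesis using y(2) j(1) by (intro bexI exI[of _ s']) auto
  qed
qed

subsection \<open>Few rounds suffice\<close>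

text \<open>With \<open>L\<close> the raked nodes, the survivors are branching nodes, at most
  \<open>card L\<close> of them, and unary nodes on short chains, each charged to a leaf or
  branching node at most \<open>\<kappa>\<close> below it. So there are at most
  \<open>(2 * \<kappa> + 1) * card L\<close> survivors; since \<open>L\<close> itself disappears, a
  constant fraction is lost.\<close>

lemma remaining_shrinks:
  fixes G :: "'v digraph"
  assumes G: "rooted_tree G"
  shows "(2 * \<kappa> + 2) * card (verts G \<inter> remaining \<kappa> G (Suc i)) \<le>
    (2 * \<kappa> + 1) * card (verts G \<inter> remaining \<kappa> G i)"
proof -
  define X where "X = remaining \<kappa> G i"
  define V where "V = verts G \<inter> X"
  define ch where "ch = (\<lambda>v. children G v \<inter> X)"
  define L where "L = {v \<in> V. ch v = {}}"
  define U where "U = {v \<in> V. v \<in> unary G X}"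
  define B where "B = {v \<in> V. ch v \<noteq> {} \<and> v \<notin> unary G X}"
  define C where "C = U - compressed \<kappa> G X"
  note E = rooted_tree_edges[OF G]
  have fin: "finite V" using rooted_tree_finite[OF G] by (simp add: V_def)
  have chV: "ch v \<subseteq> V" for v using E by (auto simp: ch_def V_def children_def)
  have finch: "finite (ch v)" for v using chV fin finite_subset by metis
  have cardU: "card (ch v) = 1" if "v \<in> U" for v
  proof -
    have "\<exists>!u. u \<in> ch v" using that by (simp add: U_def unary_def ch_def)
    then obtain u where "ch v = {u}" by blast
    then show ?thesis by simp
  qed
  have cardB: "card (ch v) \<ge> 2" if "v \<in> B" for v
  proof -
    have "card (ch v) \<noteq> 0" using that finch by (auto simp: B_def)
    moreover have "card (ch v) \<noteq> 1"
    proof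
      assume "card (ch v) = 1"
      then obtain u where "ch v = {u}" using card_1_singletonE by metis
      then have "\<exists>!w. w \<in> ch v" by simp
      then have "\<exists>!u. u \<in> children G v \<and> u \<in> X" by (simp add: ch_def)
      then show False using that by (auto simp: B_def unary_def V_def)
    qed
    ultimately show ?thesis by linarith
  qed
  have V: "V = L \<union> U \<union> B" "L \<inter> U = {}" "(L \<union> U) \<inter> B = {}"
    by (auto simp: L_def U_def B_def unary_def ch_def)
  have finLUB: "finite L" "finite U" "finite B" using fin V by auto
  have cardV: "card V = card L + card U + card B"
    using V finLUB by (metis card_Un_disjoint finite_UnI)
  \<comment> \<open>Counting edges by parent and by child: leaves have none, branching nodes at
    least two children, whence \<open>card B \<le> card L\<close>.\<close>
  have "(\<Sum>v\<in>V. card (ch v)) = card (\<Union>v\<in>V. ch v)"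
  proof (rule card_UN_disjoint[symmetric])
    show "\<forall>v\<in>V. \<forall>w\<in>V. v \<noteq> w \<longrightarrow> ch v \<inter> ch w = {}"
      using rooted_tree_parent_unique[OF G] by (auto simp: ch_def children_def)
  qed (use fin finch in auto)
  also have "\<dots> \<le> card V" using chV fin by (intro card_mono) auto
  finally have "(\<Sum>v\<in>V. card (ch v)) \<le> card V" .
  moreover have "(\<Sum>v\<in>V. card (ch v)) = (\<Sum>v\<in>L. card (ch v)) + (\<Sum>v\<in>U. card (ch v)) + (\<Sum>v\<in>B. card (ch v))"
    unfolding V(1) using V finLUB by (simp add: sum.union_disjoint)
  moreover have "(\<Sum>v\<in>U. card (ch v)) = card U" using cardU by simp
  moreover have "(\<Sum>v\<in>B. card (ch v)) \<ge> 2 * card B"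
    using sum_mono[of B "\<lambda>_. 2" "\<lambda>v. card (ch v)"] cardB by simp
  ultimately have BL: "card B \<le> card L" using cardV by linarith
  \<comment> \<open>Otherwise the only remaining child can be followed for \<open>\<kappa>\<close>
    steps among unary nodes, which ends in an eligible node and makes \<open>v\<close>
    compressed.\<close>
  have ex: "\<exists>j\<in>{1..\<kappa>}. \<exists>w\<in>L \<union> B. (v, w) \<in> edges G ^^ j" if v: "v \<in> C" for v
  proof (rule ccontr)
    assume none: "\<not> ?thesis"
    have "\<exists>w\<in>U. (v, w) \<in> chain G X ^^ j" if "j \<le> \<kappa>" for j
      using that
    proof (induction j)
      case 0
      then show ?case using v by (auto simp: C_def)
    next
      case (Suc j)
      then obtain w where w: "w \<in> U" "(v, w) \<in> chain G X ^^ j" by auto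
      then obtain u where u: "u \<in> ch w" by (auto simp: U_def unary_def ch_def)
      then have wu: "(w, u) \<in> edges G" by (auto simp: ch_def children_def)
      then have "(v, u) \<in> edges G ^^ Suc j" using chain_relpow[OF w(2)] by auto
      then have "u \<notin> L \<union> B" using none Suc.prems by (auto simp del: relpow.simps)
      then have "u \<in> U" using u chV[of w] V(1) by auto
      moreover have "(w, u) \<in> chain G X" using wu w(1) \<open>u \<in> U\<close> by (auto simp: chain_def U_def)
      ultimately show ?case using w(2) by auto
    qed
    then obtain w where w: "w \<in> U" "(v, w) \<in> chain G X ^^ \<kappa>" by auto
    have "\<exists>z. (z, w) \<in> edges G ^^ j \<and> z \<in> unary G X" if "j \<le> \<kappa>" for j
    proof -
      have "\<kappa> = (\<kappa> - j) + j" using that by simp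
      then have "(v, w) \<in> chain G X ^^ (\<kappa> - j) O chain G X ^^ j" using w(2) relpow_add by metis
      then obtain z where z: "(v, z) \<in> chain G X ^^ (\<kappa> - j)" "(z, w) \<in> chain G X ^^ j" by auto
      have "z \<in> unary G X"
        using z(1) v by (cases "\<kappa> - j") (auto simp: C_def U_def chain_def)
      then show ?thesis using chain_relpow[OF z(2)] by blast
    qed
    then have "w \<in> eligible \<kappa> G X" by (auto simp: eligible_def)
    then have "v \<in> compressed \<kappa> G X"
      using chain_relpow[OF w(2)] by (auto simp: compressed_def)
    then show False using v by (simp add: C_def)
  qed
  \<comment> \<open>The charge \<open>(j, w)\<close> determines \<open>v\<close> as the
    \<open>j\<close>-th ancestor of \<open>w\<close>.\<close>
  have "C \<subseteq> (\<lambda>(j, w). THE v. (v, w) \<in> edges G ^^ j) ` ({1..\<kappa>} \<times> (L \<union> B))"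
  proof
    fix v assume "v \<in> C"
    then obtain j w where jw: "j \<in> {1..\<kappa>}" "w \<in> L \<union> B" "(v, w) \<in> edges G ^^ j" using ex by blast
    then have "(THE v. (v, w) \<in> edges G ^^ j) = v"
      using rooted_tree_ancestor_unique[OF G] by blast
    then show "v \<in> (\<lambda>(j, w). THE v. (v, w) \<in> edges G ^^ j) ` ({1..\<kappa>} \<times> (L \<union> B))"
      using jw by (auto intro!: rev_image_eqI[of "(j, w)"])
  qed
  then have "card C \<le> card ({1..\<kappa>} \<times> (L \<union> B))"
    using finLUB by (intro surj_card_le[of _ _ "\<lambda>(j, w). THE v. (v, w) \<in> edges G ^^ j"]) auto
  also have "\<dots> = \<kappa> * (card L + card B)"
    using V finLUB by (simp add: card_cartesian_product card_Un_disjoint Int_Un_distrib2)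
  finally have cardC: "card C \<le> \<kappa> * (card L + card B)" .
  have "verts G \<inter> remaining \<kappa> G (Suc i) \<subseteq> B \<union> C"
    unfolding C_def U_def B_def V_def ch_def X_def by auto
  then have "card (verts G \<inter> remaining \<kappa> G (Suc i)) \<le> card B + card C"
    using finLUB by (intro order.trans[OF card_mono card_Un_le]) (auto simp: C_def)
  also have "\<dots> \<le> card L + \<kappa> * (card L + card L)"
    using BL by (intro add_mono order.trans[OF cardC] mult_le_mono2) auto
  finally have 1: "card (verts G \<inter> remaining \<kappa> G (Suc i)) \<le> (2 * \<kappa> + 1) * card L"
    by (simp add: algebra_simps)
  have "verts G \<inter> remaining \<kappa> G (Suc i) \<subseteq> V - L"
    unfolding V_def L_def ch_def X_def by auto
  then have "card (verts G \<inter> remaining \<kappa> G (Suc i)) \<le> card V - card L"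
    using fin by (metis L_def card_Diff_subset card_mono finLUB(1) finite_Diff mem_Collect_eq subsetI)
  moreover have "card L \<le> card V" using cardV by simp
  ultimately have "card (verts G \<inter> remaining \<kappa> G (Suc i)) + card L \<le> card V" by simp
  then have "(2 * \<kappa> + 1) * (card (verts G \<inter> remaining \<kappa> G (Suc i)) + card L) \<le> (2 * \<kappa> + 1) * card V"
    by (rule mult_le_mono2)
  then show ?thesis using 1 by (simp add: V_def X_def algebra_simps)
qed

text \<open>Bernoulli's inequality \<open>(1 + 1/q) ^ m \<ge> 1 + m/q\<close> at
  \<open>m = q\<close>, cleared of fractions. With \<open>q = 2 * \<kappa> + 1\<close> it says that
  \<open>q\<close> rounds halve the number of remaining nodes.\<close>

lemma two_power_le_Suc_power:
  fixes q :: nat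
  assumes "q > 0"
  shows "2 * q ^ q \<le> Suc q ^ q"
proof -
  have "q ^ m * (q + m) \<le> Suc q ^ m * q" for m
  proof (induction m)
    case (Suc m)
    have "q ^ Suc m * (q + Suc m) \<le> Suc q * (q ^ m * (q + m))"
      by (simp add: algebra_simps)
    also have "\<dots> \<le> Suc q * (Suc q ^ m * q)" using Suc by (rule mult_le_mono2)
    finally show ?case by (simp add: algebra_simps)
  qed simp
  from this[of q] have "q * (2 * q ^ q) \<le> q * Suc q ^ q"
    by (simp only: mult_2 algebra_simps)
  then show ?thesis using assms by (rule mult_le_cancel1[THEN iffD1, rule_format])
qed

lemma remaining_empty:
  assumes G: "rooted_tree G" and b: "card (verts G) < 2 ^ b"
  shows "verts G \<inter> remaining \<kappa> G ((2 * \<kappa> + 1) * b) = {}"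
proof -
  let ?q = "2 * \<kappa> + 1"
  let ?V = "\<lambda>i. verts G \<inter> remaining \<kappa> G i"
  have step: "Suc ?q ^ i * card (?V i) \<le> ?q ^ i * card (verts G)" for i
  proof (induction i)
    case (Suc i)
    have "Suc ?q ^ Suc i * card (?V (Suc i)) = Suc ?q ^ i * ((2 * \<kappa> + 2) * card (?V (Suc i)))"
      by (simp add: algebra_simps)
    also have "\<dots> \<le> Suc ?q ^ i * (?q * card (?V i))"
      using remaining_shrinks[OF G, of \<kappa> i] by (rule mult_le_mono2)
    also have "\<dots> = ?q * (Suc ?q ^ i * card (?V i))" by (simp only: mult.left_commute)
    also have "\<dots> \<le> ?q * (?q ^ i * card (verts G))" using Suc by (rule mult_le_mono2)
    finally show ?case by (simp only: power_Suc mult.assoc)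
  qed simp
  have "(2 * ?q ^ ?q) ^ b * card (?V (?q * b)) \<le> (Suc ?q ^ ?q) ^ b * card (?V (?q * b))"
    by (intro mult_le_mono1 power_mono two_power_le_Suc_power) simp_all
  also have "\<dots> \<le> (?q ^ ?q) ^ b * card (verts G)" using step[of "?q * b"] by (simp only: power_mult)
  finally have "(?q ^ ?q) ^ b * (2 ^ b * card (?V (?q * b))) \<le> (?q ^ ?q) ^ b * card (verts G)"
    by (simp only: power_mult_distrib mult.assoc mult.left_commute)
  then have "2 ^ b * card (?V (?q * b)) \<le> card (verts G)" by simp
  then have "2 ^ b * card (?V (?q * b)) < 2 ^ b * 1" using b by linarith
  then have "card (?V (?q * b)) < 1" by (rule mult_less_cancel1[THEN iffD1, THEN conjunct2])
  then have "card (?V (?q * b)) = 0" by linarith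
  then show ?thesis using rooted_tree_finite[OF G] by simp
qed

subsection \<open>Every node is close to an anchor above it\<close>

text \<open>Roots count like anchors, because the labeling may start afresh at both.\<close>

definition hit :: "'v digraph \<Rightarrow> 'v set \<Rightarrow> nat \<Rightarrow> 'v \<Rightarrow> bool" where
  "hit G A d v \<longleftrightarrow> (\<exists>j\<le>d. \<exists>z. (z, v) \<in> edges G ^^ j \<and> (z \<in> A \<or> parents G z = {}))"

lemma hit_mono: "hit G A d v \<Longrightarrow> d \<le> d' \<Longrightarrow> hit G A d' v"
  unfolding hit_def by (meson order_trans)

lemma hit_descendant: "(p, v) \<in> edges G ^^ j \<Longrightarrow> hit G A d p \<Longrightarrow> hit G A (d + j) v"
  unfolding hit_def by (meson add_le_mono1 relpow_add_I)

lemma hit_ancestor: "(z, v) \<in> edges G ^^ j \<Longrightarrow> z \<in> A \<Longrightarrow> j \<le> d \<Longrightarrow> hit G A d v"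
  unfolding hit_def by blast

lemma climb:
  assumes "q \<in> C"
  shows "(\<exists>j\<le>W. \<exists>z. (z, q) \<in> edges G ^^ j \<and> z \<in> C \<and> (\<forall>p\<in>parents G z. p \<notin> C)) \<or>
    (\<forall>j\<le>W. \<exists>z. (z, q) \<in> edges G ^^ j \<and> z \<in> C)"
proof (induction W)
  case (Suc W)
  show ?case
  proof (cases "\<exists>j\<le>W. \<exists>z. (z, q) \<in> edges G ^^ j \<and> z \<in> C \<and> (\<forall>p\<in>parents G z. p \<notin> C)")
    case True
    then show ?thesis by (meson le_SucI)
  next
    case False
    then have all: "\<forall>j\<le>W. \<exists>z. (z, q) \<in> edges G ^^ j \<and> z \<in> C" using Suc by blast
    then obtain z where z: "(z, q) \<in> edges G ^^ W" "z \<in> C" by blast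
    then obtain p where p: "p \<in> parents G z" "p \<in> C" using False by blast
    then have "(p, q) \<in> edges G ^^ Suc W" using z(1) by (intro relpow_Suc_I2) (auto simp: parents_def)
    then show ?thesis using all p(2) by (metis le_Suc_eq)
  qed
qed (use assms in auto)

lemma eligible_compressed: "x \<in> eligible \<kappa> G X \<Longrightarrow> x \<in> compressed \<kappa> G X"
  unfolding compressed_def by (auto intro!: exI[of _ 0])

text \<open>When \<open>p\<close> was removed, its child \<open>v\<close> was still there, so
  \<open>p\<close> was compressed rather than raked. As \<open>v\<close> was not compressed,
  \<open>p\<close> is the lower end of its chain. The ruling node that dominates \<open>p\<close>
  lies on this chain, hence above \<open>p\<close>.\<close>

lemma entering_hits:
  assumes G: "rooted_tree G" and pv: "(p, v) \<in> edges G"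
    and p: "p \<notin> remaining \<kappa> G i" and v: "v \<in> remaining \<kappa> G i" and "i \<le> I"
  shows "hit G (anchors \<kappa> I b G) (\<kappa> * b) p"
proof -
  let ?X = "remaining \<kappa> G"
  define i' where "i' = (LEAST k. p \<notin> ?X (Suc k))"
  obtain k where "i = Suc k" using p by (cases i) auto
  then have k: "p \<notin> ?X (Suc k)" "k < i" using p by auto
  have i'X: "p \<notin> ?X (Suc i')" unfolding i'_def using k(1) by (rule LeastI)
  have "i' \<le> k" unfolding i'_def using k(1) by (rule Least_le)
  have pX: "p \<in> ?X i'"
  proof (cases i')
    case (Suc m)
    then have "m < (LEAST k. p \<notin> ?X (Suc k))" by (simp add: i'_def)
    then show ?thesis using not_less_Least Suc by blast
  qed simp
  have vS: "v \<in> ?X (Suc i')" "v \<in> ?X i'"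
    using v remaining_antimono[of "Suc i'" i \<kappa> G] remaining_antimono[of i' i \<kappa> G] \<open>i' \<le> k\<close> k(2)
    by (meson Suc_leI le_less_trans less_imp_le subsetD)+
  have vch: "v \<in> children G p" using pv by (simp add: children_def)
  then have "p \<in> compressed \<kappa> G (?X i')" using i'X pX vS by auto
  then obtain j x where j: "j \<le> \<kappa>" "(p, x) \<in> edges G ^^ j" and x: "x \<in> eligible \<kappa> G (?X i')"
    by (auto simp: compressed_def)
  have unp: "p \<in> unary G (?X i')"
    using \<open>p \<in> compressed \<kappa> G (?X i')\<close> compressed_subset_unary[OF G] by blast
  have only: "c = v" if "(p, c) \<in> edges G" "c \<in> unary G (?X i')" for c
    using that unp vch vS by (auto simp: unary_def children_def)
  have "j = 0"
  proof (rule ccontr)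
    assume "j \<noteq> 0"
    then obtain m where m: "j = Suc m" by (cases j) auto
    then obtain c where c: "(p, c) \<in> edges G" "(c, x) \<in> edges G ^^ m"
      using j by (meson relpow_Suc_D2)
    then have "c \<in> compressed \<kappa> G (?X i')" using j m x unfolding compressed_def by (blast intro: Suc_leD)
    then have "v \<in> compressed \<kappa> G (?X i')" using only[OF c(1)] compressed_subset_unary[OF G] by blast
    then show False using vS by simp
  qed
  then have pe: "p \<in> eligible \<kappa> G (?X i')" using j x by simp
  obtain y s where y: "y \<in> ruling \<kappa> G (eligible \<kappa> G (?X i')) b" "s \<le> \<kappa> * b"
    and s: "(p, y) \<in> chain G (?X i') ^^ s \<or> (y, p) \<in> chain G (?X i') ^^ s"
    using ruling_dominates[OF G pe] by blast
  have yA: "y \<in> anchors \<kappa> I b G"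
    using y(1) \<open>i' \<le> k\<close> k(2) \<open>i \<le> I\<close> by (auto simp: anchors_def intro!: exI[of _ i'])
  have "(y, p) \<in> chain G (?X i') ^^ s"
  proof (cases s)
    case 0
    then show ?thesis using s by auto
  next
    case (Suc m)
    have "(p, y) \<notin> chain G (?X i') ^^ s"
    proof
      assume "(p, y) \<in> chain G (?X i') ^^ s"
      then obtain c where "(p, c) \<in> chain G (?X i')" using Suc by (meson relpow_Suc_D2)
      then have "v \<in> unary G (?X i')" using only[of c] by (auto simp: chain_def)
      have "\<exists>w. (w, v) \<in> edges G ^^ j \<and> w \<in> unary G (?X i')" if jk: "j \<le> \<kappa>" for j
      proof (cases j)
        case 0
        then show ?thesis using \<open>v \<in> unary G (?X i')\<close> by auto
      next
        case (Suc m)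
        then have "m \<le> \<kappa>" using jk by simp
        then obtain w where "(w, p) \<in> edges G ^^ m" "w \<in> unary G (?X i')"
          using pe unfolding eligible_def by blast
        then show ?thesis using pv Suc by auto
      qed
      then have "v \<in> eligible \<kappa> G (?X i')" by (simp add: eligible_def)
      from eligible_compressed[OF this] show False using vS by simp
    qed
    then show ?thesis using s by blast
  qed
  then show ?thesis using hit_ancestor[OF chain_relpow yA y(2)] by blast
qed

text \<open>The ancestor \<open>q'\<close> at height \<open>\<kappa> * b + 1\<close> has
  \<open>\<kappa>\<close> unary ancestors itself, so it is eligible. A ruling node dominating it is
  at most \<open>\<kappa> * b\<close> steps away and thus above \<open>q\<close>, even if it is
  below \<open>q'\<close>.\<close>

lemma long_chain_hits:
  assumes G: "rooted_tree G"
    and all: "\<And>j. j \<le> \<kappa> * b + 1 + \<kappa> \<Longrightarrow> \<exists>z. (z, q) \<in> edges G ^^ j \<and> z \<in> compressed \<kappa> G (remaining \<kappa> G i)"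
    and "i < I"
  shows "hit G (anchors \<kappa> I b G) (2 * \<kappa> * b + 1) q"
proof -
  let ?X = "remaining \<kappa> G i"
  let ?m = "\<kappa> * b + 1"
  have un: "\<exists>z. (z, q) \<in> edges G ^^ j \<and> z \<in> unary G ?X" if "j \<le> ?m + \<kappa>" for j
    using all[OF that] compressed_subset_unary[OF G] by blast
  obtain q' where q': "(q', q) \<in> edges G ^^ ?m" using un[of ?m] by auto
  have chain: "(q', q) \<in> chain G ?X ^^ ?m" using q' un by (intro chain_of_unary[OF G]) auto
  have "\<exists>z. (z, q') \<in> edges G ^^ j \<and> z \<in> unary G ?X" if jk: "j \<le> \<kappa>" for j
  proof -
    obtain z where z: "(z, q) \<in> edges G ^^ (?m + j)" "z \<in> unary G ?X" using un[OF add_left_mono[OF jk]] by blast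
    then have "(z, q') \<in> edges G ^^ j" using rooted_tree_ancestor_diff[OF G q' z(1)] by simp
    then show ?thesis using z by blast
  qed
  then have "q' \<in> eligible \<kappa> G ?X" by (simp add: eligible_def)
  then obtain y s where y: "y \<in> ruling \<kappa> G (eligible \<kappa> G ?X) b" "s \<le> \<kappa> * b"
    and s: "(q', y) \<in> chain G ?X ^^ s \<or> (y, q') \<in> chain G ?X ^^ s"
    using ruling_dominates[OF G] by blast
  have yA: "y \<in> anchors \<kappa> I b G" using y(1) \<open>i < I\<close> by (auto simp: anchors_def)
  from s show ?thesis
  proof
    assume "(y, q') \<in> chain G ?X ^^ s"
    then have "(y, q) \<in> edges G ^^ (s + ?m)" using chain chain_relpow relpow_add_I by metis
    then show ?thesis by (rule hit_ancestor[OF _ yA]) (use y(2) in simp)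
  next
    assume "(q', y) \<in> chain G ?X ^^ s"
    from single_valued_relpow_diff[OF chain_single_valued this chain]
    have "(y, q) \<in> edges G ^^ (?m - s)" using y(2) chain_relpow by fastforce
    then show ?thesis by (rule hit_ancestor[OF _ yA]) simp
  qed
qed

text \<open>Induction on the rounds left, each costing at most \<open>Q\<close>: from a node removed
  in round \<open>i\<close>, a climb ends at the root, at an ancestor removed earlier, on a long
  compressed chain, or at an ancestor that survives the round. \<open>Q\<close> adds
  \<open>\<kappa> * b + \<kappa> + 1\<close> for climbing a chain, \<open>\<kappa> * b\<close> for
  reaching an anchor, and some single edges.\<close>

lemma anchors_hit:
  assumes G: "rooted_tree G" and b: "card (verts G) < 2 ^ b"
    and I: "I = (2 * \<kappa> + 1) * b" and Q: "Q = 2 * \<kappa> * b + \<kappa> + 4"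
    and v: "v \<in> verts G"
  shows "hit G (anchors \<kappa> I b G) (I * Q) v"
proof -
  let ?X = "remaining \<kappa> G"
  let ?hit = "hit G (anchors \<kappa> I b G)"
  let ?W = "\<kappa> * b + 1 + \<kappa>"
  note E = rooted_tree_edges[OF G]
  have anc_verts: "z \<in> verts G" if "(z, v) \<in> edges G ^^ j" "v \<in> verts G" for z v j
    using that E by (cases j) (auto dest!: relpow_Suc_D2 simp del: relpow.simps(2))
  have "?hit (n * Q) v" if "v \<in> ?X i" "v \<in> verts G" "i + n = I" for n i v
    using that
  proof (induction n arbitrary: i v)
    case 0
    then have "v \<in> verts G \<inter> ?X I" by simp
    then show ?case using remaining_empty[OF G b] I by auto
  next
    case (Suc n)
    have iI: "i < I" using Suc.prems by simp
    have IH: "?hit (n * Q) u" if "u \<in> ?X (Suc i)" "u \<in> verts G" for u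
      using Suc.IH[OF that] Suc.prems by simp
    have small: "d \<le> Q \<Longrightarrow> ?hit d u \<Longrightarrow> ?hit (Suc n * Q) u" for d u
      by (erule hit_mono) simp
    have step: "?hit (Suc n * Q) u" if "(p, u) \<in> edges G ^^ j" "?hit d p" "d + j \<le> Suc n * Q" for p u j d
      using hit_mono[OF hit_descendant[OF that(1,2)] that(3)] .
    show ?case
    proof (cases "v \<in> ?X (Suc i) \<or> parents G v = {}")
      case True
      then show ?thesis
      proof
        assume "v \<in> ?X (Suc i)"
        from hit_mono[OF IH[OF this Suc.prems(2)]] show ?thesis by simp
      next
        assume "parents G v = {}"
        then have "?hit 0 v" by (auto simp: hit_def)
        then show ?thesis by (rule hit_mono) simp
      qed
    next
      case False
      then obtain p where "(p, v) \<in> edges G" by (auto simp: parents_def)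
      then have p: "(p, v) \<in> edges G ^^ 1" "(p, v) \<in> edges G" by auto
      have pG: "p \<in> verts G" using p(2) E by auto
      show ?thesis
      proof (cases "p \<in> ?X i")
        case notin: False
        show ?thesis
          by (rule step[OF p(1) entering_hits[OF G p(2) notin Suc.prems(1)]]) (use iI Q in auto)
      next
        case pX: True
        have vch: "v \<in> children G p \<inter> ?X i" using p Suc.prems by (auto simp: children_def)
        let ?C = "compressed \<kappa> G (?X i)"
        show ?thesis
        proof (cases "p \<in> ?C")
          case notin: False
          then have "p \<in> ?X (Suc i)" using pX vch by auto
          then show ?thesis using step[OF p(1) IH] pG Q by simp
        next
          case pC: True
          from climb[OF this, of ?W G] show ?thesis
          proof
            assume "\<forall>j\<le>?W. \<exists>z. (z, p) \<in> edges G ^^ j \<and> z \<in> ?C"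
            then have "?hit (2 * \<kappa> * b + 1) p" using long_chain_hits[OF G _ iI] by blast
            from step[OF p(1) this] show ?thesis using Q by simp
          next
            assume "\<exists>j\<le>?W. \<exists>z. (z, p) \<in> edges G ^^ j \<and> z \<in> ?C \<and> (\<forall>p\<in>parents G z. p \<notin> ?C)"
            then obtain j z where j: "j \<le> ?W" "(z, p) \<in> edges G ^^ j" and z: "z \<in> ?C"
              and top: "\<And>p. p \<in> parents G z \<Longrightarrow> p \<notin> ?C" by blast
            have zv: "(z, v) \<in> edges G ^^ Suc j" using j(2) p(2) by auto
            have zX: "z \<in> ?X i" using z compressed_subset_unary[OF G] by (auto simp: unary_def)
            have jQ: "\<kappa> * b + Suc (Suc j) \<le> Q" using j(1) Q by simp
            show ?thesis
            proof (cases "parents G z = {}")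
              case True
              then have "?hit 0 z" by (auto simp: hit_def)
              from step[OF zv this] show ?thesis using jQ by simp
            next
              case False
              then obtain p' where "p' \<in> parents G z" by blast
              then have p': "(p', z) \<in> edges G" "p' \<notin> ?C" using top by (auto simp: parents_def)
              have p'v: "(p', v) \<in> edges G ^^ Suc (Suc j)" using p'(1) zv by (rule relpow_Suc_I2)
              have p'G: "p' \<in> verts G" using p'(1) E by auto
              show ?thesis
              proof (cases "p' \<in> ?X i")
                case notin: False
                show ?thesis
                  by (rule step[OF p'v entering_hits[OF G p'(1) notin zX]]) (use iI jQ in auto)
              next
                case True
                then have "p' \<in> ?X (Suc i)" using p' zX by (auto simp: children_def)
                from step[OF p'v IH[OF this p'G]] show ?thesis using jQ by simp
              qed
            qed
          qed
        qed
      qed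
    qed
  qed
  from this[of v 0 I] show ?thesis using v by simp
qed


subsection \<open>Labeling from the anchors downwards\<close>

text \<open>The \<open>\<kappa>\<close> nodes above an anchor are unary in its round, so no other anchor interferes, and
  from the topmost one every label admits a walk of length \<open>\<kappa>\<close> to \<open>s\<close>.\<close>

definition target :: "nat \<Rightarrow> 'l set \<Rightarrow> ('l \<times> 'l) set \<Rightarrow> 'l \<Rightarrow> 'v digraph \<Rightarrow> 'v set \<Rightarrow> 'v \<Rightarrow> 'l set" where
  "target \<kappa> S r s G A v =
     {a \<in> S. \<forall>j\<le>\<kappa>. \<forall>x. (v, x) \<in> edges G ^^ j \<longrightarrow> x \<in> A \<longrightarrow> (a, s) \<in> r ^^ j}"

definition extends :: "'l lcl \<Rightarrow> 'v set \<Rightarrow> ('v \<Rightarrow> 'l set) \<Rightarrow> 'l \<Rightarrow> ('v \<Rightarrow> 'l) \<Rightarrow> bool" where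
  "extends P U W a f \<longleftrightarrow> (\<exists>us. distinct us \<and> set us = U \<and> (a, map f us) \<in> configs P) \<and>
     (\<forall>u\<in>U. f u \<in> W u)"

text \<open>Each node recomputes the labels of its ancestors, with \<open>d\<close> bounding the
  climb. The choice of \<open>f\<close> depends on the parent only, so siblings choose the same
  configuration without communication.\<close>

primrec top_down :: "'l lcl \<Rightarrow> nat \<Rightarrow> 'l set \<Rightarrow> 'l \<Rightarrow> ('v digraph \<Rightarrow> 'v set) \<Rightarrow> nat \<Rightarrow> 'v digraph \<Rightarrow> 'v \<Rightarrow> 'l" where
  "top_down P \<kappa> S s A 0 G v = s"
| "top_down P \<kappa> S s A (Suc d) G v =
     (if v \<notin> A G \<and> is_singleton (parents G v)
      then let p = the_elem (parents G v) in
        (SOME f. extends P (children G p) (target \<kappa> S (steps P S) s G (A G))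
          (top_down P \<kappa> S s A d G p) f) v
      else s)"

lemma local_target:
  assumes "local t (\<lambda>G v. v \<in> A G)"
  shows "local (t + \<kappa>) (\<lambda>G v. target \<kappa> S r s G (A G) v)"
proof -
  have "local (t + \<kappa>) (\<lambda>G v. \<exists>x. (v, x) \<in> edges G ^^ j \<and> x \<in> A G)" if "j \<le> \<kappa>" for j
    by (rule local_desc[OF assms that])
  moreover have "target \<kappa> S r s G (A G) v =
      {a \<in> S. \<forall>j\<le>\<kappa>. (\<exists>x. (v, x) \<in> edges G ^^ j \<and> x \<in> A G) \<longrightarrow> (a, s) \<in> r ^^ j}" for G v
    by (auto simp: target_def)
  ultimately show ?thesis unfolding local_def by simp
qed

lemma extends_cong:
  "U = U' \<Longrightarrow> (\<And>u. u \<in> U \<Longrightarrow> W u = W' u) \<Longrightarrow> extends P U W = extends P U' W'"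
  unfolding extends_def by (intro ext) auto

lemma local_top_down:
  assumes A: "local t (\<lambda>G v. v \<in> A G)"
  shows "local (t + \<kappa> + 2 + d) (top_down P \<kappa> S s A d)"
proof (induction d)
  case (Suc d)
  show ?case unfolding local_def
  proof (intro allI impI)
    fix G H and v :: 'a
    define m where "m = t + \<kappa> + 2 + d"
    assume "agree (t + \<kappa> + 2 + Suc d) G H v"
    then have ag: "agree (Suc m) G H v" by (simp add: m_def)
    then have par: "parents G v = parents H v" and agp: "\<And>p. p \<in> parents G v \<Longrightarrow> agree m G H p"
      by auto
    have vA: "v \<in> A G \<longleftrightarrow> v \<in> A H" by (rule localD[OF A ag]) (simp add: m_def)
    show "top_down P \<kappa> S s A (Suc d) G v = top_down P \<kappa> S s A (Suc d) H v"
    proof (cases "is_singleton (parents G v)")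
      case True
      define p where "p = the_elem (parents G v)"
      have "parents G v = {p}" using True by (simp add: p_def is_singleton_the_elem)
      then have p: "p \<in> parents G v" by simp
      have pH: "p = the_elem (parents H v)" by (simp add: p_def par)
      have "top_down P \<kappa> S s A d G p = top_down P \<kappa> S s A d H p"
        by (rule localD[OF Suc agp[OF p]]) (simp add: m_def)
      moreover have "agree (Suc (m - 1)) G H p" using agp[OF p] by (simp add: m_def)
      then have ch: "children G p = children H p"
        and agc: "\<And>u. u \<in> children G p \<Longrightarrow> agree (m - 1) G H u" by auto
      have "target \<kappa> S (steps P S) s G (A G) u = target \<kappa> S (steps P S) s H (A H) u"
        if "u \<in> children G p" for u
        by (rule localD[OF local_target[OF A] agc[OF that]]) (simp add: m_def)
      with ch have "extends P (children G p) (target \<kappa> S (steps P S) s G (A G)) =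
          extends P (children H p) (target \<kappa> S (steps P S) s H (A H))"
        by (rule extends_cong)
      ultimately show ?thesis
        by (simp add: par vA Let_def flip: pH)
    next
      case False
      then show ?thesis by (simp add: par)
    qed
  qed
qed (simp add: local_def)

text \<open>Configurations allow any order of the children, so \<open>u\<close> can be enumerated at
  the position of \<open>b\<close>.\<close>

lemma extends_exists:
  assumes bs: "(a, bs) \<in> configs P" "b \<in> set bs" and U: "finite U" "card U = length bs" "u \<in> U"
    and W: "b \<in> W u" "\<And>w. w \<in> U \<Longrightarrow> w \<noteq> u \<Longrightarrow> set bs \<subseteq> W w"
  shows "\<exists>f. extends P U W a f"
proof -
  obtain b1 b2 where b: "bs = b1 @ b # b2" using bs(2) split_list by metis
  obtain vs where vs: "set vs = U - {u}" "distinct vs" using U(1) finite_distinct_list by blast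
  have len: "length vs = length b1 + length b2"
    using vs U b distinct_card[of vs] by simp
  define us where "us = take (length b1) vs @ u # drop (length b1) vs"
  have "set us = insert u (set vs)"
    unfolding us_def by (metis append_take_drop_id list.simps(15) set_append Un_insert_right)
  then have us: "set us = U" using vs U by auto
  have lenus: "length us = length bs" using len b by (simp add: us_def)
  have dist: "distinct us" using us lenus U(2) card_distinct by metis
  define f where "f = (\<lambda>x. the (map_of (zip us bs) x))"
  have map: "map f us = bs"
    by (rule nth_equalityI) (auto simp: lenus f_def map_of_zip_nth[OF lenus dist])
  have "f u = b"
  proof -
    have "us ! length b1 = u" "length b1 < length us"
      using len by (auto simp: us_def nth_append)
    moreover have "bs ! length b1 = b" by (simp add: b)
    ultimately show ?thesis using map by (metis nth_map)
  qed
  moreover have "f w \<in> set bs" if "w \<in> U" for w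
    using map us that by (metis image_eqI set_map)
  ultimately have "\<forall>w\<in>U. f w \<in> W w" using W by (metis subsetD)
  then show ?thesis using us dist map bs unfolding extends_def by metis
qed

lemma compressed_layer_unique:
  assumes G: "rooted_tree G"
    and "v \<in> compressed \<kappa> G (remaining \<kappa> G i)" "v \<in> compressed \<kappa> G (remaining \<kappa> G j)"
  shows "i = j"
proof -
  have "\<not> i < j" if "v \<in> compressed \<kappa> G (remaining \<kappa> G i)" "v \<in> compressed \<kappa> G (remaining \<kappa> G j)" for i j
  proof
    assume "i < j"
    have "v \<in> remaining \<kappa> G j"
      using that compressed_subset_unary[OF G] by (auto simp: unary_def)
    then have "v \<in> remaining \<kappa> G (Suc i)"
      using remaining_antimono[of "Suc i" j \<kappa> G] \<open>i < j\<close> by (meson Suc_leI subsetD)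
    then show False using that by simp
  qed
  then show ?thesis using assms by (meson linorder_neqE_nat)
qed

text \<open>Both anchors make \<open>v\<close> compressed, and a node is compressed in one round
  only. So they lie on the same chain through \<open>v\<close>, within \<open>\<kappa>\<close> of
  each other, and belong to the same ruling set.\<close>

lemma anchor_below_unique:
  assumes G: "rooted_tree G" and ids: "\<And>v. v \<in> verts G \<Longrightarrow> v < 2 ^ b" and v: "v \<in> verts G"
    and x: "x \<in> anchors \<kappa> I b G" "(v, x) \<in> edges G ^^ j" "j \<le> \<kappa>"
    and y: "y \<in> anchors \<kappa> I b G" "(v, y) \<in> edges G ^^ l" "l \<le> \<kappa>"
  shows "x = y \<and> j = l"
proof -
  have G_verts: "z \<in> verts G" if "(v, z) \<in> edges G ^^ m" for z m
    using that v rooted_tree_edges[OF G] by (cases m) auto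
  obtain i where i: "x \<in> ruling \<kappa> G (eligible \<kappa> G (remaining \<kappa> G i)) b"
    using x(1) by (auto simp: anchors_def)
  obtain i' where i': "y \<in> ruling \<kappa> G (eligible \<kappa> G (remaining \<kappa> G i')) b"
    using y(1) by (auto simp: anchors_def)
  have e: "x \<in> eligible \<kappa> G (remaining \<kappa> G i)" "y \<in> eligible \<kappa> G (remaining \<kappa> G i')"
    using i i' ruling_subset by blast+
  then have "v \<in> compressed \<kappa> G (remaining \<kappa> G i)" "v \<in> compressed \<kappa> G (remaining \<kappa> G i')"
    using x y unfolding compressed_def by blast+
  then have "i = i'" using compressed_layer_unique[OF G] by blast
  define X where "X = remaining \<kappa> G i"
  have cx: "(v, x) \<in> chain G X ^^ j" and cy: "(v, y) \<in> chain G X ^^ l"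
    using chain_of_eligible[OF G] e x y \<open>i = i'\<close> by (auto simp: X_def)
  note diff = single_valued_relpow_diff[OF chain_single_valued]
  have "near \<kappa> G x y"
  proof (cases "j \<le> l")
    case True
    from chain_relpow[OF diff[OF cx cy True]] show ?thesis
      using y(3) unfolding near_def by (intro exI[of _ "l - j"]) auto
  next
    case False
    from chain_relpow[OF diff[OF cy cx]] show ?thesis
      using x(3) False unfolding near_def by (intro exI[of _ "j - l"]) auto
  qed
  then have "x = y"
    using ruling_not_near i i' \<open>i = i'\<close> ids G_verts x(2) y(2) by blast
  moreover have "j = l"
  proof -
    have "(x, x) \<in> edges G ^^ (l - j)" if "j \<le> l"
      using chain_relpow[OF diff[OF cx cy that]] \<open>x = y\<close> by simp
    moreover have "(x, x) \<in> edges G ^^ (j - l)" if "l \<le> j"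
      using chain_relpow[OF diff[OF cy cx that]] \<open>x = y\<close> by simp
    ultimately show ?thesis
      using rooted_tree_acyclic[OF G, of x] by (metis diff_is_0_eq le_antisym nat_le_linear)
  qed
  ultimately show ?thesis by simp
qed

text \<open>The recursion stops at the first anchor or root, so additional depth changes
  nothing.\<close>

lemma top_down_stable:
  assumes G: "rooted_tree G" and "hit G (A G) d v" "d < e"
  shows "top_down P \<kappa> S s A e G v = top_down P \<kappa> S s A (Suc d) G v"
  using assms(2,3)
proof (induction d arbitrary: v e)
  case 0
  then show ?case by (cases e) (auto simp: hit_def is_singleton_def)
next
  case (Suc d)
  then obtain e' where e: "e = Suc e'" by (cases e) auto
  show ?case
  proof (cases "v \<notin> A G \<and> is_singleton (parents G v)")
    case True
    then obtain p where p: "parents G v = {p}" by (auto simp: is_singleton_def)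
    obtain j z where j: "j \<le> Suc d" "(z, v) \<in> edges G ^^ j" and z: "z \<in> A G \<or> parents G z = {}"
      using Suc.prems by (auto simp: hit_def)
    have "j \<noteq> 0" using j(2) z True p by (intro notI) simp
    then obtain i where i: "j = Suc i" by (cases j) auto
    then obtain w where w: "(z, w) \<in> edges G ^^ i" "(w, v) \<in> edges G" using j(2) by auto
    then have "w = p" using p by (auto simp: parents_def)
    then have "hit G (A G) d p" using w z j i unfolding hit_def by (meson Suc_le_mono)
    then have "top_down P \<kappa> S s A e' G p = top_down P \<kappa> S s A (Suc d) G p"
      using Suc.IH[of p e'] Suc.prems(2) e by simp
    then show ?thesis using True p e by simp
  next
    case False
    then show ?thesis by (simp only: e top_down.simps if_False)
  qed
qed

text \<open>The invariant, carried from the root downwards, is that the label of a node lies in its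
  target set. At an anchor the target set leaves only \<open>s\<close> (case \<open>j = 0\<close>),
  so the label chosen by the parent agrees with the one with which the anchor restarts.\<close>

lemma top_down_feasible:
  fixes P :: "'l lcl" and G :: "nat digraph"
  assumes P: "is_lcl P" and cert: "certificate P S s \<kappa>" and G: "regular_tree (arity P) G"
    and ids: "\<And>v. v \<in> verts G \<Longrightarrow> v < 2 ^ b" and hits: "\<And>v. v \<in> verts G \<Longrightarrow> hit G (anchors \<kappa> I b G) d v"
  shows "feasible P G (top_down P \<kappa> S s (anchors \<kappa> I b) (Suc d) G)"
proof -
  define A where "A = anchors \<kappa> I b"
  define L where "L = top_down P \<kappa> S s A (Suc d) G"
  define Tg where "Tg = target \<kappa> S (steps P S) s G (A G)"
  define F where "F = (\<lambda>p. SOME f. extends P (children G p) Tg (L p) f)"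
  have tree: "rooted_tree G" using G by (rule regular_tree_rooted)
  note E = rooted_tree_edges[OF tree]
  have sS: "s \<in> S" and SP: "S \<subseteq> labels P" and walk: "\<And>a j. a \<in> S \<Longrightarrow> \<kappa> \<le> j \<Longrightarrow> (a, s) \<in> steps P S ^^ j"
    and conf: "\<And>a. a \<in> S \<Longrightarrow> \<exists>bs. (a, bs) \<in> configs P \<and> set bs \<subseteq> S"
    using cert by (auto simp: certificate_def)
  have unique: "x = y \<and> j = l" if "v \<in> verts G" "x \<in> A G" "(v, x) \<in> edges G ^^ j" "j \<le> \<kappa>"
    "y \<in> A G" "(v, y) \<in> edges G ^^ l" "l \<le> \<kappa>" for v x y j l
    using anchor_below_unique[OF tree ids] that unfolding A_def by blast
  have ext: "extends P (children G p) Tg (L p) (F p)"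
    if p: "p \<in> verts G" and ne: "children G p \<noteq> {}" and a: "L p \<in> Tg p" for p
  proof -
    have card: "card (children G p) = arity P" using G p ne by (auto simp: regular_tree_def)
    have fin: "finite (children G p)"
      using E rooted_tree_finite[OF tree] by (auto simp: children_def intro: finite_subset)
    have aS: "L p \<in> S" using a by (simp add: Tg_def target_def)
    have cG: "u \<in> verts G" if "u \<in> children G p" for u using that E by (auto simp: children_def)
    \<comment> \<open>Anchors at distance exactly \<open>\<kappa>\<close> impose nothing, since
      every label of \<open>S\<close> has a walk of length \<open>\<kappa>\<close> to
      \<open>s\<close>.\<close>
    have free: "b \<in> Tg u" if "b \<in> S" "\<And>j x. j < \<kappa> \<Longrightarrow> (u, x) \<in> edges G ^^ j \<Longrightarrow> x \<notin> A G" for b u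
      using that walk unfolding Tg_def target_def by (auto simp: le_less)
    \<comment> \<open>At most one child has an anchor less than \<open>\<kappa>\<close> below it. It
      receives the next label of the walk from \<open>L p\<close> to \<open>s\<close>; the other
      children are unrestricted.\<close>
    have "\<exists>f. extends P (children G p) Tg (L p) f"
    proof (cases "\<exists>u\<in>children G p. \<exists>j<\<kappa>. \<exists>x. (u, x) \<in> edges G ^^ j \<and> x \<in> A G")
      case True
      then obtain u j x where u: "u \<in> children G p" and j: "j < \<kappa>" "(u, x) \<in> edges G ^^ j" "x \<in> A G"
        by blast
      have px: "(p, x) \<in> edges G ^^ Suc j" using u j by (intro relpow_Suc_I2) (auto simp: children_def)
      have "(L p, s) \<in> steps P S ^^ Suc j"
        using a px j unfolding Tg_def target_def by (auto simp del: relpow.simps)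
      then obtain b where b: "(L p, b) \<in> steps P S" "(b, s) \<in> steps P S ^^ j" by (meson relpow_Suc_D2)
      then obtain bs where bs: "(L p, bs) \<in> configs P" "set bs \<subseteq> S" "b \<in> set bs" by (auto simp: steps_def)
      show ?thesis
      proof (rule extends_exists[OF bs(1,3) fin _ u])
        show "card (children G p) = length bs" using card is_lclD(3)[OF P bs(1)] by simp
        have "i = j" if "(u, y) \<in> edges G ^^ i" "y \<in> A G" "i \<le> \<kappa>" for i y
          using unique[OF cG[OF u] j(3,2) _ that(2,1,3)] j(1) by simp
        then show "b \<in> Tg u" using b bs unfolding Tg_def target_def by auto
      next
        fix w assume w: "w \<in> children G p" "w \<noteq> u"
        have "y \<notin> A G" if "i < \<kappa>" "(w, y) \<in> edges G ^^ i" for i y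
        proof
          assume y: "y \<in> A G"
          have "(p, y) \<in> edges G ^^ Suc i" using w that by (intro relpow_Suc_I2) (auto simp: children_def)
          from unique[OF p j(3) px _ y this] have "x = y" "j = i" using j(1) that(1) by auto
          then show False using rooted_tree_ancestor_unique[OF tree j(2)] that w by blast
        qed
        then show "set bs \<subseteq> Tg w" using free bs by blast
      qed
    next
      case False
      obtain bs where bs: "(L p, bs) \<in> configs P" "set bs \<subseteq> S" using conf[OF aS] by blast
      obtain u where u: "u \<in> children G p" using ne by blast
      have len: "card (children G p) = length bs" using card is_lclD(3)[OF P bs(1)] by simp
      then obtain b where b: "b \<in> set bs" using u fin by (cases bs) auto
      have "set bs \<subseteq> Tg w" if "w \<in> children G p" for w using free bs False that by blast
      then show ?thesis using extends_exists[OF bs(1) b fin len u] u b by blast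
    qed
    then show ?thesis unfolding F_def by (rule someI_ex)
  qed
  \<comment> \<open>An anchor has \<open>\<kappa>\<close> ancestors, so it cannot lie less than
    \<open>\<kappa>\<close> below a root.\<close>
  have s_root: "s \<in> Tg v" if "parents G v = {}" for v
    unfolding Tg_def target_def
  proof (safe intro!: sS)
    fix j x assume j: "j \<le> \<kappa>" "(v, x) \<in> edges G ^^ j" "x \<in> A G"
    then obtain i where "x \<in> eligible \<kappa> G (remaining \<kappa> G i)"
      using ruling_subset unfolding A_def anchors_def by blast
    then obtain w where "(w, x) \<in> edges G ^^ \<kappa>" by (auto simp: eligible_def)
    from rooted_tree_ancestor_diff[OF tree j(2) this j(1)]
    have "(w, v) \<in> edges G ^^ (\<kappa> - j)" .
    then have "\<kappa> - j = 0" using that by (cases "\<kappa> - j") (auto simp: parents_def)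
    then show "(s, s) \<in> steps P S ^^ j" using walk[OF sS] j(1) by simp
  qed
  have s_anchor: "s \<in> Tg v" if "v \<in> A G" "v \<in> verts G" for v
  proof -
    have "(s, s) \<in> steps P S ^^ j" if "(v, x) \<in> edges G ^^ j" "x \<in> A G" "j \<le> \<kappa>" for j x
    proof -
      have "v = x \<and> 0 = j" by (rule unique[OF \<open>v \<in> verts G\<close> \<open>v \<in> A G\<close> _ _ that(2,1,3)]) auto
      then show ?thesis by auto
    qed
    then show ?thesis using sS unfolding Tg_def target_def by blast
  qed
  have anchor_s: "a = s" if "v \<in> A G" "a \<in> Tg v" for v a
  proof -
    have "(v, v) \<in> edges G ^^ 0" by simp
    then have "(a, s) \<in> steps P S ^^ 0" using that unfolding Tg_def target_def by blast
    then show ?thesis by simp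
  qed
  have L_child: "L v = F p v" if v: "v \<in> verts G" "v \<notin> A G" and p: "(p, v) \<in> edges G" for v p
  proof -
    have par: "parents G v = {p}" using p rooted_tree_parent_unique[OF tree] by (auto simp: parents_def)
    have "L v = top_down P \<kappa> S s A (Suc (Suc d)) G v"
      unfolding L_def A_def
      by (rule sym, rule top_down_stable[where A = "anchors \<kappa> I b", OF tree hits[OF v(1)]]) simp
    then show ?thesis using par v by (simp add: F_def L_def Tg_def)
  qed
  have L_root: "L v = s" if "parents G v = {}" for v using that by (simp add: L_def is_singleton_def)
  have L_anchor: "L v = s" if "v \<in> A G" for v using that by (simp add: L_def)
  obtain r where r: "\<And>u. (u, r) \<notin> edges G" and reach: "\<And>v. v \<in> verts G \<Longrightarrow> (r, v) \<in> (edges G)\<^sup>*"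
    using tree unfolding rooted_tree_def by blast
  have L_Tg: "L v \<in> Tg v" if "v \<in> verts G" for v
    using reach[OF that] that
  proof (induction rule: rtrancl_induct)
    case base
    have "parents G r = {}" using r by (auto simp: parents_def)
    then show ?case using L_root s_root by simp
  next
    case (step p v)
    show ?case
    proof (cases "v \<in> A G")
      case True
      then show ?thesis using L_anchor s_anchor step by simp
    next
      case False
      have "p \<in> verts G" "v \<in> children G p" using step E by (auto simp: children_def)
      then show ?thesis using ext[of p] step L_child[OF _ False] by (auto simp: extends_def)
    qed
  qed
  have "feasible P G L"
    unfolding feasible_def
  proof (intro conjI ballI impI)
    show "L ` verts G \<subseteq> labels P" using L_Tg SP by (auto simp: Tg_def target_def)
    fix p assume p: "p \<in> verts G" and card: "card (children G p) = arity P"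
    then have "children G p \<noteq> {}" using is_lclD(1)[OF P] by auto
    from ext[OF p this L_Tg[OF p]]
    obtain us where us: "distinct us" "set us = children G p" "(L p, map (F p) us) \<in> configs P"
      and FT: "\<And>u. u \<in> children G p \<Longrightarrow> F p u \<in> Tg u" by (auto simp: extends_def)
    have "F p u = L u" if "u \<in> children G p" for u
    proof (cases "u \<in> A G")
      case True
      then show ?thesis using anchor_s FT[OF that] L_anchor by simp
    next
      case False
      then show ?thesis using L_child that E by (auto simp: children_def)
    qed
    then have "map (F p) us = map L us" using us(2) by auto
    then show "\<exists>us. distinct us \<and> set us = children G p \<and> (L p, map L us) \<in> configs P"
      using us by metis
  qed
  then show ?thesis unfolding L_def A_def .
qed


section \<open>Transport of trees along identifier assignments\<close>

lemma children_rename: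
  assumes "inj_on f (verts G)" "edges G \<subseteq> verts G \<times> verts G" "v \<in> verts G"
  shows "children (rename f G) (f v) = f ` children G v"
proof
  show "children (rename f G) (f v) \<subseteq> f ` children G v"
  proof
    fix w assume "w \<in> children (rename f G) (f v)"
    then obtain a c where ac: "(a, c) \<in> edges G" "f a = f v" "w = f c"
      by (auto simp: children_def rename_def)
    then have "a = v" using assms by (auto simp: inj_on_def)
    then show "w \<in> f ` children G v" using ac by (auto simp: children_def)
  qed
qed (force simp: children_def rename_def)

lemma regular_tree_rename:
  assumes f: "inj_on f (verts G)" and G: "regular_tree d G"
  shows "regular_tree d (rename f G)"
proof -
  have tree: "rooted_tree G" using G by (rule regular_tree_rooted)
  note E = rooted_tree_edges[OF tree]
  obtain r where r: "r \<in> verts G" "\<And>u. (u, r) \<notin> edges G"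
    and reach: "\<And>v. v \<in> verts G \<Longrightarrow> (r, v) \<in> (edges G)\<^sup>*"
    using tree unfolding rooted_tree_def by blast
  have edgeD: "\<exists>a c. (a, c) \<in> edges G \<and> x = f a \<and> y = f c" if "(x, y) \<in> edges (rename f G)" for x y
    using that by (auto simp: rename_def)
  have inj: "a = c" if "f a = f c" "a \<in> verts G" "c \<in> verts G" for a c
    using that f by (auto simp: inj_on_def)
  have "(f r, f v) \<in> (edges (rename f G))\<^sup>*" if "v \<in> verts G" for v
    using reach[OF that]
  proof (induction rule: rtrancl_induct)
    case (step y z)
    then have "(f y, f z) \<in> edges (rename f G)" by (force simp: rename_def)
    then show ?case using step by simp
  qed simp
  moreover have "(u, f r) \<notin> edges (rename f G)" for u
  proof
    assume "(u, f r) \<in> edges (rename f G)"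
    then obtain a c where "(a, c) \<in> edges G" "f r = f c" using edgeD by blast
    then show False using inj[of r c] r E by auto
  qed
  moreover have "u = u'" if uv: "(u, v) \<in> edges (rename f G)" "(u', v) \<in> edges (rename f G)" for u u' v
  proof -
    obtain a c a' c' where "(a, c) \<in> edges G" "u = f a" "v = f c"
      "(a', c') \<in> edges G" "u' = f a'" "v = f c'" using edgeD uv by metis
    moreover from this have "c = c'" using inj[of c c'] E by auto
    ultimately show ?thesis using rooted_tree_parent_unique[OF tree] by blast
  qed
  moreover have "edges (rename f G) \<subseteq> verts (rename f G) \<times> verts (rename f G)"
    using E by (auto simp: rename_def)
  moreover have "finite (verts (rename f G))" "f r \<in> verts (rename f G)"
    using rooted_tree_finite[OF tree] r by (auto simp: rename_def)
  moreover have "\<forall>v\<in>verts (rename f G). (f r, v) \<in> (edges (rename f G))\<^sup>*"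
    using calculation(1) by (auto simp: rename_def)
  ultimately have "rooted_tree (rename f G)"
    unfolding rooted_tree_def by blast
  moreover have "card (children (rename f G) v) = d"
    if v: "v \<in> verts (rename f G)" "children (rename f G) v \<noteq> {}" for v
  proof -
    obtain u where u: "u \<in> verts G" "v = f u" using v by (auto simp: rename_def)
    have eq: "children (rename f G) v = f ` children G u" using children_rename[OF f E u(1)] u by simp
    moreover have "inj_on f (children G u)"
      using f E by (auto intro: inj_on_subset simp: children_def)
    ultimately show ?thesis using G u v by (auto simp: regular_tree_def card_image)
  qed
  ultimately show ?thesis by (simp add: regular_tree_def)
qed

lemma rename_induced_nbhd:
  assumes f: "inj_on f (verts G)" and E: "edges G \<subseteq> verts G \<times> verts G" and v: "v \<in> verts G"
  shows "rename f (induced G (nbhd G T v)) = induced (rename f G) (nbhd (rename f G) T (f v))"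
proof -
  let ?r = "edges G \<union> (edges G)\<inverse>"
  let ?H = "rename f G"
  let ?s = "edges ?H \<union> (edges ?H)\<inverse>"
  have rs: "(f a, f c) \<in> ?s" if "(a, c) \<in> ?r" for a c
    using that by (force simp: rename_def)
  have inj: "a = c" if "f a = f c" "a \<in> verts G" "c \<in> verts G" for a c
    using that f by (auto simp: inj_on_def)
  have sr: "\<exists>c. y = f c \<and> (a, c) \<in> ?r" if s: "(f a, y) \<in> ?s" "a \<in> verts G" for a y
  proof -
    obtain a' c' where ac: "(a', c') \<in> ?r" "f a = f a'" "y = f c'" using s by (auto simp: rename_def)
    then have "a = a'" using inj s(2) E by auto
    then show ?thesis using ac by auto
  qed
  have fwd: "(v, u) \<in> ?r ^^ k \<Longrightarrow> (f v, f u) \<in> ?s ^^ k" for k u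
  proof (induction k arbitrary: u)
    case (Suc k)
    then show ?case using rs by (meson relpow_Suc_E relpow_Suc_I)
  qed simp
  have bwd: "(f v, y) \<in> ?s ^^ k \<Longrightarrow> \<exists>u\<in>verts G. y = f u \<and> (v, u) \<in> ?r ^^ k" for k y
  proof (induction k arbitrary: y)
    case (Suc k)
    then obtain z where "(f v, z) \<in> ?s ^^ k" and zy: "(z, y) \<in> ?s" by auto
    then obtain u where u: "u \<in> verts G" "z = f u" "(v, u) \<in> ?r ^^ k" using Suc.IH by blast
    then obtain c where c: "y = f c" "(u, c) \<in> ?r" using sr zy by blast
    then have "c \<in> verts G" using E by auto
    moreover have "(v, c) \<in> ?r ^^ Suc k" using u(3) c(2) by (rule relpow_Suc_I)
    ultimately show ?case using c(1) by blast
  qed (use v in auto)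
  have nb: "nbhd ?H T (f v) = f ` nbhd G T v"
  proof (intro equalityI subsetI)
    fix y assume "y \<in> nbhd ?H T (f v)"
    then obtain k where "k \<le> T" "(f v, y) \<in> ?s ^^ k" by (auto simp: nbhd_def)
    then show "y \<in> f ` nbhd G T v" using bwd unfolding nbhd_def by blast
  next
    fix y assume "y \<in> f ` nbhd G T v"
    then obtain u k where "y = f u" "u \<in> verts G" "k \<le> T" "(v, u) \<in> ?r ^^ k" by (auto simp: nbhd_def)
    then show "y \<in> nbhd ?H T (f v)" using fwd unfolding nbhd_def by (auto simp: rename_def)
  qed
  have "f ` (verts G \<inter> nbhd G T v) = f ` verts G \<inter> f ` nbhd G T v"
    using nbhd_subset_verts[of G T v] by blast
  moreover have "map_prod f f ` (edges G \<inter> nbhd G T v \<times> nbhd G T v) =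
      map_prod f f ` edges G \<inter> (f ` nbhd G T v) \<times> (f ` nbhd G T v)"
  proof (intro equalityI subsetI)
    fix e assume "e \<in> map_prod f f ` edges G \<inter> (f ` nbhd G T v) \<times> (f ` nbhd G T v)"
    then obtain a c a' c' where e: "(a, c) \<in> edges G" "e = (f a, f c)"
      "a' \<in> nbhd G T v" "f a = f a'" "c' \<in> nbhd G T v" "f c = f c'"
      by (elim IntE imageE) (auto simp: image_iff; metis)
    moreover from this have "a = a'" "c = c'" using inj E nbhd_subset_verts[of G T v] by blast+
    ultimately show "e \<in> map_prod f f ` (edges G \<inter> nbhd G T v \<times> nbhd G T v)" by force
  qed auto
  moreover have "verts (rename f G) = f ` verts G" "edges (rename f G) = map_prod f f ` edges G"
    by (simp_all add: rename_def)
  ultimately show ?thesis by (simp add: induced_def nb rename_def[of _ "\<lparr>verts = _, edges = _\<rparr>"])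
qed

text \<open>The labeling is built in the tree whose nodes are renamed to their identifiers. The
  quadratic term comes from \<open>anchors_hit\<close>: linearly many rounds in \<open>b n\<close>,
  each with a climb linear in \<open>b n\<close>.\<close>

lemma local_algorithm:
  fixes P :: "'l lcl" and N b :: "nat \<Rightarrow> nat"
  assumes P: "is_lcl P" and cert: "certificate P S s \<kappa>" and b: "\<And>n. N n < 2 ^ b n"
  shows "\<exists>A c. solves_local N P A (\<lambda>n. c * (Suc (b n))\<^sup>2)"
proof -
  define I where "I = (\<lambda>n. (2 * \<kappa> + 1) * b n)"
  define D where "D = (\<lambda>n. I n * (2 * \<kappa> * b n + \<kappa> + 4))"
  \<comment> \<open>The sum of all coefficients in the required radius, as \<open>1\<close>,
    \<open>b n\<close> and \<open>(b n)\<^sup>2\<close> are at most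
    \<open>(Suc (b n))\<^sup>2\<close>.\<close>
  define c where "c = (2 * \<kappa> + 1) * (2 * \<kappa> + 1) + 1 + \<kappa> + \<kappa> + \<kappa> + 3 + (2 * \<kappa> + 1) * (2 * \<kappa> + \<kappa> + 4)"
  define T where "T = (\<lambda>n. c * (Suc (b n))\<^sup>2)"
  have Tge: "I n * (2 * \<kappa> + 1) + 1 + \<kappa> + b n * \<kappa> + \<kappa> + 2 + Suc (D n) \<le> T n" for n
    unfolding T_def c_def I_def D_def by (simp add: power2_eq_square algebra_simps)
  define alg :: "'l local_alg" where
    "alg = (\<lambda>n i H. top_down P \<kappa> S s (anchors \<kappa> (I n) (b n)) (Suc (D n)) H i)"
  have "feasible P G (local_output alg (T (card (verts G))) G ident)"
    if G: "regular_tree (arity P) G" and inj: "inj_on ident (verts G)"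
      and ids: "ident ` verts G \<subseteq> {1..N (card (verts G))}" for G :: "nat digraph" and ident
  proof -
    define n where "n = card (verts G)"
    define H where "H = rename ident G"
    define L where "L = top_down P \<kappa> S s (anchors \<kappa> (I n) (b n)) (Suc (D n)) H"
    have E: "edges G \<subseteq> verts G \<times> verts G"
      using G regular_tree_rooted rooted_tree_edges by blast
    have H: "regular_tree (arity P) H" unfolding H_def by (rule regular_tree_rename[OF inj G])
    have tree: "rooted_tree H" using H by (rule regular_tree_rooted)
    have lt: "v < 2 ^ b n" if "v \<in> verts H" for v
      using that ids b[of n] by (force simp: H_def rename_def n_def)
    have "verts H \<subseteq> {1..N n}" using ids by (simp add: H_def rename_def n_def)
    then have "card (verts H) \<le> N n" using card_mono[of "{1..N n}" "verts H"] by simp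
    then have "card (verts H) < 2 ^ b n" using b[of n] by linarith
    then have "hit H (anchors \<kappa> (I n) (b n) H) (D n) v" if "v \<in> verts H" for v
      unfolding D_def I_def by (rule anchors_hit[OF tree _ refl refl that])
    then have feas: "feasible P H L"
      unfolding L_def using top_down_feasible[OF P cert H lt] by blast
    have out: "local_output alg (T n) G ident v = L (ident v)" if v: "v \<in> verts G" for v
    proof -
      have "agree (T n) H (induced H (nbhd H (T n) (ident v))) (ident v)"
        using v by (intro agree_induced_nbhd[OF rooted_tree_edges[OF tree], of _ 0])
          (auto simp: H_def rename_def nbhd_def)
      from localD[OF local_top_down[OF local_anchors] this]
      have "L (ident v) = top_down P \<kappa> S s (anchors \<kappa> (I n) (b n)) (Suc (D n))
          (induced H (nbhd H (T n) (ident v))) (ident v)"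
        unfolding L_def using Tge[of n] .
      then show ?thesis
        using rename_induced_nbhd[OF inj E v, of "T n"]
        by (simp add: local_output_def alg_def H_def flip: n_def)
    qed
    show ?thesis
      unfolding feasible_def n_def[symmetric]
    proof (intro conjI ballI impI)
      show "local_output alg (T n) G ident ` verts G \<subseteq> labels P"
        using feas out by (auto simp: feasible_def H_def rename_def)
      fix v assume v: "v \<in> verts G" and card: "card (children G v) = arity P"
      have ch: "children H (ident v) = ident ` children G v"
        unfolding H_def by (rule children_rename[OF inj E v])
      have inj': "inj_on ident (children G v)"
        using inj E by (auto intro: inj_on_subset simp: children_def)
      have "ident v \<in> verts H" "card (children H (ident v)) = arity P"
        using v ch card card_image[OF inj'] by (auto simp: H_def rename_def)
      then obtain ws where ws: "distinct ws" "set ws = children H (ident v)"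
        "(L (ident v), map L ws) \<in> configs P" using feas unfolding feasible_def by blast
      define us where "us = map (the_inv_into (children G v) ident) ws"
      have ret: "map ident us = ws"
        unfolding us_def map_map
      proof (rule map_idI)
        fix w assume "w \<in> set ws"
        then show "(ident \<circ> the_inv_into (children G v) ident) w = w"
          using ws(2) ch inj' by (simp add: f_the_inv_into_f)
      qed
      then have "distinct us" using ws(1) distinct_map by metis
      moreover have us: "set us = children G v"
        unfolding us_def using ws(2) ch inj' by (auto simp: the_inv_into_f_f image_image)
      moreover have "map (local_output alg (T n) G ident) us = map L ws"
        unfolding ret[symmetric] using us E out by (auto simp: children_def)
      ultimately show "\<exists>us. distinct us \<and> set us = children G v \<and>
          (local_output alg (T n) G ident v, map (local_output alg (T n) G ident) us) \<in> configs P"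
        using ws(3) out[OF v] by metis
    qed
  qed
  then show ?thesis unfolding solves_local_def T_def by blast
qed

section \<open>Polylogarithms against powers\<close>

lemma eventually_less_powr:
  fixes c \<alpha> :: real
  assumes "\<alpha> > 0"
  shows "\<forall>\<^sub>F n in sequentially. c < real n powr \<alpha>"
proof -
  define M where "M = max 1 c"
  have "\<forall>\<^sub>F n in sequentially. M powr (1 / \<alpha>) < real n"
    using eventually_compose_filterlim[OF eventually_gt_at_top filterlim_real_sequentially] .
  then show ?thesis
  proof eventually_elim
    case (elim n)
    have "(M powr (1 / \<alpha>)) powr \<alpha> < real n powr \<alpha>"
      using assms elim by (intro powr_less_mono2) auto
    then show ?case using assms by (simp add: powr_powr M_def)
  qed
qed

text \<open>From \<open>ln n \<le> n powr \<beta> / \<beta>\<close> with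
  \<open>\<beta> = \<alpha> / 4\<close>, the square costs a power \<open>\<alpha> / 2\<close>. The
  other half of the exponent absorbs the constants.\<close>

lemma ln_power_bound:
  fixes C D c d \<alpha> :: real
  assumes \<alpha>: "\<alpha> > 0" and nonneg: "C \<ge> 0" "D \<ge> 0" "c \<ge> 0" and d: "d > 0"
  shows "\<forall>\<^sub>F n :: nat in at_top. c * (C + D * ln (real n))\<^sup>2 < d * real n powr \<alpha>"
proof -
  define \<beta> where "\<beta> = \<alpha> / 4"
  have \<beta>: "\<beta> > 0" using \<alpha> by (simp add: \<beta>_def)
  define F where "F = C + D / \<beta>"
  have "\<forall>\<^sub>F n in sequentially. c * F\<^sup>2 / d < real n powr (\<alpha> / 2)"
    using \<alpha> by (intro eventually_less_powr) simp
  with eventually_gt_at_top[of 0] show ?thesis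
  proof eventually_elim
    case (elim n)
    have n: "real n \<ge> 1" using elim by simp
    have "\<beta> * ln n = ln (real n powr \<beta>)" using elim by (simp add: ln_powr)
    also have "\<dots> \<le> real n powr \<beta>" using elim ln_le_minus_one[of "real n powr \<beta>"] by simp
    finally have "ln n \<le> real n powr \<beta> / \<beta>" using \<beta> by (simp add: field_simps)
    from mult_left_mono[OF this nonneg(2)]
    have "D * ln n \<le> D / \<beta> * real n powr \<beta>" by simp
    moreover have "C \<le> C * real n powr \<beta>"
      using nonneg ge_one_powr_ge_zero[OF n, of \<beta>] \<beta> by (simp add: mult_le_cancel_left1)
    ultimately have "C + D * ln n \<le> F * real n powr \<beta>" by (simp add: F_def distrib_right)
    moreover have "0 \<le> C + D * ln n" using nonneg n by simp
    ultimately have "(C + D * ln n)\<^sup>2 \<le> (F * real n powr \<beta>)\<^sup>2" by (intro power_mono)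
    also have "\<dots> = F\<^sup>2 * real n powr (\<alpha> / 2)"
    proof -
      have "(real n powr \<beta>)\<^sup>2 = real n powr (\<beta> + \<beta>)" by (simp only: power2_eq_square powr_add)
      moreover have "\<beta> + \<beta> = \<alpha> / 2" by (simp add: \<beta>_def)
      ultimately show ?thesis by (simp add: power_mult_distrib)
    qed
    finally have "c * (C + D * ln n)\<^sup>2 \<le> c * F\<^sup>2 * real n powr (\<alpha> / 2)"
      using nonneg by (simp add: mult_left_mono mult.assoc)
    also have "\<dots> < (d * real n powr (\<alpha> / 2)) * real n powr (\<alpha> / 2)"
      using elim d by (intro mult_strict_right_mono) (auto simp: field_simps)
    also have "\<dots> = d * real n powr \<alpha>" by (simp flip: powr_add)
    finally show ?case .
  qed
qed

text \<open>A polylogarithmic upper bound and a polynomial lower bound can both hold eventually only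
  along the trivial filter. In this form no argument about the unboundedness of the input sizes is
  needed.\<close>

lemma certificate_not_polynomial:
  fixes P :: "'l lcl" and N :: "nat \<Rightarrow> nat"
  assumes P: "is_lcl P" and cert: "certificate P S s \<kappa>"
    and N: "(\<lambda>n. real (N n)) \<in> O(\<lambda>n. real n ^ k)"
    and poly: "polynomial_locality P (locality_local N P)"
  shows "inf at_top (principal (input_sizes P)) = bot"
proof -
  define b where "b = (\<lambda>n. LEAST b. N n < 2 ^ b)"
  have b: "N n < 2 ^ b n" for n
    unfolding b_def by (rule LeastI_ex) (use less_exp in blast)
  obtain A c where A: "solves_local N P A (\<lambda>n. c * (Suc (b n))\<^sup>2)"
    using local_algorithm[where b = b, OF P cert b] by blast
  have le: "locality_local N P n \<le> enat (c * (Suc (b n))\<^sup>2)" for n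
    unfolding locality_local_def Inf_apply image_image
    by (rule INF_lower2[of "\<lambda>n. c * (Suc (b n))\<^sup>2"]) (use A in auto)
  obtain \<alpha> d where \<alpha>: "\<alpha> > 0" "d > 0" and
    ev: "\<forall>\<^sub>F n in inf at_top (principal (input_sizes P)).
      ereal (d * real n powr \<alpha>) \<le> ereal_of_enat (locality_local N P n)"
    using poly unfolding polynomial_locality_def by blast
  obtain C0 where C0: "C0 > 0" "\<forall>\<^sub>F n in at_top. norm (real (N n)) \<le> C0 * norm (real n ^ k)"
    using N by (rule landau_o.bigE)
  define C where "C = C0 + 1"
  have "ln C \<ge> 0" using C0 by (simp add: C_def)
  then have bound: "\<forall>\<^sub>F n in at_top. real c * (2 + ln C / ln 2 + real k / ln 2 * ln (real n))\<^sup>2 < d * real n powr \<alpha>"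
    using \<alpha> by (intro ln_power_bound) auto
  have "\<forall>\<^sub>F n in at_top. real (c * (Suc (b n))\<^sup>2) < d * real n powr \<alpha>"
    using C0(2) bound eventually_gt_at_top[of 0]
  proof eventually_elim
    case (elim n)
    have C1: "C > 1" using C0 by (simp add: C_def)
    have "real (b n) \<le> 1 + (ln C + k * ln n) / ln 2"
    proof (cases "b n")
      case 0
      then show ?thesis using C1 elim by simp
    next
      case (Suc m)
      then have "\<not> N n < 2 ^ m" using not_less_Least[of m "\<lambda>b. N n < 2 ^ b"] by (simp add: b_def)
      then have "2 ^ m \<le> real (N n)" by (simp add: not_less flip: of_nat_power of_nat_le_iff)
      also have "\<dots> \<le> C0 * real n ^ k" using elim(1) by simp
      also have "\<dots> \<le> C * real n ^ k" by (simp add: C_def mult_right_mono)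
      finally have "ln (2 ^ m) \<le> ln (C * real n ^ k)" using C1 elim by (subst ln_le_cancel_iff) auto
      then have "m * ln 2 \<le> ln C + k * ln n" using C1 elim by (simp add: ln_mult ln_realpow)
      then show ?thesis using Suc by (simp add: field_simps)
    qed
    then have "real (Suc (b n)) \<le> 2 + ln C / ln 2 + k / ln 2 * ln n" by (simp add: add_divide_distrib)
    then have "(real (Suc (b n)))\<^sup>2 \<le> (2 + ln C / ln 2 + k / ln 2 * ln n)\<^sup>2"
      by (intro power_mono) auto
    then have "real (c * (Suc (b n))\<^sup>2) \<le> c * (2 + ln C / ln 2 + k / ln 2 * ln n)\<^sup>2"
      by (simp add: mult_left_mono)
    also have "\<dots> < d * real n powr \<alpha>" using elim(2) C1 by simp
    finally show ?case .
  qed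
  then have "\<forall>\<^sub>F n in inf at_top (principal (input_sizes P)). real (c * (Suc (b n))\<^sup>2) < d * real n powr \<alpha>"
    by (rule filter_leD[rotated]) simp
  with ev have "\<forall>\<^sub>F n in inf at_top (principal (input_sizes P)). False"
  proof eventually_elim
    case (elim n)
    have "ereal_of_enat (locality_local N P n) \<le> ereal (real (c * (Suc (b n))\<^sup>2))"
      using le[of n] by (metis ereal_of_enat_le_iff ereal_of_enat_simps(1))
    then have "ereal (d * real n powr \<alpha>) \<le> ereal (real (c * (Suc (b n))\<^sup>2))"
      using elim(1) by (rule order.trans[rotated])
    then show False using elim(2) by simp
  qed
  then show ?thesis by (simp add: trivial_limit_def)
qed

section \<open>Infinite forests given by parent functions\<close>

text \<open>The path from \<open>u\<close> to \<open>v\<close> climbs \<open>b\<close> steps to a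
  common ancestor and then descends \<open>a\<close> steps.\<close>

definition ball :: "('v \<Rightarrow> 'v) \<Rightarrow> nat \<Rightarrow> 'v \<Rightarrow> 'v set" where
  "ball par t u = {v. \<exists>a b. a + b \<le> t \<and> (par ^^ a) v = (par ^^ b) u}"

lemma self_in_ball: "u \<in> ball par t u"
  unfolding ball_def by (auto intro!: exI[of _ 0])

lemma ball_mono: "s \<le> t \<Longrightarrow> ball par s u \<subseteq> ball par t u"
  unfolding ball_def by (auto intro: order_trans)

lemma ball_sym: "v \<in> ball par t u \<Longrightarrow> u \<in> ball par t v"
  unfolding ball_def by clarsimp (metis add.commute)

lemma ball_ancestor: "i \<le> t \<Longrightarrow> (par ^^ i) u \<in> ball par t u"
  unfolding ball_def by (intro CollectI exI[of _ 0] exI[of _ i]) simp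

lemma ball_descendant: "(par ^^ i) v = u \<Longrightarrow> i \<le> t \<Longrightarrow> v \<in> ball par t u"
  using ball_ancestor ball_sym by metis

lemma ball_trans:
  assumes "v \<in> ball par s u" "w \<in> ball par t v"
  shows "w \<in> ball par (s + t) u"
proof -
  obtain a b where ab: "a + b \<le> s" "(par ^^ a) v = (par ^^ b) u" using assms by (auto simp: ball_def)
  obtain c d where cd: "c + d \<le> t" "(par ^^ c) w = (par ^^ d) v" using assms by (auto simp: ball_def)
  show ?thesis
  proof (cases "d \<le> a")
    case True
    then have "(par ^^ (a - d + c)) w = (par ^^ (a - d + d)) v"
      by (simp only: funpow_add comp_apply cd)
    then show ?thesis using True ab cd unfolding ball_def
      by (intro CollectI exI[of _ "a - d + c"] exI[of _ b]) auto
  next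
    case False
    then have "(par ^^ (d - a + a)) v = (par ^^ (d - a + b)) u"
      by (simp only: funpow_add comp_apply ab)
    then show ?thesis using False ab cd unfolding ball_def
      by (intro CollectI exI[of _ c] exI[of _ "d - a + b"]) auto
  qed
qed

lemma ball_inner: "a + b \<le> t \<Longrightarrow> (par ^^ a) v = (par ^^ b) u \<Longrightarrow> i \<le> a \<Longrightarrow> (par ^^ i) v \<in> ball par t u"
proof -
  assume "a + b \<le> t" "(par ^^ a) v = (par ^^ b) u" "i \<le> a"
  moreover from this have "(par ^^ (a - i)) ((par ^^ i) v) = (par ^^ b) u"
    by (simp flip: funpow_add comp_apply[of "par ^^ (a - i)"])
  ultimately show ?thesis unfolding ball_def by (intro CollectI exI[of _ "a - i"] exI[of _ b]) auto
qed

text \<open>Ranks and main marks belong to the nodes once and for all; only the parent function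
  changes during the game.\<close>

locale ranked =
  fixes \<delta> :: nat and rk :: "nat \<Rightarrow> nat" and main :: "nat \<Rightarrow> bool"
  assumes \<delta>: "\<delta> \<ge> 1" and main_rk: "main v \<Longrightarrow> rk v > 0"
begin

text \<open>The last condition bounds the number of nodes that are not main children by \<open>C\<close> along
  every path, so balls have polynomial size.\<close>

definition forest :: "nat \<Rightarrow> (nat \<Rightarrow> nat) \<Rightarrow> bool" where
  "forest C par \<longleftrightarrow>
     (\<forall>v k. k > 0 \<longrightarrow> (par ^^ k) v \<noteq> v) \<and>
     (\<forall>v. rk v > 0 \<longrightarrow> card {c. par c = v} = \<delta> \<and> (\<exists>!c. par c = v \<and> main c)) \<and>
     (\<forall>v. rk v = 0 \<longrightarrow> {c. par c = v} = {}) \<and>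
     (\<exists>lam. \<forall>v. lam v \<le> C \<and> lam v \<le> lam (par v) \<and> (\<not> main v \<longrightarrow> lam v < lam (par v)))"

context
  fixes C par assumes F: "forest C par"
begin

lemma par_acyclic: "(par ^^ k) v = v \<Longrightarrow> k = 0"
  using F unfolding forest_def by blast

lemma par_pow_inj: "(par ^^ i) v = (par ^^ j) v \<Longrightarrow> i = j"
proof (induction i j rule: linorder_wlog)
  case (le i j)
  then have "(par ^^ (j - i + i)) v = (par ^^ i) v" by simp
  then have "(par ^^ (j - i)) ((par ^^ i) v) = (par ^^ i) v" by (simp only: funpow_add comp_apply)
  then show ?case using par_acyclic le(1) by fastforce
qed auto

lemma card_children: "rk v > 0 \<Longrightarrow> card {c. par c = v} = \<delta>"
  using F unfolding forest_def by blast

lemma finite_children: "finite {c. par c = v}"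
  using F \<delta> unfolding forest_def by (metis card.infinite finite.emptyI not_gr_zero not_one_le_zero)

lemma rk_par: "rk (par v) > 0"
proof (rule ccontr)
  assume "\<not> rk (par v) > 0"
  then have "{c. par c = par v} = {}" using F unfolding forest_def by simp
  then show False by blast
qed

lemma main_child: "rk v > 0 \<Longrightarrow> \<exists>!c. par c = v \<and> main c"
  using F by (simp add: forest_def)

text \<open>On the way down \<open>lam\<close> drops at every non-main child, so at most
  \<open>c\<close> of them occur. A descendant is described by the lengths of at most
  \<open>c + 1\<close> main stretches and the choices of the non-main children in between.\<close>

lemma card_descendants:
  assumes lam: "\<And>v. lam v \<le> lam (par v) \<and> (\<not> main v \<longrightarrow> lam v < lam (par v))"
    and c: "lam z \<le> c"
  shows "finite {v. \<exists>k\<le>t. (par ^^ k) v = z} \<and> card {v. \<exists>k\<le>t. (par ^^ k) v = z} \<le> (t + 1) ^ (c + 1) * \<delta> ^ c"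
  using c
proof (induction t arbitrary: z c)
  case 0
  have "{v. \<exists>k\<le>0. (par ^^ k) v = z} = {z}" by auto
  then show ?case using \<delta> by simp
next
  case (Suc t)
  let ?D = "\<lambda>t z. {v. \<exists>k\<le>t. (par ^^ k) v = z}"
  let ?ch = "{w. par w = z}"
  have split: "?D (Suc t) z = insert z (\<Union>w\<in>?ch. ?D t w)"
  proof (intro equalityI subsetI)
    fix v assume "v \<in> ?D (Suc t) z"
    then obtain k where k: "k \<le> Suc t" "(par ^^ k) v = z" by blast
    then show "v \<in> insert z (\<Union>w\<in>?ch. ?D t w)" by (cases k) auto
  next
    fix v assume "v \<in> insert z (\<Union>w\<in>?ch. ?D t w)"
    then consider "v = z" | k where "k \<le> t" "par ((par ^^ k) v) = z" by auto
    then show "v \<in> ?D (Suc t) z"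
    proof cases
      case 1
      then show ?thesis by (auto intro!: exI[of _ 0])
    next
      case 2
      then show ?thesis by (auto intro!: exI[of _ "Suc k"])
    qed
  qed
  show ?case
  proof (cases "rk z > 0")
    case False
    then have "par w \<noteq> z" for w using rk_par[of w] by auto
    then have Dz: "?D (Suc t) z = {z}" using split by simp
    have one: "1 \<le> (Suc t + 1) ^ (c + 1) * \<delta> ^ c" 
    proof -
      have "0 < (Suc t + 1) ^ (c + 1) * \<delta> ^ c" using \<delta> by (intro mult_pos_pos zero_less_power) auto
      then show ?thesis by (simp only: One_nat_def Suc_leI)
    qed
    have "card {z} = 1" by simp
    then have "card (?D (Suc t) z) \<le> (Suc t + 1) ^ (c + 1) * \<delta> ^ c" unfolding Dz using one by (simp only:)
    then show ?thesis using Dz by (simp only: finite.intros simp_thms)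
  next
    case True
    then obtain m where m: "par m = z" "main m" and only: "\<And>w. par w = z \<Longrightarrow> main w \<Longrightarrow> w = m"
      using main_child by blast
    have lm: "lam m \<le> c" using lam[of m] m Suc.prems by simp
    have Dm: "finite (?D t m)" "card (?D t m) \<le> (t + 1) ^ (c + 1) * \<delta> ^ c"
      using Suc.IH[OF lm] by auto
    have light: "lam w < c" if "w \<in> ?ch - {m}" for w
      using lam[of w] that only[of w] Suc.prems by auto
    have Dw: "finite (?D t w) \<and> card (?D t w) \<le> (t + 1) ^ c * \<delta> ^ (c - 1)" if "w \<in> ?ch - {m}" for w
      using Suc.IH[of w "c - 1"] light[OF that] by auto
    have cardch: "card (?ch - {m}) = \<delta> - 1" using card_children[OF True] m by simp
    have split': "?D (Suc t) z = insert z (?D t m \<union> (\<Union>w\<in>?ch - {m}. ?D t w))" using split m(1) by blast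
    have fin: "finite (?ch - {m})" using finite_children by simp
    have cardU: "card (\<Union>w\<in>?ch - {m}. ?D t w) \<le> (\<delta> - 1) * ((t + 1) ^ c * \<delta> ^ (c - 1))"
    proof -
      have "card (\<Union>w\<in>?ch - {m}. ?D t w) \<le> (\<Sum>w\<in>?ch - {m}. card (?D t w))"
        by (rule card_UN_le[OF fin])
      also have "\<dots> \<le> (\<Sum>w\<in>?ch - {m}. (t + 1) ^ c * \<delta> ^ (c - 1))" using Dw by (intro sum_mono) blast
      finally show ?thesis using cardch by (simp only: sum_constant of_nat_id)
    qed
    have finU: "finite (\<Union>w\<in>?ch - {m}. ?D t w)" using fin Dw by blast
    have "card (?D (Suc t) z) \<le> Suc (card (?D t m \<union> (\<Union>w\<in>?ch - {m}. ?D t w)))"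
      unfolding split' by (rule card_insert_le_m1) (auto simp: card_insert_if finU Dm)
    also have "\<dots> \<le> Suc (card (?D t m) + card (\<Union>w\<in>?ch - {m}. ?D t w))"
      using card_Un_le by auto
    finally have card: "card (?D (Suc t) z) \<le> 1 + (t + 1) ^ (c + 1) * \<delta> ^ c + card (\<Union>w\<in>?ch - {m}. ?D t w)"
      using Dm by simp
    have "card (?D (Suc t) z) \<le> (Suc t + 1) ^ (c + 1) * \<delta> ^ c"
    proof (cases c)
      case 0
      then have "?ch - {m} = {}" using light by blast
      then have "card (\<Union>w\<in>?ch - {m}. ?D t w) = 0" by (simp only: UN_empty card.empty)
      then show ?thesis using card 0 by simp
    next
      case (Suc c')
      define A where "A = (t + 1) ^ c * \<delta> ^ c'"
      have A: "A \<ge> 1" using \<delta> by (simp add: A_def)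
      obtain d where d: "\<delta> = Suc d" using \<delta> by (cases \<delta>) auto
      have "(t + 1) ^ c \<le> (Suc t + 1) ^ c" by (rule power_mono) auto
      then have "A \<le> (Suc t + 1) ^ c * \<delta> ^ c'" unfolding A_def by (rule mult_le_mono1)
      then have "(t + 2) * \<delta> * A \<le> (t + 2) * \<delta> * ((Suc t + 1) ^ c * \<delta> ^ c')" by (rule mult_le_mono2)
      also have "\<dots> = (Suc t + 1) ^ (c + 1) * \<delta> ^ c" by (simp add: Suc algebra_simps)
      finally have "(t + 2) * \<delta> * A \<le> (Suc t + 1) ^ (c + 1) * \<delta> ^ c" .
      moreover have "1 + (t + 1) ^ (c + 1) * \<delta> ^ c + (\<delta> - 1) * ((t + 1) ^ c * \<delta> ^ (c - 1)) \<le> (t + 2) * \<delta> * A"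
      proof -
        have "(t + 1) ^ (c + 1) * \<delta> ^ c = (t + 1) * \<delta> * A" by (simp add: Suc A_def algebra_simps)
        moreover have "(\<delta> - 1) * ((t + 1) ^ c * \<delta> ^ (c - 1)) = d * A" by (simp add: Suc A_def d)
        moreover have "1 + (t + 1) * \<delta> * A + d * A \<le> (t + 2) * \<delta> * A" using A by (simp add: d algebra_simps)
        ultimately show ?thesis by simp
      qed
      ultimately show ?thesis using card cardU by linarith
    qed
    then show ?thesis using split' finU Dm by simp
  qed
qed

text \<open>A ball is covered by the descendants of the first \<open>t + 1\<close> ancestors, which
  explains one more factor \<open>t + 1\<close>.\<close>

lemma card_ball: "finite (ball par t u) \<and> card (ball par t u) \<le> (t + 1) ^ (C + 2) * \<delta> ^ C"
proof -
  obtain lam where lam: "\<And>v. lam v \<le> C" "\<And>v. lam v \<le> lam (par v) \<and> (\<not> main v \<longrightarrow> lam v < lam (par v))"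
    using F unfolding forest_def by blast
  let ?D = "\<lambda>z. {v. \<exists>k\<le>t. (par ^^ k) v = z}"
  have D: "finite (?D z) \<and> card (?D z) \<le> (t + 1) ^ (C + 1) * \<delta> ^ C" for z
    by (rule card_descendants[of lam]) (use lam in auto)
  have sub: "ball par t u \<subseteq> (\<Union>b\<in>{..t}. ?D ((par ^^ b) u))"
  proof
    fix v assume "v \<in> ball par t u"
    then obtain a b where "a + b \<le> t" "(par ^^ a) v = (par ^^ b) u" by (auto simp: ball_def)
    then have "b \<in> {..t}" "v \<in> ?D ((par ^^ b) u)" by (auto intro!: exI[of _ a])
    then show "v \<in> (\<Union>b\<in>{..t}. ?D ((par ^^ b) u))" by blast
  qed
  have fin: "finite (\<Union>b\<in>{..t}. ?D ((par ^^ b) u))" using D by blast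
  have "card (ball par t u) \<le> card (\<Union>b\<in>{..t}. ?D ((par ^^ b) u))" by (rule card_mono[OF fin sub])
  also have "\<dots> \<le> (\<Sum>b\<in>{..t}. card (?D ((par ^^ b) u)))" by (rule card_UN_le) simp
  also have "\<dots> \<le> (\<Sum>b\<in>{..t}. (t + 1) ^ (C + 1) * \<delta> ^ C)" using D by (intro sum_mono) blast
  also have "\<dots> = (t + 1) * ((t + 1) ^ (C + 1) * \<delta> ^ C)" by (simp only: sum_constant card_atMost of_nat_id Suc_eq_plus1)
  also have "\<dots> = (t + 1) ^ (C + 2) * \<delta> ^ C"
    using power_Suc[of "t + 1" "C + 1"] by (simp only: Suc_eq_plus1 add.assoc one_add_one mult.assoc)
  finally show ?thesis using finite_subset[OF sub fin] by (simp only: simp_thms)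
qed

end

end


section \<open>Completing partial views to input trees\<close>

lemma regular_tree_card:
  assumes "regular_tree d G"
  shows "\<exists>a. card (verts G) = 1 + d * a"
proof -
  have tree: "rooted_tree G" using assms by (rule regular_tree_rooted)
  note E = rooted_tree_edges[OF tree] and fin = rooted_tree_finite[OF tree]
  obtain r where r: "r \<in> verts G" "\<And>u. (u, r) \<notin> edges G"
    and reach: "\<And>v. v \<in> verts G \<Longrightarrow> (r, v) \<in> (edges G)\<^sup>*"
    using tree unfolding rooted_tree_def by blast
  have finE: "finite (edges G)" using E fin by (meson finite_SigmaI finite_subset)
  have "snd ` edges G = verts G - {r}"
  proof (intro equalityI subsetI)
    fix v assume v: "v \<in> verts G - {r}"
    then have "(r, v) \<in> (edges G)\<^sup>*" using reach by blast
    then obtain u where "(u, v) \<in> edges G" using v by (metis DiffD2 insertI1 rtranclE)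
    then show "v \<in> snd ` edges G" by force
  qed (use E r in force)
  moreover have "inj_on snd (edges G)"
    using rooted_tree_parent_unique[OF tree] by (auto simp: inj_on_def)
  ultimately have "card (edges G) = card (verts G) - 1" using r fin by (metis card_Diff_singleton card_image)
  moreover have "card (edges G) = (\<Sum>v\<in>verts G. card (children G v))"
  proof -
    have "edges G = (SIGMA v:verts G. children G v)" using E by (auto simp: children_def)
    moreover have "finite (children G v)" for v
      using E fin by (auto simp: children_def intro: finite_subset[of _ "verts G"])
    ultimately show ?thesis using fin by (metis card_SigmaI)
  qed
  moreover have "(\<Sum>v\<in>verts G. card (children G v)) = (\<Sum>v\<in>verts G. d * of_bool (children G v \<noteq> {}))"
    using assms by (intro sum.cong) (auto simp: regular_tree_def)
  ultimately have "card (verts G) - 1 = d * (\<Sum>v\<in>verts G. of_bool (children G v \<noteq> {}))"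
    by (simp add: sum_distrib_left)
  moreover have "card (verts G) \<ge> 1" using r(1) fin by (metis One_nat_def Suc_leI card_gt_0_iff empty_iff)
  ultimately show ?thesis by (metis le_add_diff_inverse)
qed

definition roots :: "'v set \<Rightarrow> ('v \<times> 'v) set \<Rightarrow> 'v set" where
  "roots W E = {v \<in> W. \<forall>u. (u, v) \<notin> E}"

definition finite_forest :: "nat \<Rightarrow> 'v set \<Rightarrow> ('v \<times> 'v) set \<Rightarrow> bool" where
  "finite_forest d W E \<longleftrightarrow> finite W \<and> E \<subseteq> W \<times> W \<and> single_valued (E\<inverse>) \<and> acyclic E \<and>
     (\<forall>v\<in>W. E `` {v} \<noteq> {} \<longrightarrow> card (E `` {v}) = d)"

lemma rtrancl_Un_star:
  "(x, z) \<in> (E \<union> {y} \<times> F)\<^sup>* \<Longrightarrow> (x, z) \<in> E\<^sup>* \<or> (x, y) \<in> E\<^sup>*"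
proof (induction rule: rtrancl_induct)
  case (step u w)
  then show ?case by (auto intro: rtrancl_into_rtrancl)
qed simp

lemma star_reach:
  assumes "(r, y) \<in> E\<^sup>*" "f \<in> F"
  shows "(r, f) \<in> (E \<union> {y} \<times> F)\<^sup>*"
proof (rule rtrancl_into_rtrancl)
  show "(r, y) \<in> (E \<union> {y} \<times> F)\<^sup>*" using assms(1) rtrancl_mono[of E] by blast
qed (use assms(2) in simp)

lemma acyclic_Un_star:
  assumes "finite F" "acyclic E" "\<And>f. f \<in> F \<Longrightarrow> (f, y) \<notin> E\<^sup>*"
  shows "acyclic (E \<union> {y} \<times> F)"
  using assms(1,3)
proof (induction F rule: finite_induct)
  case (insert f F)
  have "(f, y) \<notin> (E \<union> {y} \<times> F)\<^sup>*" using rtrancl_Un_star[of f y E y F] insert.prems by blast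
  moreover have "E \<union> {y} \<times> insert f F = insert (y, f) (E \<union> {y} \<times> F)" by auto
  ultimately show ?case using insert by (simp only: acyclic_insert) auto
qed (use assms in simp)

text \<open>The new children \<open>F\<close> of the leaf \<open>y\<close> may be fresh nodes or
  roots of other components; \<open>ny\<close> prevents a cycle through the root above
  \<open>y\<close>.\<close>

lemma finite_forest_attach:
  assumes W: "finite_forest d W E" and y: "y \<in> W" "E `` {y} = {}"
    and F: "finite F" "card F = d" "F \<inter> W \<subseteq> roots W E" and ny: "\<And>f. f \<in> F \<Longrightarrow> (f, y) \<notin> E\<^sup>*"
  shows "finite_forest d (W \<union> F) (E \<union> {y} \<times> F)"
    and "roots (W \<union> F) (E \<union> {y} \<times> F) = roots W E - F"
proof -
  have E: "E \<subseteq> W \<times> W" using W by (simp add: finite_forest_def)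
  have noE: "(u, f) \<notin> E" if "f \<in> F" for u f using that F(3) E by (auto simp: roots_def)
  have sv: "single_valued ((E \<union> {y} \<times> F)\<inverse>)"
    using W noE unfolding finite_forest_def single_valued_def by blast
  have "card ((E \<union> {y} \<times> F) `` {v}) = d" if "v \<in> W \<union> F" "(E \<union> {y} \<times> F) `` {v} \<noteq> {}" for v
  proof (cases "v = y")
    case True
    then have "(E \<union> {y} \<times> F) `` {v} = F" using y(2) by auto
    then show ?thesis using F by simp
  next
    case False
    then have "(E \<union> {y} \<times> F) `` {v} = E `` {v}" by auto
    moreover from this have "v \<in> W" using that E by auto
    ultimately show ?thesis using W that by (auto simp: finite_forest_def)
  qed
  then show "finite_forest d (W \<union> F) (E \<union> {y} \<times> F)"
    using W F(1) y(1) sv acyclic_Un_star[OF F(1) _ ny] unfolding finite_forest_def by auto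
  show "roots (W \<union> F) (E \<union> {y} \<times> F) = roots W E - F"
    using noE by (auto simp: roots_def)
qed

lemma finite_forest_regular_tree:
  assumes W: "finite_forest d W E" and r: "roots W E = {r}"
  shows "regular_tree d \<lparr>verts = W, edges = E\<rparr>"
proof -
  have E: "E \<subseteq> W \<times> W" "finite W" using W by (auto simp: finite_forest_def)
  then have "finite E" by (meson finite_SigmaI finite_subset)
  then have wf: "wf E" using W finite_acyclic_wf by (auto simp: finite_forest_def)
  have ch: "children \<lparr>verts = W, edges = E\<rparr> v = E `` {v}" for v by (auto simp: children_def)
  have "(r, v) \<in> E\<^sup>*" if "v \<in> W" for v
    using that
  proof (induction v rule: wf_induct_rule[OF wf])
    case (1 v)
    show ?case
    proof (cases "v \<in> roots W E")
      case False
      then obtain u where "(u, v) \<in> E" using 1 by (auto simp: roots_def)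
      moreover from this have "u \<in> W" using E by blast
      ultimately have "(r, u) \<in> E\<^sup>*" using 1 by blast
      then show ?thesis using \<open>(u, v) \<in> E\<close> by (rule rtrancl_into_rtrancl)
    qed (use r in simp)
  qed
  moreover have "r \<in> W" "\<And>u. (u, r) \<notin> E" using r by (auto simp: roots_def)
  moreover have "u = u'" if "(u, v) \<in> E" "(u', v) \<in> E" for u u' v
    using that W unfolding finite_forest_def single_valued_def by blast
  ultimately have "rooted_tree \<lparr>verts = W, edges = E\<rparr>"
    using E unfolding rooted_tree_def digraph.simps by blast
  then show ?thesis
    using W ch unfolding regular_tree_def finite_forest_def by simp
qed

lemma reach_inside:
  assumes "E \<subseteq> W \<times> W" "(x, y) \<in> E\<^sup>*"
  shows "x = y \<or> x \<in> W \<and> y \<in> W"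
  using assms(2) by (induction rule: rtrancl_induct) (use assms(1) in auto)

lemma roots_reach_unique:
  assumes W: "finite_forest d W E" and "r \<in> roots W E" "r' \<in> roots W E"
    and "(r, y) \<in> E\<^sup>*" "(r', y) \<in> E\<^sup>*"
  shows "r = r'"
  using assms(4,5)
proof (induction rule: rtrancl_induct)
  case base
  then show ?case using assms(2) by (auto simp: roots_def elim: rtranclE)
next
  case (step u w)
  have "r' \<noteq> w" using step assms(3) by (auto simp: roots_def)
  then obtain u' where "(r', u') \<in> E\<^sup>*" "(u', w) \<in> E" using step.prems by (metis rtranclE)
  moreover have "u = u'" using calculation step W by (auto simp: finite_forest_def single_valued_def)
  ultimately show ?case using step by blast
qed

text \<open>Nodes of \<open>S\<close> outside of the boundary \<open>B\<close> must not receive new neighbors, since all of their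
  neighbors have been revealed.\<close>

definition extension :: "nat \<Rightarrow> nat set \<Rightarrow> nat set \<Rightarrow> (nat \<times> nat) set \<Rightarrow> nat set \<Rightarrow> (nat \<times> nat) set \<Rightarrow> bool" where
  "extension d S B R W E \<longleftrightarrow> finite_forest d W E \<and> S \<subseteq> W \<and> E \<inter> S \<times> S = R \<and>
     (\<forall>(a, b)\<in>E. (a \<in> S \<longrightarrow> b \<in> S \<or> a \<in> B) \<and> (b \<in> S \<longrightarrow> a \<in> S \<or> b \<in> B)) \<and> roots W E \<subseteq> S \<inter> B"

text \<open>A leaf below \<open>r\<close> that may receive children without any effect on the
  interior of \<open>S\<close>.\<close>

definition port :: "nat set \<Rightarrow> nat set \<Rightarrow> nat set \<Rightarrow> (nat \<times> nat) set \<Rightarrow> nat \<Rightarrow> nat \<Rightarrow> bool" where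
  "port S B W E r y \<longleftrightarrow> y \<in> W \<and> (r, y) \<in> E\<^sup>* \<and> E `` {y} = {} \<and> (y \<in> S \<longrightarrow> y \<in> B)"

lemma extension_attach:
  assumes X: "extension d S B R W E" and y: "port S B W E r y"
    and F: "finite F" "card F = d" "F \<inter> W \<subseteq> roots W E" and ny: "\<And>f. f \<in> F \<Longrightarrow> (f, y) \<notin> E\<^sup>*"
    and yF: "y \<notin> S \<or> F \<inter> S = {}"
  shows "extension d S B R (W \<union> F) (E \<union> {y} \<times> F)"
    and "roots (W \<union> F) (E \<union> {y} \<times> F) = roots W E - F"
proof -
  have W: "finite_forest d W E" using X by (simp add: extension_def)
  have y': "y \<in> W" "E `` {y} = {}" using y by (auto simp: port_def)
  note att = finite_forest_attach[OF W y' F ny]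
  show "roots (W \<union> F) (E \<union> {y} \<times> F) = roots W E - F" by (rule att)
  have "f \<in> B" if "f \<in> F" "f \<in> S" for f
    using that X F(3) unfolding extension_def by blast
  then show "extension d S B R (W \<union> F) (E \<union> {y} \<times> F)"
    using X y yF att unfolding extension_def port_def by auto
qed

lemma fresh_set:
  assumes "finite (W :: nat set)"
  shows "\<exists>F. finite F \<and> card F = d \<and> F \<inter> W = {}"
proof -
  have "infinite (- W)" using assms by (simp add: Compl_eq_Diff_UNIV)
  then obtain F where "F \<subseteq> - W" "finite F" "card F = d" using infinite_arbitrarily_large by metis
  then show ?thesis by blast
qed

text \<open>Each step hangs \<open>d\<close> fresh leaves below the port, and one of them is the
  next port. So the size can grow by any multiple of \<open>d\<close>.\<close>

lemma extension_pad:
  assumes d: "d \<ge> 1" and "extension d S B R W E" "roots W E = {r}" "port S B W E r y"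
  shows "\<exists>W' E' y'. extension d S B R W' E' \<and> roots W' E' = {r} \<and> port S B W' E' r y' \<and> card W' = card W + d * m"
proof (induction m)
  case 0
  then show ?case using assms by auto
next
  case (Suc m)
  then obtain W' E' y' where X: "extension d S B R W' E'" and r: "roots W' E' = {r}"
    and y: "port S B W' E' r y'" and card: "card W' = card W + d * m" by blast
  have fin: "finite W'" and E: "E' \<subseteq> W' \<times> W'" and SW: "S \<subseteq> W'"
    using X by (auto simp: extension_def finite_forest_def)
  obtain F where F: "finite F" "card F = d" "F \<inter> W' = {}" using fresh_set[OF fin] by blast
  have ny: "(f, y') \<notin> E'\<^sup>*" if "f \<in> F" for f
  proof
    assume "(f, y') \<in> E'\<^sup>*"
    moreover have "f \<noteq> y'" using that F y by (auto simp: port_def)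
    ultimately show False using reach_inside[OF E] that F by blast
  qed
  have sub: "F \<inter> W' \<subseteq> roots W' E'" "y' \<notin> S \<or> F \<inter> S = {}" using F(3) SW by auto
  note att = extension_attach[OF X y F(1,2) sub(1) ny sub(2)]
  obtain f where f: "f \<in> F" using F(2) d by (metis card.empty equals0I not_one_le_zero)
  have "f \<notin> W'" using f F by blast
  moreover have "(r, f) \<in> (E' \<union> {y'} \<times> F)\<^sup>*"
    by (rule star_reach[OF _ f]) (use y in \<open>simp add: port_def\<close>)
  ultimately have "port S B (W' \<union> F) (E' \<union> {y'} \<times> F) r f"
    using f E SW y by (auto simp: port_def)
  moreover have "roots (W' \<union> F) (E' \<union> {y'} \<times> F) = {r}"
    using att(2) r F(3) by (auto simp: roots_def)
  moreover have "card (W' \<union> F) = card W + d * Suc m"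
    using F fin card by (simp add: card_Un_disjoint Int_commute)
  ultimately show ?case using att(1) by blast
qed

text \<open>\<open>r'\<close> is hung below a fresh child \<open>f\<close> of the port of
  \<open>r\<close>, not below the port itself: an edge between two nodes of \<open>S\<close> would
  change the revealed graph. This costs \<open>d\<close> fresh children of the port and
  \<open>d - 1\<close> fresh siblings of \<open>r'\<close>. Afterwards the port of \<open>r'\<close>
  serves \<open>r\<close>.\<close>

lemma extension_merge:
  assumes d: "d \<ge> 1" and X: "extension d S B R W E"
    and r: "r \<in> roots W E" "r' \<in> roots W E" "r \<noteq> r'"
    and ports: "\<And>q. q \<in> roots W E \<Longrightarrow> \<exists>y. port S B W E q y"
  shows "\<exists>W' E'. extension d S B R W' E' \<and> roots W' E' = roots W E - {r'} \<and>
    (\<forall>q\<in>roots W' E'. \<exists>y. port S B W' E' q y) \<and> card W' + 1 = card W + 2 * d"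
proof -
  have W: "finite_forest d W E" and SW: "S \<subseteq> W" using X by (auto simp: extension_def)
  have fin: "finite W" and E: "E \<subseteq> W \<times> W" using W by (auto simp: finite_forest_def)
  obtain y where y: "port S B W E r y" using ports r by blast
  obtain y' where y': "port S B W E r' y'" using ports r by blast
  obtain F where F: "finite F" "card F = d" "F \<inter> W = {}" using fresh_set[OF fin] by blast
  define W1 where "W1 = W \<union> F"
  define E1 where "E1 = E \<union> {y} \<times> F"
  obtain F' where F': "finite F'" "card F' = d - 1" "F' \<inter> W1 = {}"
    using fresh_set[of W1 "d - 1"] fin F(1) by (auto simp: W1_def)
  obtain f where f: "f \<in> F" using F(2) d by (metis card.empty equals0I not_one_le_zero)
  have r'W: "r' \<in> W" "\<And>u. (u, r') \<notin> E" using r by (auto simp: roots_def)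
  have yW: "y \<in> W" using y by (simp add: port_def)
  have stuck: "(g, z) \<notin> E\<^sup>*" if "g \<notin> W" "g \<noteq> z" for g z
    using reach_inside[OF E] that by blast
  have stuck': "z \<notin> W \<Longrightarrow> (g, z) \<in> E\<^sup>* \<Longrightarrow> g = z" for g z
    using reach_inside[OF E] by blast
  have ny: "(g, y) \<notin> E\<^sup>*" if "g \<in> F" for g using stuck[of g y] that F yW by auto
  have sub: "F \<inter> W \<subseteq> roots W E" "y \<notin> S \<or> F \<inter> S = {}" using F SW by auto
  note att1 = extension_attach[OF X y F(1,2) sub(1) ny sub(2), folded W1_def E1_def]
  have roots1: "roots W1 E1 = roots W E" using att1(2) F(3) by (auto simp: roots_def)
  have E1: "E1 \<subseteq> W1 \<times> W1" using E yW by (auto simp: E1_def W1_def)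
  have EE1: "E\<^sup>* \<subseteq> E1\<^sup>*" by (rule rtrancl_mono) (simp add: E1_def)
  have rf: "(r, f) \<in> E1\<^sup>*"
    unfolding E1_def by (rule star_reach[OF _ f]) (use y in \<open>simp add: port_def\<close>)
  have port1: "port S B W1 E1 r f"
    using rf f F E SW yW unfolding port_def by (auto simp: E1_def W1_def)
  have nf: "(g, f) \<notin> E1\<^sup>*" if "g \<in> insert r' F'" for g
  proof
    assume gf: "(g, f) \<in> E1\<^sup>*"
    show False
    proof (cases "g = r'")
      case True
      have "(r', f) \<notin> E\<^sup>*" using stuck'[of f r'] f F r'W by auto
      then have "(r', y) \<in> E\<^sup>*" using rtrancl_Un_star gf True unfolding E1_def by metis
      then show False using roots_reach_unique[OF W r(1,2)] y r(3) by (auto simp: port_def)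
    next
      case False
      then have "g \<notin> W1" "g \<noteq> f" using that F' f by (auto simp: W1_def)
      then show False using reach_inside[OF E1 gf] by blast
    qed
  qed
  have r'F': "r' \<notin> F'" using F' r'W by (auto simp: W1_def)
  have cardF: "card (insert r' F') = d" using F' d r'F' by simp
  have sub': "insert r' F' \<inter> W1 \<subseteq> roots W1 E1" "f \<notin> S \<or> insert r' F' \<inter> S = {}"
    using F' roots1 r f F SW by auto
  define W2 where "W2 = W1 \<union> insert r' F'"
  define E2 where "E2 = E1 \<union> {f} \<times> insert r' F'"
  note att2 = extension_attach[OF att1(1) port1 _ cardF sub'(1) nf sub'(2), folded W2_def E2_def]
  have roots2: "roots W2 E2 = roots W E - {r'}"
    using att2(2) F' roots1 by (auto simp: roots_def W1_def)
  have E12: "E1\<^sup>* \<subseteq> E2\<^sup>*" by (rule rtrancl_mono) (auto simp: E2_def)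
  have keep: "port S B W2 E2 q z" if "port S B W E q' z" "(q, q') \<in> E2\<^sup>*" "z \<noteq> y" for q q' z
  proof -
    have "z \<in> W" "E `` {z} = {}" "(q', z) \<in> E\<^sup>*" "z \<in> S \<longrightarrow> z \<in> B" using that(1) by (auto simp: port_def)
    moreover have "z \<noteq> f" using calculation(1) f F by auto
    moreover have "(q, z) \<in> E2\<^sup>*" using that(2) calculation(3) EE1 E12 by (meson rtrancl_trans subsetD)
    ultimately show ?thesis using that(3) unfolding port_def by (auto simp: E2_def E1_def W2_def W1_def)
  qed
  have y_root: "q = r" if "port S B W E q y" "q \<in> roots W E" for q
    using roots_reach_unique[OF W that(2) r(1), of y] that(1) y by (auto simp: port_def)
  have "(f, r') \<in> E2" by (simp add: E2_def)
  then have rr': "(r, r') \<in> E2\<^sup>*" using rf E12 by (meson rtrancl_into_rtrancl subsetD)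
  have "\<exists>z. port S B W2 E2 q z" if q: "q \<in> roots W2 E2" for q
  proof (cases "q = r")
    case True
    have "y' \<noteq> y" using y' y_root r by blast
    then show ?thesis using keep[OF y' rr'] True by blast
  next
    case False
    have qr: "q \<in> roots W E" using q roots2 by simp
    then obtain z where "port S B W E q z" using ports by blast
    moreover from this have "z \<noteq> y" using y_root[of q] qr False by auto
    ultimately show ?thesis using keep[of q z q] by blast
  qed
  moreover have "card W2 + 1 = card W + 2 * d"
  proof -
    have "W2 = W1 \<union> F'" using r'W by (auto simp: W2_def W1_def)
    then have "card W2 = card W1 + card F'" using F' fin F(1) by (simp add: card_Un_disjoint Int_commute W1_def)
    moreover have "card W1 = card W + d" using F fin by (simp add: card_Un_disjoint Int_commute W1_def)
    ultimately show ?thesis using F' d by simp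
  qed
  ultimately show ?thesis using att2(1) roots2 F'(1) by (intro exI[of _ W2] exI[of _ E2]) auto
qed

lemma extension_connect:
  assumes d: "d \<ge> 1" and "extension d S B R W E" and "roots W E \<noteq> {}"
    and "\<And>q. q \<in> roots W E \<Longrightarrow> \<exists>y. port S B W E q y"
  shows "\<exists>W' E' r y. extension d S B R W' E' \<and> roots W' E' = {r} \<and> port S B W' E' r y \<and>
    card W' \<le> card W + 2 * d * card (roots W E)"
  using assms(2-4)
proof (induction "card (roots W E)" arbitrary: W E rule: less_induct)
  case less
  have fin: "finite (roots W E)"
    using less.prems(1) by (auto simp: extension_def finite_forest_def roots_def)
  obtain r where r: "r \<in> roots W E" using less.prems by blast
  show ?case
  proof (cases "roots W E = {r}")
    case True
    then obtain y where "port S B W E r y" using less.prems(3) by blast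
    then show ?thesis using True less.prems(1) by (metis le_add1)
  next
    case False
    then obtain r' where r': "r' \<in> roots W E" "r \<noteq> r'" using r by blast
    obtain W' E' where X: "extension d S B R W' E'" and rts: "roots W' E' = roots W E - {r'}"
      and ports: "\<And>q. q \<in> roots W' E' \<Longrightarrow> \<exists>y. port S B W' E' q y" and card: "card W' + 1 = card W + 2 * d"
      using extension_merge[OF d less.prems(1) r r' less.prems(3)] by blast
    have c: "card (roots W E) = Suc (card (roots W' E'))"
      using rts r'(1) fin by (metis card_Suc_Diff1)
    have "roots W' E' \<noteq> {}" using rts r r' by auto
    from less.hyps[OF _ X this ports] c
    obtain W2 E2 r2 y2 where "extension d S B R W2 E2" "roots W2 E2 = {r2}" "port S B W2 E2 r2 y2"
      "card W2 \<le> card W' + 2 * d * card (roots W' E')" by auto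
    moreover from this(4) have "card W2 \<le> card W + 2 * d * card (roots W E)"
      using card unfolding c by (simp add: algebra_simps)
    ultimately show ?thesis by blast
  qed
qed

context ranked
begin

text \<open>Missing siblings are added, the pieces are linked at ports, and leaves are padded until
  the size is exactly \<open>n\<close>. The factor \<open>3 * \<delta> + 1\<close> pays for the
  nodes of \<open>S\<close>, at most \<open>\<delta>\<close> children for each, and at most
  \<open>2 * \<delta>\<close> nodes per link, with at most \<open>card S\<close> roots.\<close>

lemma completion:
  assumes F: "forest C par" and ps: "finite ps" "ps \<noteq> {}" and S: "S = (\<Union>u\<in>ps. ball par T u)"
    and n: "n = 1 + \<delta> * m" "(3 * \<delta> + 1) * card S \<le> n"
  shows "\<exists>G :: nat digraph. regular_tree \<delta> G \<and> card (verts G) = n \<and> S \<subseteq> verts G \<and>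
    edges G \<inter> S \<times> S = {(par v, v) | v. v \<in> S \<and> par v \<in> S} \<and> (\<forall>u\<in>ps. nbhd G T u = ball par T u)"
proof -
  define R where "R = {(par v, v) | v. v \<in> S \<and> par v \<in> S}"
  \<comment> \<open>Nodes seen at distance exactly \<open>T\<close> only; these alone may have
    neighbors outside of \<open>S\<close>.\<close>
  define B where "B = {v \<in> S. \<forall>u\<in>ps. \<forall>t<T. v \<notin> ball par t u}"
  \<comment> \<open>A node with one child in \<open>S\<close> is no leaf, so it must get all of its
    children.\<close>
  define S' where "S' = {c. par c \<in> S \<and> (\<exists>c'\<in>S. par c' = par c)}"
  define W where "W = S \<union> S'"
  define E where "E = {(par c, c) | c. c \<in> S'}"
  have finS: "finite S" using S ps card_ball[OF F] by blast
  have inner: "par v \<in> S" "\<And>c. par c = v \<Longrightarrow> c \<in> S" if v: "v \<in> S" "v \<notin> B" for v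
  proof -
    obtain u t where ut: "u \<in> ps" "t < T" "v \<in> ball par t u" using v by (auto simp: B_def)
    have near: "w \<in> S" if "w \<in> ball par 1 v" for w
      using ball_trans[OF ut(3) that] ut ball_mono[of "t + 1" T par u] S by auto
    show "par v \<in> S" using near[of "par v"] ball_ancestor[of 1 1 par v] by simp
    show "c \<in> S" if "par c = v" for c using near ball_descendant[of 1 par c v 1] that by simp
  qed
  have S'sub: "S' \<subseteq> (\<Union>v\<in>S. {c. par c = v})" by (auto simp: S'_def)
  have finS': "finite S'" using S'sub finS finite_children[OF F] by (meson finite_UN_I finite_subset)
  have ch_le: "card {c. par c = v} \<le> \<delta>" for v
  proof (cases "rk v > 0")
    case False
    then have "par c \<noteq> v" for c using rk_par[OF F, of c] by auto
    then have "{c. par c = v} = {}" by simp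
    then show ?thesis by simp
  qed (use card_children[OF F] in simp)
  have "card S' \<le> (\<Sum>v\<in>S. card {c. par c = v})"
    using finS finite_children[OF F] by (intro order.trans[OF card_mono[OF _ S'sub] card_UN_le]) auto
  also have "\<dots> \<le> \<delta> * card S" using sum_mono[of S "\<lambda>v. card {c. par c = v}" "\<lambda>_. \<delta>"] ch_le
    by (simp add: mult.commute)
  finally have cardW: "card W \<le> card S + \<delta> * card S"
    unfolding W_def by (meson add_left_mono card_Un_le le_trans)
  have EF: "E `` {v} = {c. par c = v}" if "E `` {v} \<noteq> {}" for v
    using that by (auto simp: E_def S'_def)
  have acyc: "acyclic E"
  proof (rule acyclicI, rule allI, rule notI)
    fix x assume "(x, x) \<in> E\<^sup>+"
    then obtain k where k: "k > 0" "(x, x) \<in> E ^^ k" using trancl_power by metis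
    have "(a, b) \<in> E ^^ k \<Longrightarrow> (par ^^ k) b = a" for a b k
    proof (induction k arbitrary: b)
      case (Suc k)
      then obtain c where "(a, c) \<in> E ^^ k" "(c, b) \<in> E" by auto
      then show ?case using Suc.IH by (auto simp: E_def funpow_swap1)
    qed simp
    then show False using k par_acyclic[OF F] by blast
  qed
  have FF: "finite_forest \<delta> W E"
    unfolding finite_forest_def
  proof (intro conjI ballI impI acyc)
    show "finite W" using finS finS' by (simp add: W_def)
    show "E \<subseteq> W \<times> W" by (auto simp: E_def W_def S'_def)
    show "single_valued (E\<inverse>)" by (auto simp: E_def single_valued_def)
    fix v assume "E `` {v} \<noteq> {}"
    moreover from this obtain c where "v = par c" by (auto simp: E_def)
    then have "rk v > 0" using rk_par[OF F] by simp
    ultimately have "E `` {v} = {c. par c = v}" "card {c. par c = v} = \<delta>"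
      using EF card_children[OF F] by blast+
    then show "card (E `` {v}) = \<delta>" by simp
  qed
  have rootsW: "roots W E \<subseteq> {v \<in> S. par v \<notin> S}"
    by (auto simp: roots_def W_def E_def S'_def)
  have rootsB: "roots W E \<subseteq> S \<inter> B" using rootsW inner(1) by auto
  have X: "extension \<delta> S B R W E"
    unfolding extension_def
  proof (intro conjI FF rootsB)
    show "S \<subseteq> W" by (simp add: W_def)
    show "E \<inter> S \<times> S = R" by (auto simp: E_def R_def S'_def)
    show "\<forall>(a, b)\<in>E. (a \<in> S \<longrightarrow> b \<in> S \<or> a \<in> B) \<and> (b \<in> S \<longrightarrow> a \<in> S \<or> b \<in> B)"
      using inner by (auto simp: E_def S'_def)
  qed
  \<comment> \<open>Main children are followed down from \<open>r\<close> until they leave the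
    finite set \<open>S\<close>. The first node outside is a leaf if it was added as a sibling;
    otherwise its parent is a leaf on the boundary.\<close>
  have port: "\<exists>y. port S B W E r y" if r: "r \<in> roots W E" for r
  proof (cases "rk r > 0")
    case False
    then have "par c \<noteq> r" for c using rk_par[OF F, of c] by auto
    then have "E `` {r} = {}" by (auto simp: E_def)
    then show ?thesis using r rootsB by (intro exI[of _ r]) (auto simp: port_def roots_def)
  next
    case True
    define nxt where "nxt = (\<lambda>v. THE c. par c = v \<and> main c)"
    have nxt: "par (nxt v) = v" "main (nxt v)" if "rk v > 0" for v
      using theI'[OF main_child[OF F that]] by (auto simp: nxt_def)
    define q where "q = (\<lambda>i. (nxt ^^ i) r)"
    have rkq: "rk (q i) > 0" for i
      by (induction i) (use True nxt main_rk in \<open>auto simp: q_def\<close>)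
    have parq: "par (q (Suc i)) = q i" for i using nxt(1)[OF rkq[of i]] by (simp add: q_def)
    have powq: "(par ^^ i) (q i) = r" for i
      by (induction i) (auto simp: funpow_swap1 parq, simp add: q_def)
    have "inj q"
    proof (rule injI)
      fix i j assume "q i = q j"
      then have "(par ^^ (i + j)) (q i) = (par ^^ (j + i)) (q j)" by (simp add: add.commute)
      then have "(par ^^ j) r = (par ^^ i) r"
        using powq by (metis add.commute comp_apply funpow_add)
      then show "i = j" using par_pow_inj[OF F] by metis
    qed
    then have "\<exists>i. q i \<notin> S" using finS by (meson finite_subset image_subsetI infinite_UNIV_nat finite_imageD)
    define i where "i = (LEAST i. q i \<notin> S)"
    have iS: "q i \<notin> S" unfolding i_def using \<open>\<exists>i. q i \<notin> S\<close> by (rule LeastI_ex)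
    have before: "q j \<in> S" if "j < i" for j using that not_less_Least by (auto simp: i_def)
    have "q 0 = r" by (simp add: q_def)
    then have "i \<noteq> 0" using iS r rootsB by (metis IntD1 subsetD)
    then obtain i' where i': "i = Suc i'" by (cases i) auto
    have edge: "(q j, q (Suc j)) \<in> E" if "Suc j < i" for j
      using before[OF that] before[of j] that parq[of j] by (auto simp: E_def S'_def intro!: exI[of _ "q (Suc j)"])
    have reach: "j < i \<Longrightarrow> (r, q j) \<in> E\<^sup>*" for j
      by (induction j) (use edge \<open>q 0 = r\<close> in \<open>auto intro: rtrancl_into_rtrancl\<close>)
    have q': "q i' \<in> S" "par (q i) = q i'" "(r, q i') \<in> E\<^sup>*" using before[of i'] parq[of i'] reach[of i'] i' by auto
    show ?thesis
    proof (cases "(q i', q i) \<in> E")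
      case True
      then have "q i \<in> S'" by (auto simp: E_def)
      moreover have "E `` {q i} = {}" using iS by (auto simp: E_def S'_def)
      ultimately show ?thesis
        using True q' iS by (intro exI[of _ "q i"]) (auto simp: port_def W_def intro: rtrancl_into_rtrancl)
    next
      case False
      then have "E `` {q i'} = {}" using EF[of "q i'"] q' by auto
      moreover have "q i' \<in> B" using inner(2)[of "q i'" "q i"] q' iS by blast
      ultimately show ?thesis using q' by (intro exI[of _ "q i'"]) (auto simp: port_def W_def)
    qed
  qed
  have "S \<noteq> {}" using ps self_in_ball S by fastforce
  have "roots W E \<noteq> {}"
  proof
    assume none: "roots W E = {}"
    obtain v where "v \<in> S" using \<open>S \<noteq> {}\<close> by blast
    then have pW: "(par ^^ i) v \<in> W" for i
    proof (induction i)
      case (Suc i)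
      then obtain u where "(u, (par ^^ i) v) \<in> E" using none by (auto simp: roots_def)
      then show ?case using Suc by (auto simp: E_def S'_def W_def)
    qed (simp add: W_def)
    moreover have "inj (\<lambda>i. (par ^^ i) v)" using par_pow_inj[OF F] by (meson injI)
    ultimately show False using FF unfolding finite_forest_def
      by (metis finite_imageD finite_subset image_subsetI infinite_UNIV_nat)
  qed
  then obtain W' E' r y where X': "extension \<delta> S B R W' E'" and r: "roots W' E' = {r}"
    and y: "port S B W' E' r y" and cardW': "card W' \<le> card W + 2 * \<delta> * card (roots W E)"
    using extension_connect[OF \<delta> X _ port] by blast
  have "card (roots W E) \<le> card S" using rootsB finS by (intro card_mono) auto
  then have "card W' \<le> card S + \<delta> * card S + 2 * \<delta> * card S"
    using cardW cardW' by (meson add_mono le_trans mult_le_mono2)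
  then have "card W' \<le> n" using n(2) by (simp add: algebra_simps)
  have "finite_forest \<delta> W' E'" using X' by (simp add: extension_def)
  from regular_tree_card[OF finite_forest_regular_tree[OF this r]]
  obtain a where a: "card W' = 1 + \<delta> * a" by auto
  then have "a \<le> m" using \<open>card W' \<le> n\<close> n(1) \<delta> by simp
  obtain W2 E2 where X2: "extension \<delta> S B R W2 E2" and r2: "roots W2 E2 = {r}"
    and card2: "card W2 = card W' + \<delta> * (m - a)"
    using extension_pad[OF \<delta> X' r y] by blast
  have cardn: "card W2 = n"
    using card2 a n(1) \<open>a \<le> m\<close> by (simp add: add_mult_distrib2[symmetric])
  define G where "G = \<lparr>verts = W2, edges = E2\<rparr>"
  have FF2: "finite_forest \<delta> W2 E2" and SW: "S \<subseteq> W2" and ER: "E2 \<inter> S \<times> S = R"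
    and bnd: "\<And>a b. (a, b) \<in> E2 \<Longrightarrow> (a \<in> S \<longrightarrow> b \<in> S \<or> a \<in> B) \<and> (b \<in> S \<longrightarrow> a \<in> S \<or> b \<in> B)"
    using X2 by (auto simp: extension_def)
  have reg: "regular_tree \<delta> G" unfolding G_def by (rule finite_forest_regular_tree[OF FF2 r2])
  let ?r = "edges G \<union> (edges G)\<inverse>"
  have up: "(v, (par ^^ i) v) \<in> ?r ^^ i" if "\<And>j. j \<le> i \<Longrightarrow> (par ^^ j) v \<in> S" for v i
    using that
  proof (induction i)
    case (Suc i)
    have "(par ((par ^^ i) v), (par ^^ i) v) \<in> R" using Suc.prems[of i] Suc.prems[of "Suc i"] by (auto simp: R_def)
    then have "((par ^^ i) v, (par ^^ Suc i) v) \<in> ?r" using ER by (auto simp: G_def)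
    then show ?case using Suc by (meson le_SucI relpow_Suc_I)
  qed simp
  have nb: "nbhd G T u = ball par T u" if u: "u \<in> ps" for u
  proof (intro equalityI subsetI)
    fix v assume v: "v \<in> ball par T u"
    then obtain a b where ab: "a + b \<le> T" "(par ^^ a) v = (par ^^ b) u" by (auto simp: ball_def)
    have subS: "ball par T u \<subseteq> S" using u S by auto
    have "(u, (par ^^ b) u) \<in> ?r ^^ b"
      using ab subS ball_ancestor[of _ T par u] by (intro up) (meson dual_order.trans le_add2 subsetD)
    moreover have "(v, (par ^^ a) v) \<in> ?r ^^ a"
      using ball_inner[OF ab] subS by (intro up) blast
    then have "((par ^^ a) v, v) \<in> (?r\<inverse>) ^^ a" by (simp add: relpow_converse_iff)
    moreover have "?r\<inverse> = ?r" by auto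
    ultimately have "(u, v) \<in> ?r ^^ (b + a)" using ab(2) relpow_add_I by metis
    then show "v \<in> nbhd G T u" using v subS SW ab(1) unfolding nbhd_def by (auto simp: G_def add.commute intro!: exI[of _ "b + a"])
  next
    fix v assume "v \<in> nbhd G T u"
    then obtain k where k: "k \<le> T" "(u, v) \<in> ?r ^^ k" by (auto simp: nbhd_def)
    \<comment> \<open>Along a path from \<open>u\<close>, every node at distance below
      \<open>T\<close> avoids \<open>B\<close>, so its edges in \<open>G\<close> are edges of the
      forest.\<close>
    have "(u, v) \<in> ?r ^^ k \<Longrightarrow> k \<le> T \<Longrightarrow> v \<in> ball par k u" for v k
    proof (induction k arbitrary: v)
      case 0
      then show ?case using self_in_ball by auto
    next
      case (Suc k)
      then obtain w where w: "(u, w) \<in> ?r ^^ k" "(w, v) \<in> ?r" by auto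
      then have wb: "w \<in> ball par k u" using Suc by simp
      then have wS: "w \<in> S" "w \<notin> B" using u S ball_mono[of k T par u] Suc.prems(2) by (auto simp: B_def)
      from w(2) have "v \<in> S" using bnd wS by (auto simp: G_def)
      then have "(w, v) \<in> R \<or> (v, w) \<in> R" unfolding ER[symmetric] using w(2) wS by (auto simp: G_def)
      then have "v = par w \<or> par v = w" by (auto simp: R_def)
      then have "v \<in> ball par 1 w" using ball_ancestor[of 1 1 par w] ball_descendant[of 1 par v w 1] by auto
      from ball_trans[OF wb this] show ?case by simp
    qed
    from this[OF k(2,1)] show "v \<in> ball par T u" using ball_mono[OF k(1)] by (rule rev_subsetD)
  qed
  show ?thesis
    using reg cardn SW ER nb by (intro exI[of _ G]) (auto simp: G_def R_def)
qed

end

section \<open>Exchanging subtrees\<close>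

lemma funpow_cong_orbit:
  assumes "\<And>i. i < k \<Longrightarrow> par' ((par ^^ i) z) = par ((par ^^ i) z)"
  shows "(par' ^^ k) z = (par ^^ k) z"
  using assms by (induction k) auto

lemma funpow_closed:
  assumes "\<And>v. par v \<in> K \<longleftrightarrow> v \<in> K"
  shows "(par ^^ k) v \<in> K \<longleftrightarrow> v \<in> K"
  by (induction k) (auto simp: assms)

lemma ball_closed:
  assumes "\<And>v. par v \<in> K \<longleftrightarrow> v \<in> K" and "v \<in> ball par t u"
  shows "v \<in> K \<longleftrightarrow> u \<in> K"
proof -
  obtain a b where "(par ^^ a) v = (par ^^ b) u" using assms(2) by (auto simp: ball_def)
  then show ?thesis
    using funpow_closed[of par K a v, OF assms(1)] funpow_closed[of par K b u, OF assms(1)] by simp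
qed

lemma ball_cong_closed:
  assumes K: "\<And>v. par v \<in> K \<longleftrightarrow> v \<in> K" "\<And>v. par' v \<in> K \<longleftrightarrow> v \<in> K"
    and eq: "\<And>v. v \<in> K \<Longrightarrow> par' v = par v" and u: "u \<in> K"
  shows "ball par' t u = ball par t u"
proof -
  have pow: "(par' ^^ i) v = (par ^^ i) v" if "v \<in> K" for v i
    by (rule funpow_cong_orbit) (use that funpow_closed[of par K, OF K(1)] eq in blast)
  show ?thesis
  proof (intro equalityI subsetI)
    fix v assume v: "v \<in> ball par' t u"
    then have "v \<in> K" using ball_closed[of par' K, OF K(2) v] u by simp
    then show "v \<in> ball par t u" using v pow u by (simp add: ball_def)
  next
    fix v assume v: "v \<in> ball par t u"
    then have "v \<in> K" using ball_closed[of par K, OF K(1) v] u by simp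
    then show "v \<in> ball par' t u" using v pow u by (simp add: ball_def)
  qed
qed

definition swap :: "('v \<Rightarrow> 'v) \<Rightarrow> 'v \<Rightarrow> 'v \<Rightarrow> 'v \<Rightarrow> 'v" where
  "swap par x y v = (if v = x then par y else if v = y then par x else par v)"

lemma swap_other: "v \<noteq> x \<Longrightarrow> v \<noteq> y \<Longrightarrow> swap par x y v = par v"
  by (simp add: swap_def)

text \<open>Every edge that is removed or added joins two of these four nodes, so no short path from
  \<open>u\<close> uses it.\<close>

lemma ball_swap:
  assumes "x \<notin> ball par t u" "par x \<notin> ball par t u" "y \<notin> ball par t u" "par y \<notin> ball par t u"
  shows "ball (swap par x y) t u = ball par t u"
proof -
  let ?s = "swap par x y"
  have up: "(?s ^^ b) u = (par ^^ b) u" if "b \<le> t" for b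
  proof (rule funpow_cong_orbit)
    fix i assume "i < b"
    then have "(par ^^ i) u \<in> ball par t u" using that by (intro ball_ancestor) simp
    then show "?s ((par ^^ i) u) = par ((par ^^ i) u)" using assms by (intro swap_other) auto
  qed
  show ?thesis
  proof (intro equalityI subsetI)
    fix v assume "v \<in> ball ?s t u"
    then obtain a b where ab: "a + b \<le> t" "(?s ^^ a) v = (?s ^^ b) u" by (auto simp: ball_def)
    then have "(?s ^^ a) v = (par ^^ b) u" using up by simp
    with ab(1) have "(par ^^ a) v = (par ^^ b) u"
    proof (induction a arbitrary: v)
      case (Suc a)
      have IH: "(par ^^ a) (?s v) = (par ^^ b) u"
        using Suc.IH[of "?s v"] Suc.prems by (simp add: funpow_swap1)
      then have "?s v \<in> ball par t u" using Suc.prems unfolding ball_def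
        by (intro CollectI exI[of _ a] exI[of _ b]) auto
      then have "v \<noteq> x" "v \<noteq> y" using assms by (auto simp: swap_def split: if_splits)
      then show ?case using IH by (simp add: funpow_swap1 swap_other)
    qed simp
    then show "v \<in> ball par t u" using ab(1) by (auto simp: ball_def)
  next
    fix v assume "v \<in> ball par t u"
    then obtain a b where ab: "a + b \<le> t" "(par ^^ a) v = (par ^^ b) u" by (auto simp: ball_def)
    have "(?s ^^ a) v = (par ^^ a) v"
    proof (rule funpow_cong_orbit)
      fix i assume "i < a"
      then have "(par ^^ i) v \<in> ball par t u" using ab by (intro ball_inner) auto
      then show "?s ((par ^^ i) v) = par ((par ^^ i) v)" using assms by (intro swap_other) auto
    qed
    moreover have "(?s ^^ b) u = (par ^^ b) u" using ab(1) by (intro up) simp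
    ultimately show "v \<in> ball ?s t u" using ab unfolding ball_def by (intro CollectI exI[of _ a] exI[of _ b]) simp
  qed
qed

context ranked
begin

lemma forest_mono: "forest C par \<Longrightarrow> C \<le> C' \<Longrightarrow> forest C' par"
  unfolding forest_def by (meson le_trans)

text \<open>A new cycle would need an ascent from \<open>par x\<close> or \<open>par y\<close> back
  to \<open>x\<close> or \<open>y\<close>, but neither node lies above the other. Since both are
  main, each node keeps exactly one main child. The potential may drop across the exchanged edges; a
  shift by \<open>C\<close> repairs this and doubles the bound.\<close>

lemma forest_swap:
  assumes F: "forest C par" and xy: "main x" "main y"
    and un: "\<And>k. (par ^^ k) x \<noteq> y" "\<And>k. (par ^^ k) y \<noteq> x"
  shows "forest (2 * C) (swap par x y)"
proof -
  let ?s = "swap par x y"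
  have above: "(par ^^ i) (par z) \<notin> {x, y}" if "z \<in> {x, y}" for i z
  proof -
    have "(par ^^ i) (par z) = (par ^^ Suc i) z" by (simp add: funpow_swap1)
    moreover have "(par ^^ Suc i) z \<noteq> z" using par_acyclic[OF F] by blast
    ultimately show ?thesis using that un by (metis insertE singletonD)
  qed
  have pow: "(?s ^^ i) (par z) = (par ^^ i) (par z)" if "z \<in> {x, y}" for i z
    by (rule funpow_cong_orbit) (use above[OF that] in \<open>auto intro!: swap_other\<close>)
  have acyc: "(?s ^^ k) v \<noteq> v" if "k > 0" for k v
  proof
    assume cyc: "(?s ^^ k) v = v"
    show False
    proof (cases "\<exists>i<k. (?s ^^ i) v \<in> {x, y}")
      case False
      have "(?s ^^ i) v = (par ^^ i) v" if "i \<le> k" for i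
        using that
      proof (induction i)
        case (Suc i)
        then have "(?s ^^ i) v \<noteq> x" "(?s ^^ i) v \<noteq> y" using False by auto
        then show ?case using Suc by (simp add: swap_other)
      qed simp
      from this[of k] show False using cyc par_acyclic[OF F, of k v] \<open>k > 0\<close> by simp
    next
      case True
      then obtain i z where z: "z = (?s ^^ i) v" "z \<in> {x, y}" by blast
      have "(?s ^^ (k + i)) v = (?s ^^ (i + k)) v" by (simp only: add.commute)
      then have zk: "(?s ^^ k) z = z" using cyc z(1) by (simp only: funpow_add comp_apply)
      define w where "w = (if z = x then y else x)"
      have w: "w \<in> {x, y}" "?s z = par w" using z(2) un[of 0] by (auto simp: w_def swap_def)
      obtain k' where k': "k = Suc k'" using \<open>k > 0\<close> by (cases k) auto
      have "z = (?s ^^ k') (par w)" using zk w(2) k' by (simp add: funpow_swap1)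
      then show False using pow[OF w(1)] above[OF w(1)] z(2) by metis
    qed
  qed
  define \<sigma> where "\<sigma> = (\<lambda>v. if v = x then y else if v = y then x else v)"
  have s: "?s v = par (\<sigma> v)" for v by (simp add: swap_def \<sigma>_def)
  have inv: "\<sigma> (\<sigma> v) = v" for v by (simp add: \<sigma>_def)
  have main: "main (\<sigma> v) = main v" for v using xy by (simp add: \<sigma>_def)
  have ch: "{c. ?s c = v} = \<sigma> ` {c. par c = v}" for v
  proof (intro equalityI subsetI)
    fix c assume "c \<in> {c. ?s c = v}"
    then show "c \<in> \<sigma> ` {c. par c = v}" using s inv by (intro image_eqI[of _ _ "\<sigma> c"]) auto
  qed (use s inv in auto)
  have "inj \<sigma>" using inv by (metis injI)
  then have card: "card {c. ?s c = v} = card {c. par c = v}" for v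
    unfolding ch by (intro card_image) (auto intro: inj_on_subset)
  have mc: "\<exists>!c. ?s c = v \<and> main c" if "rk v > 0" for v
  proof -
    obtain c where c: "par c = v" "main c" "\<And>c'. par c' = v \<Longrightarrow> main c' \<Longrightarrow> c' = c"
      using main_child[OF F \<open>rk v > 0\<close>] by blast
    show ?thesis
    proof (rule ex1I[of _ "\<sigma> c"])
      show "?s (\<sigma> c) = v \<and> main (\<sigma> c)" using c(1,2) s inv main by simp
      fix c' assume "?s c' = v \<and> main c'"
      then have "\<sigma> c' = c" using c(3)[of "\<sigma> c'"] s main by simp
      then show "c' = \<sigma> c" using inv by metis
    qed
  qed
  obtain lam where lam: "\<And>v. lam v \<le> C" "\<And>v. lam v \<le> lam (par v)" "\<And>v. \<not> main v \<Longrightarrow> lam v < lam (par v)"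
    using F unfolding forest_def by blast
  \<comment> \<open>The nodes at or below \<open>x\<close> or \<open>y\<close> in the new forest
    keep their potential; all others are lifted by \<open>C\<close>, hence above everything in
    \<open>D\<close>.\<close>
  define D where "D = {v. \<exists>k. (?s ^^ k) v \<in> {x, y}}"
  define lam' where "lam' = (\<lambda>v. if v \<in> D then lam v else lam v + C)"
  have Dp: "v \<in> D \<longleftrightarrow> ?s v \<in> D" if "v \<notin> {x, y}" for v
  proof
    assume "v \<in> D"
    then obtain k where k: "(?s ^^ k) v \<in> {x, y}" by (auto simp: D_def)
    then have "k \<noteq> 0" using that by (metis funpow_0)
    then obtain k' where "k = Suc k'" by (cases k) auto
    then show "?s v \<in> D" using k by (auto simp: D_def funpow_swap1)
  next
    assume "?s v \<in> D"
    then obtain k where "(?s ^^ k) (?s v) \<in> {x, y}" by (auto simp: D_def)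
    then have "(?s ^^ Suc k) v \<in> {x, y}" by (simp add: funpow_swap1)
    then show "v \<in> D" unfolding D_def by blast
  qed
  have "lam' v \<le> 2 * C \<and> lam' v \<le> lam' (?s v) \<and> (\<not> main v \<longrightarrow> lam' v < lam' (?s v))" for v
  proof (cases "v \<in> {x, y}")
    case True
    define w where "w = (if v = x then y else x)"
    have w: "w \<in> {x, y}" "?s v = par w" using True un[of 0] by (auto simp: w_def swap_def)
    have "par w \<notin> D" using pow[OF w(1)] above[OF w(1)] unfolding D_def by auto
    moreover have "v \<in> D" using True unfolding D_def by (auto intro!: exI[of _ 0])
    moreover have "main v" using True xy by auto
    ultimately show ?thesis using w lam(1)[of v] lam(1)[of "par w"] by (simp add: lam'_def)
  next
    case False
    then have "?s v = par v" by (simp add: swap_def)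
    then show ?thesis using Dp[OF False] lam(1)[of v] lam(2)[of v] lam(3)[of v] by (auto simp: lam'_def)
  qed
  then show ?thesis
    unfolding forest_def using acyc card mc card_children[OF F] F
    by (intro conjI allI impI exI[of _ lam']) (auto simp: ch forest_def)
qed

text \<open>\<open>lam\<close> increases strictly above every non-main node, which is impossible for
  \<open>C + 1\<close> consecutive ancestors.\<close>

lemma main_above:
  assumes F: "forest C par"
  shows "\<exists>q. d \<le> q \<and> q \<le> d + C \<and> main ((par ^^ q) w)"
proof (rule ccontr)
  assume none: "\<not> ?thesis"
  obtain lam where lam: "\<And>v. lam v \<le> C" "\<And>v. \<not> main v \<Longrightarrow> lam v < lam (par v)"
    using F unfolding forest_def by blast
  have "i \<le> lam ((par ^^ (d + i)) w)" if "i \<le> Suc C" for i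
    using that
  proof (induction i)
    case (Suc i)
    then have "\<not> main ((par ^^ (d + i)) w)" using none by auto
    from lam(2)[OF this] show ?case using Suc by simp
  qed simp
  from this[of "Suc C"] show False using lam(1)[of "(par ^^ (d + Suc C)) w"] by simp
qed

lemma main_path:
  assumes F: "forest C par" and w: "rk w > 0"
  shows "\<exists>\<beta>. \<beta> 0 = w \<and> (\<forall>i. par (\<beta> (Suc i)) = \<beta> i \<and> main (\<beta> (Suc i)))"
proof -
  define nxt where "nxt = (\<lambda>v. THE c. par c = v \<and> main c)"
  have nxt: "par (nxt v) = v" "main (nxt v)" if "rk v > 0" for v
    using theI'[OF main_child[OF F that]] by (auto simp: nxt_def)
  have pos: "rk ((nxt ^^ i) w) > 0" for i
    by (induction i) (use w nxt main_rk in auto)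
  show ?thesis
    using nxt pos by (intro exI[of _ "\<lambda>i. (nxt ^^ i) w"]) simp
qed

end


section \<open>Labels assigned by an online algorithm in partial views\<close>

definition view :: "(nat \<Rightarrow> nat) \<Rightarrow> nat \<Rightarrow> nat set \<Rightarrow> nat digraph" where
  "view par T us = (let S = \<Union>u\<in>us. ball par T u in
     \<lparr>verts = S, edges = {(par v, v) | v. v \<in> S \<and> par v \<in> S}\<rparr>)"

lemma view_cong:
  assumes "\<And>u. u \<in> us \<Longrightarrow> ball par' T u = ball par T u"
    and "\<And>u v. u \<in> us \<Longrightarrow> v \<in> ball par T u \<Longrightarrow> par' v = par v"
  shows "view par' T us = view par T us"
proof -
  define S where "S = (\<Union>u\<in>us. ball par T u)"
  have S': "(\<Union>u\<in>us. ball par' T u) = S" using assms(1) by (simp add: S_def)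
  have "par' v = par v" if "v \<in> S" for v using that assms(2) by (auto simp: S_def)
  then have "{(par' v, v) | v. v \<in> S \<and> par' v \<in> S} = {(par v, v) | v. v \<in> S \<and> par v \<in> S}" by force
  then show ?thesis by (simp add: view_def S' flip: S_def)
qed

text \<open>The balls of radius \<open>T\<close> around at most \<open>Lmax\<close> nodes fit into an input tree with \<open>n\<close> nodes.
  Nodes of rank at least \<open>i\<close> are those from which the adversary tries to enforce a label that
  survives \<open>i\<close> rounds of pruning. The forest \<open>par0\<close> has infinitely many components, indexed by
  \<open>cmp\<close>, which serve as a supply of unrevealed structure.\<close>

locale game = ranked \<delta> rk main for \<delta> :: nat and rk :: "nat \<Rightarrow> nat" and main :: "nat \<Rightarrow> bool" +
  fixes P :: "'l lcl" and A :: "'l online_alg" and n m T Lmax Cmax gap k :: nat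
    and par0 :: "nat \<Rightarrow> nat" and cmp :: "nat \<Rightarrow> nat"
  assumes P: "is_lcl P" and arity: "arity P = \<delta>"
    and solves: "\<And>G vs. regular_tree \<delta> G \<Longrightarrow> card (verts G) = n \<Longrightarrow> distinct vs \<Longrightarrow> set vs = verts G \<Longrightarrow>
      feasible P G (online_output A T G vs)"
    and n: "n = 1 + \<delta> * m" "(3 * \<delta> + 1) * (Lmax * ((T + 1) ^ (Cmax + 2) * \<delta> ^ Cmax)) \<le> n"
    and gap: "\<And>j a X. j < k \<Longrightarrow> a \<in> pruned P j - pruned P (Suc j) \<Longrightarrow>
      \<exists>l. X \<le> l \<and> l \<le> X + gap \<and> (a, a) \<notin> steps P (pruned P j) ^^ l"
    and empty: "pruned P k = {}"
    and par0_cmp: "cmp (par0 v) = cmp v"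
    and par0_rk: "rk v \<le> rk (par0 v)" "rk (par0 v) \<le> Suc (rk v)" "main v \<Longrightarrow> rk (par0 v) = rk v"
    and fresh: "\<exists>v. cmp v = t \<and> rk v \<ge> k"
begin

text \<open>The counterpart of \<open>online_output\<close>, with the infinite forest in place of an
  input tree.\<close>

definition lb :: "(nat \<Rightarrow> nat) \<Rightarrow> nat list \<Rightarrow> nat \<Rightarrow> 'l" where
  "lb par ps u = (let qs = takeWhile (\<lambda>w. w \<noteq> u) ps @ [u] in A n qs (view par T (set qs)))"

lemma lb_append: "u \<in> set ps \<Longrightarrow> lb par (ps @ qs) u = lb par ps u"
  by (simp add: lb_def takeWhile_append1)

lemma lb_cong:
  assumes "u \<in> set ps" "\<And>u. u \<in> set ps \<Longrightarrow> ball par' T u = ball par T u"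
    and "\<And>u v. u \<in> set ps \<Longrightarrow> v \<in> ball par T u \<Longrightarrow> par' v = par v"
  shows "lb par' ps u = lb par ps u"
proof -
  have "set (takeWhile (\<lambda>w. w \<noteq> u) ps @ [u]) \<subseteq> set ps" using assms(1) by (auto dest: set_takeWhileD)
  then have "view par' T (set (takeWhile (\<lambda>w. w \<noteq> u) ps @ [u])) = view par T (set (takeWhile (\<lambda>w. w \<noteq> u) ps @ [u]))"
    using assms(2,3) by (intro view_cong) blast+
  then show ?thesis by (simp only: lb_def Let_def)
qed

text \<open>By \<open>completion\<close> the algorithm sees exactly what it would see in a genuine
  tree with \<open>n\<close> nodes, where the other nodes are presented after \<open>ps\<close>.
  Only at nodes whose children are all revealed does feasibility speak about known labels.\<close>

lemma lb_feasible:
  assumes F: "forest C par" "C \<le> Cmax" and ps: "distinct ps" "length ps \<le> Lmax"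
  shows "(\<forall>u\<in>set ps. lb par ps u \<in> labels P) \<and>
    (\<forall>v\<in>set ps. rk v > 0 \<longrightarrow> {c. par c = v} \<subseteq> set ps \<longrightarrow>
      (\<exists>us. distinct us \<and> set us = {c. par c = v} \<and> (lb par ps v, map (lb par ps) us) \<in> configs P))"
proof (cases "ps = []")
  case False
  define S where "S = (\<Union>u\<in>set ps. ball par T u)"
  have F': "forest Cmax par" using forest_mono F by blast
  have "card S \<le> (\<Sum>u\<in>set ps. card (ball par T u))" unfolding S_def by (rule card_UN_le) simp
  also have "\<dots> \<le> (\<Sum>u\<in>set ps. (T + 1) ^ (Cmax + 2) * \<delta> ^ Cmax)" using card_ball[OF F'] by (intro sum_mono) blast
  also have "\<dots> = length ps * ((T + 1) ^ (Cmax + 2) * \<delta> ^ Cmax)" by (simp only: sum_constant distinct_card[OF ps(1)] of_nat_id)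
  also have "\<dots> \<le> Lmax * ((T + 1) ^ (Cmax + 2) * \<delta> ^ Cmax)" using ps(2) by (rule mult_le_mono1)
  finally have "(3 * \<delta> + 1) * card S \<le> n" using n(2) by (meson le_trans mult_le_mono2)
  then obtain G :: "nat digraph" where G: "regular_tree \<delta> G" "card (verts G) = n" "S \<subseteq> verts G"
    and ER: "edges G \<inter> S \<times> S = {(par v, v) | v. v \<in> S \<and> par v \<in> S}"
    and nb: "\<And>u. u \<in> set ps \<Longrightarrow> nbhd G T u = ball par T u"
    using completion[OF F(1) _ _ S_def n(1)] False by auto
  have psS: "set ps \<subseteq> S" using self_in_ball by (fastforce simp: S_def)
  have tree: "rooted_tree G" using G(1) by (rule regular_tree_rooted)
  define rest where "rest = sorted_list_of_set (verts G - set ps)"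
  have vs: "distinct (ps @ rest)" "set (ps @ rest) = verts G"
    using ps(1) psS G(3) rooted_tree_finite[OF tree] by (auto simp: rest_def)
  note feas = solves[OF G(1,2) vs]
  have out: "online_output A T G (ps @ rest) u = lb par ps u" if u: "u \<in> set ps" for u
  proof -
    define qs where "qs = takeWhile (\<lambda>w. w \<noteq> u) ps @ [u]"
    have qs: "set qs \<subseteq> set ps" using u by (auto simp: qs_def dest: set_takeWhileD)
    define U where "U = (\<Union>u\<in>set qs. ball par T u)"
    have US: "U \<subseteq> S" using qs by (auto simp: U_def S_def)
    have "(\<Union>u\<in>set qs. nbhd G T u) = U" using qs nb by (auto simp: U_def)
    moreover have "edges G \<inter> U \<times> U = {(par v, v) | v. v \<in> U \<and> par v \<in> U}"
    proof -
      have "edges G \<inter> U \<times> U = (edges G \<inter> S \<times> S) \<inter> U \<times> U" using US by blast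
      also have "\<dots> = {(par v, v) | v. v \<in> U \<and> par v \<in> U}" unfolding ER using US by auto
      finally show ?thesis .
    qed
    moreover have "verts G \<inter> U = U" using US G(3) by blast
    ultimately have "induced G (\<Union>u\<in>set qs. nbhd G T u) = view par T (set qs)"
      by (simp add: induced_def view_def flip: U_def)
    then show ?thesis
      using u G(2) by (simp add: online_output_def lb_def takeWhile_append1 flip: qs_def)
  qed
  have ch: "children G v = {c. par c = v}" if v: "v \<in> set ps" "rk v > 0" "{c. par c = v} \<subseteq> set ps" for v
  proof -
    have sub: "{c. par c = v} \<subseteq> children G v"
    proof
      fix c assume c: "c \<in> {c. par c = v}"
      then have "(par c, c) \<in> {(par v, v) | v. v \<in> S \<and> par v \<in> S}" using v psS by auto
      then have "(par c, c) \<in> edges G" using ER by blast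
      then show "c \<in> children G v" using c by (simp add: children_def)
    qed
    have card: "card {c. par c = v} = \<delta>" using card_children[OF F(1) v(2)] .
    then have "children G v \<noteq> {}" using sub \<delta> by auto
    then have "card (children G v) = \<delta>" using G(1) v(1) psS G(3) by (auto simp: regular_tree_def)
    moreover have "finite (children G v)" using calculation \<delta> by (metis card.infinite not_one_le_zero)
    ultimately show ?thesis using card sub card_subset_eq by metis
  qed
  show ?thesis
  proof (intro conjI ballI impI)
    fix u assume "u \<in> set ps"
    then show "lb par ps u \<in> labels P" using feas out psS G(3) unfolding feasible_def by force
  next
    fix v assume v: "v \<in> set ps" "rk v > 0" "{c. par c = v} \<subseteq> set ps"
    have "card (children G v) = arity P" using ch[OF v] card_children[OF F(1) v(2)] arity by simp
    moreover have "v \<in> verts G" using v psS G(3) by auto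
    ultimately obtain us where us: "distinct us" "set us = children G v"
      "(online_output A T G (ps @ rest) v, map (online_output A T G (ps @ rest)) us) \<in> configs P"
      using feas unfolding feasible_def by blast
    moreover have "map (online_output A T G (ps @ rest)) us = map (lb par ps) us"
      using us(2) ch[OF v] v(3) out by auto
    ultimately show "\<exists>us. distinct us \<and> set us = {c. par c = v} \<and> (lb par ps v, map (lb par ps) us) \<in> configs P"
      using ch[OF v] out[OF v(1)] by auto
  qed
qed simp

section \<open>States, fragments and budgets of the adversary\<close>

lemma lost_level:
  assumes "a \<in> labels P" "a \<notin> pruned P j"
  shows "\<exists>i<j. a \<in> pruned P i - pruned P (Suc i)"
  using assms
proof (induction j)
  case (Suc j)
  then show ?case by (cases "a \<in> pruned P j") (auto simp del: pruned.simps(2) intro: less_SucI)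
qed simp

text \<open>Components with index at least \<open>\<tau>\<close> are unrevealed and still as in
  \<open>par0\<close>: the reserve for later moves.\<close>

definition state :: "nat \<Rightarrow> (nat \<Rightarrow> nat) \<Rightarrow> nat list \<Rightarrow> nat \<Rightarrow> bool" where
  "state C par ps \<tau> \<longleftrightarrow> forest C par \<and> distinct ps \<and> (\<forall>u\<in>set ps. cmp u < \<tau>) \<and>
     (\<forall>v. cmp (par v) < \<tau> \<longleftrightarrow> cmp v < \<tau>) \<and> (\<forall>v. cmp v \<ge> \<tau> \<longrightarrow> par v = par0 v)"

definition continues :: "(nat \<Rightarrow> nat) \<Rightarrow> nat \<Rightarrow> (nat \<Rightarrow> nat) \<Rightarrow> nat list \<Rightarrow> nat \<Rightarrow> bool" where
  "continues par \<tau> par' qs \<tau>' \<longleftrightarrow> \<tau> \<le> \<tau>' \<and> (\<forall>v. cmp v < \<tau> \<longrightarrow> par' v = par v) \<and>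
     (\<forall>v. cmp (par' v) < \<tau> \<longleftrightarrow> cmp v < \<tau>) \<and> (\<forall>q\<in>set qs. \<tau> \<le> cmp q \<and> cmp q < \<tau>')"

text \<open>Joining two fragments of level \<open>i\<close> destroys the monotonicity of ranks above \<open>i\<close>, but only
  ranks up to \<open>i\<close> are needed afterwards, so ranks are capped.\<close>

definition nice :: "nat \<Rightarrow> (nat \<Rightarrow> nat) \<Rightarrow> nat set \<Rightarrow> bool" where
  "nice i par K \<longleftrightarrow> (\<forall>v\<in>K. min i (rk v) \<le> min i (rk (par v)) \<and>
     min i (rk (par v)) \<le> Suc (min i (rk v)) \<and> (main v \<longrightarrow> min i (rk (par v)) = min i (rk v)))"

text \<open>\<open>K\<close> is a union of whole components. The rank of \<open>w\<close> provides a
  main path below it, and \<open>B\<close> bounds how far the revealed part of \<open>K\<close>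
  reaches from \<open>w\<close>, so that edges farther away than \<open>T + B\<close> can be
  exchanged unnoticed.\<close>

definition fragment :: "(nat \<Rightarrow> nat) \<Rightarrow> nat list \<Rightarrow> nat set \<Rightarrow> nat \<Rightarrow> nat \<Rightarrow> nat \<Rightarrow> bool" where
  "fragment par ps K i w B \<longleftrightarrow> (\<forall>v. par v \<in> K \<longleftrightarrow> v \<in> K) \<and> nice (Suc i) par K \<and> w \<in> K \<and> w \<in> set ps \<and>
     rk w \<ge> Suc i \<and> lb par ps w \<in> pruned P i - pruned P (Suc i) \<and> (\<forall>s\<in>set ps \<inter> K. s \<in> ball par B w)"

text \<open>Budgets: \<open>L\<close> bounds the number of newly revealed nodes, \<open>J\<close> the number of exchanges
  (each of which doubles \<open>C\<close>), and \<open>B\<close> the radius of the fragment.\<close>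

definition reachable :: "nat \<Rightarrow> nat \<Rightarrow> nat \<Rightarrow> nat \<Rightarrow> nat \<Rightarrow> (nat \<Rightarrow> nat) \<Rightarrow> nat list \<Rightarrow> nat \<Rightarrow> bool" where
  "reachable j L J B C par ps \<tau> \<longleftrightarrow> (\<exists>par' qs \<tau>' K i w. continues par \<tau> par' qs \<tau>' \<and>
     state (C * 2 ^ J) par' (ps @ qs) \<tau>' \<and> length qs \<le> L \<and> i < j \<and> K \<subseteq> {v. \<tau> \<le> cmp v \<and> cmp v < \<tau>'} \<and>
     fragment par' (ps @ qs) K i w B)"

text \<open>Quantifying over all states allows the same strategy to be replayed in fresh components
  while earlier fragments are kept.\<close>

definition enforces :: "nat \<Rightarrow> nat \<Rightarrow> nat \<Rightarrow> nat \<Rightarrow> bool" where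
  "enforces j L J B \<longleftrightarrow> (\<forall>C par ps \<tau>. state C par ps \<tau> \<longrightarrow> length ps + L \<le> Lmax \<longrightarrow> C * 2 ^ J \<le> Cmax \<longrightarrow>
     reachable j L J B C par ps \<tau>)"

lemma state_mono: "state C par ps \<tau> \<Longrightarrow> C \<le> C' \<Longrightarrow> state C' par ps \<tau>"
  unfolding state_def using forest_mono by blast

lemma continues_trans:
  assumes 1: "continues par \<tau> par1 q1 \<tau>1" and 2: "continues par1 \<tau>1 par2 q2 \<tau>2"
  shows "continues par \<tau> par2 (q1 @ q2) \<tau>2"
proof -
  have "\<tau> \<le> \<tau>1" "\<tau>1 \<le> \<tau>2" using 1 2 by (auto simp: continues_def)
  moreover have "par2 v = par1 v" if "cmp v < \<tau>1" for v using 2 that by (simp add: continues_def)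
  moreover have "cmp (par2 v) < \<tau> \<longleftrightarrow> cmp v < \<tau>" for v
  proof (cases "cmp v < \<tau>1")
    case True
    then show ?thesis using 1 calculation(3) by (simp add: continues_def)
  next
    case False
    moreover have "\<not> cmp (par2 v) < \<tau>1" using 2 False by (simp add: continues_def)
    ultimately show ?thesis using \<open>\<tau> \<le> \<tau>1\<close> by linarith
  qed
  ultimately show ?thesis using 1 2 unfolding continues_def by fastforce
qed

text \<open>Balls never leave the components in which they start, and old components are not
  changed.\<close>

lemma continues_lb:
  assumes st: "state C par ps \<tau>" and ext: "continues par \<tau> par' qs \<tau>'" and u: "u \<in> set ps"
  shows "lb par' (ps @ qs) u = lb par ps u"
proof -
  let ?K = "{v. cmp v < \<tau>}"
  have K: "par v \<in> ?K \<longleftrightarrow> v \<in> ?K" "par' v \<in> ?K \<longleftrightarrow> v \<in> ?K" "v \<in> ?K \<Longrightarrow> par' v = par v" for v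
    using st ext by (auto simp: state_def continues_def)
  have psK: "u \<in> ?K" if "u \<in> set ps" for u using st that by (simp add: state_def)
  have "lb par' ps u = lb par ps u"
  proof (rule lb_cong[OF u])
    fix u assume u: "u \<in> set ps"
    show "ball par' T u = ball par T u" by (rule ball_cong_closed[of par ?K par', OF K psK[OF u]])
    fix v assume "v \<in> ball par T u"
    then show "par' v = par v" using ball_closed[of par ?K v T u, OF K(1)] psK[OF u] K(3) by blast
  qed
  then show ?thesis using lb_append u by simp
qed

lemma continues_fragment:
  assumes st: "state C par ps \<tau>" and ext: "continues par \<tau> par' qs \<tau>'"
    and K: "K \<subseteq> {v. cmp v < \<tau>}" and frag: "fragment par ps K i w B"
  shows "fragment par' (ps @ qs) K i w B"
proof -
  have closed: "par v \<in> K \<longleftrightarrow> v \<in> K" for v using frag by (simp add: fragment_def)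
  have eq: "par' v = par v" if "v \<in> K" for v using that K ext by (auto simp: continues_def)
  have closed': "par' v \<in> K \<longleftrightarrow> v \<in> K" for v
  proof (cases "cmp v < \<tau>")
    case True
    then have "par' v = par v" using ext by (simp add: continues_def)
    then show ?thesis using closed by simp
  next
    case False
    then have "\<not> cmp (par' v) < \<tau>" using ext by (simp add: continues_def)
    then show ?thesis using False K by blast
  qed
  have "q \<notin> K" if "q \<in> set qs" for q using that K ext by (force simp: continues_def)
  then have "set (ps @ qs) \<inter> K = set ps \<inter> K" by auto
  moreover have "nice (Suc i) par' K" using frag eq by (simp add: fragment_def nice_def)
  moreover have "ball par' B w = ball par B w"
    using frag by (intro ball_cong_closed[of par K par', OF closed closed' eq]) (auto simp: fragment_def)
  moreover have "lb par' (ps @ qs) w = lb par ps w"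
    using continues_lb[OF st ext] frag by (simp add: fragment_def)
  ultimately show ?thesis using frag closed' unfolding fragment_def by (simp del: pruned.simps)
qed

text \<open>A single node of a fresh component suffices: as no label survives \<open>k\<close>
  rounds, its label is lost in one of them.\<close>

lemma enforces_top: "enforces k 1 0 0"
  unfolding enforces_def
proof (intro allI impI)
  fix C par ps \<tau>
  assume st: "state C par ps \<tau>" and L: "length ps + 1 \<le> Lmax" and C: "C * 2 ^ 0 \<le> Cmax"
  obtain w where w: "cmp w = \<tau>" "rk w \<ge> k" using fresh by blast
  define K where "K = {v. cmp v = \<tau>}"
  have par0: "par v = par0 v" if "cmp v \<ge> \<tau>" for v using st that by (simp add: state_def)
  have clos: "cmp (par v) < \<tau> \<longleftrightarrow> cmp v < \<tau>" for v using st by (simp add: state_def)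
  have cmp: "cmp (par v) = cmp v" if "cmp v \<ge> \<tau>" for v using par0[OF that] par0_cmp by simp
  have K: "par v \<in> K \<longleftrightarrow> v \<in> K" for v
    using cmp[of v] clos[of v] by (cases "cmp v < \<tau>") (auto simp: K_def)
  have ext: "continues par \<tau> par [w] (Suc \<tau>)" using w clos by (simp add: continues_def)
  have st': "state C par (ps @ [w]) (Suc \<tau>)"
    unfolding state_def
  proof (intro conjI allI impI)
    fix v
    show "cmp (par v) < Suc \<tau> \<longleftrightarrow> cmp v < Suc \<tau>"
      using clos[of v] cmp[of v] by (cases "cmp v < \<tau>") auto
  qed (use st w in \<open>auto simp: state_def\<close>)
  have "lb par (ps @ [w]) w \<in> labels P"
    using lb_feasible[of C par "ps @ [w]"] st' L C by (simp add: state_def)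
  then obtain i where i: "i < k" "lb par (ps @ [w]) w \<in> pruned P i - pruned P (Suc i)"
    using lost_level[of _ k] empty by blast
  have "set (ps @ [w]) \<inter> K = {w}" using st w by (auto simp: state_def K_def)
  then have "\<forall>s\<in>set (ps @ [w]) \<inter> K. s \<in> ball par 0 w" 
    by (simp only: ball_simps self_in_ball simp_thms)
  moreover have "nice (Suc i) par K"
    unfolding nice_def
  proof (intro ballI)
    fix v assume "v \<in> K"
    then have "par v = par0 v" using par0 by (simp add: K_def)
    then show "min (Suc i) (rk v) \<le> min (Suc i) (rk (par v)) \<and>
        min (Suc i) (rk (par v)) \<le> Suc (min (Suc i) (rk v)) \<and>
        (main v \<longrightarrow> min (Suc i) (rk (par v)) = min (Suc i) (rk v))"
      using par0_rk[of v] by auto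
  qed
  ultimately have "fragment par (ps @ [w]) K i w 0"
    using K i w unfolding fragment_def by (simp del: pruned.simps add: K_def)
  then show "reachable k 1 0 0 C par ps \<tau>"
    unfolding reachable_def using ext st' i(1)
    by (intro exI[of _ par] exI[of _ "[w]"] exI[of _ "Suc \<tau>"] exI[of _ K] exI[of _ i] exI[of _ w])
      (auto simp: K_def)
qed

definition collected :: "nat \<Rightarrow> nat \<Rightarrow> nat \<Rightarrow> nat \<Rightarrow> nat \<Rightarrow> nat \<Rightarrow> (nat \<Rightarrow> nat) \<Rightarrow> nat list \<Rightarrow> nat \<Rightarrow>
    (nat \<Rightarrow> nat) \<Rightarrow> nat list \<Rightarrow> nat \<Rightarrow> (nat \<Rightarrow> nat set) \<Rightarrow> (nat \<Rightarrow> nat) \<Rightarrow> bool" where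
  "collected e j L J B C par ps \<tau> par' qs \<tau>' Kf wh \<longleftrightarrow> continues par \<tau> par' qs \<tau>' \<and> state (C * 2 ^ (e * J)) par' (ps @ qs) \<tau>' \<and>
      length qs \<le> e * L \<and> (\<forall>i<e. Kf i \<subseteq> {v. \<tau> \<le> cmp v \<and> cmp v < \<tau>'} \<and> fragment par' (ps @ qs) (Kf i) j (wh i) B) \<and>
      (\<forall>i<e. \<forall>i'<e. i \<noteq> i' \<longrightarrow> Kf i \<inter> Kf i' = {})"

text \<open>Each replay yields a label lost before round \<open>j\<close>, which already is the
  goal, or one more fragment of level exactly \<open>j\<close>. Replays use different components, so
  the fragments are disjoint.\<close>

lemma collect_fragments:
  assumes enf: "enforces (Suc j) L J B" and st: "state C par ps \<tau>"
    and "length ps + e * L \<le> Lmax" "C * 2 ^ (e * J) \<le> Cmax"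
  shows "reachable j (e * L) (e * J) B C par ps \<tau> \<or>
    (\<exists>par' qs \<tau>' Kf wh. collected e j L J B C par ps \<tau> par' qs \<tau>' Kf wh)"
  using assms(3,4)
proof (induction e)
  case 0
  have "continues par \<tau> par [] \<tau>" using st by (simp add: continues_def state_def)
  then have "collected 0 j L J B C par ps \<tau> par [] \<tau> (\<lambda>_. {}) (\<lambda>_. 0)"
    using st by (simp add: collected_def)
  then show ?case by blast
next
  case (Suc e)
  have pow: "C * 2 ^ (e * J) * 2 ^ J = C * 2 ^ (Suc e * J)" by (simp add: power_add)
  have le: "C * 2 ^ (e * J) \<le> C * 2 ^ (Suc e * J)" by (intro mult_le_mono2 power_increasing) auto
  have "reachable j (e * L) (e * J) B C par ps \<tau> \<or>
    (\<exists>par' qs \<tau>' Kf wh. collected e j L J B C par ps \<tau> par' qs \<tau>' Kf wh)"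
    by (rule Suc.IH) (use Suc.prems(1) le_trans[OF le Suc.prems(2)] in auto)
  then show ?case
  proof
    assume "reachable j (e * L) (e * J) B C par ps \<tau>"
    then obtain par' qs \<tau>' K i w where "continues par \<tau> par' qs \<tau>'" "state (C * 2 ^ (e * J)) par' (ps @ qs) \<tau>'"
      "length qs \<le> e * L" "i < j" "K \<subseteq> {v. \<tau> \<le> cmp v \<and> cmp v < \<tau>'}" "fragment par' (ps @ qs) K i w B"
      unfolding reachable_def by blast
    then have "reachable j (Suc e * L) (Suc e * J) B C par ps \<tau>"
      unfolding reachable_def using state_mono[OF _ le]
      by (intro exI[of _ par'] exI[of _ qs] exI[of _ \<tau>'] exI[of _ K] exI[of _ i] exI[of _ w]) auto
    then show ?thesis ..
  next
    assume "\<exists>par' qs \<tau>' Kf wh. collected e j L J B C par ps \<tau> par' qs \<tau>' Kf wh"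
    then obtain par1 q1 \<tau>1 Kf wh where "collected e j L J B C par ps \<tau> par1 q1 \<tau>1 Kf wh" by blast
    then have c1: "continues par \<tau> par1 q1 \<tau>1"
      and st1: "state (C * 2 ^ (e * J)) par1 (ps @ q1) \<tau>1" and len1: "length q1 \<le> e * L"
      and fr1: "\<And>i. i < e \<Longrightarrow> Kf i \<subseteq> {v. \<tau> \<le> cmp v \<and> cmp v < \<tau>1} \<and> fragment par1 (ps @ q1) (Kf i) j (wh i) B"
      and dis1: "\<And>i i'. i < e \<Longrightarrow> i' < e \<Longrightarrow> i \<noteq> i' \<Longrightarrow> Kf i \<inter> Kf i' = {}"
      unfolding collected_def by blast+
    have "length (ps @ q1) + L \<le> Lmax" using len1 Suc.prems(1) by simp
    moreover have "C * 2 ^ (e * J) * 2 ^ J \<le> Cmax" unfolding pow by (rule Suc.prems(2))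
    ultimately have "reachable (Suc j) L J B (C * 2 ^ (e * J)) par1 (ps @ q1) \<tau>1"
      using enf st1 unfolding enforces_def by blast
    then obtain par2 q2 \<tau>2 K i w where c2: "continues par1 \<tau>1 par2 q2 \<tau>2"
      and st2: "state (C * 2 ^ (Suc e * J)) par2 (ps @ (q1 @ q2)) \<tau>2" and len2: "length q2 \<le> L"
      and i: "i < Suc j" and K: "K \<subseteq> {v. \<tau>1 \<le> cmp v \<and> cmp v < \<tau>2}"
      and fr2: "fragment par2 (ps @ (q1 @ q2)) K i w B"
      unfolding reachable_def pow by auto
    have c: "continues par \<tau> par2 (q1 @ q2) \<tau>2" by (rule continues_trans[OF c1 c2])
    have len: "length (q1 @ q2) \<le> Suc e * L" using len1 len2 by simp
    have \<tau>: "\<tau> \<le> \<tau>1" "\<tau>1 \<le> \<tau>2" using c1 c2 by (auto simp: continues_def)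
    then have K': "K \<subseteq> {v. \<tau> \<le> cmp v \<and> cmp v < \<tau>2}" using K by auto
    show ?thesis
    proof (cases "i < j")
      case True
      then have "reachable j (Suc e * L) (Suc e * J) B C par ps \<tau>"
        unfolding reachable_def using c st2 len K' fr2 by blast
      then show ?thesis ..
    next
      case False
      then have "i = j" using i by simp
      have old: "fragment par2 (ps @ (q1 @ q2)) (Kf i') j (wh i') B" if "i' < e" for i'
        using continues_fragment[OF st1 c2, of "Kf i'" j "wh i'" B] fr1[OF that] by fastforce
      define Kf' where "Kf' = Kf(e := K)"
      define wh' where "wh' = wh(e := w)"
      have "\<forall>i'<Suc e. Kf' i' \<subseteq> {v. \<tau> \<le> cmp v \<and> cmp v < \<tau>2} \<and> fragment par2 (ps @ (q1 @ q2)) (Kf' i') j (wh' i') B"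
      proof (intro allI impI)
        fix i' assume "i' < Suc e"
        then consider "i' < e" | "i' = e" by linarith
        then show "Kf' i' \<subseteq> {v. \<tau> \<le> cmp v \<and> cmp v < \<tau>2} \<and> fragment par2 (ps @ (q1 @ q2)) (Kf' i') j (wh' i') B"
        proof cases
          case 1
          then have "Kf i' \<subseteq> {v. \<tau> \<le> cmp v \<and> cmp v < \<tau>2}" using fr1[OF 1] \<tau>(2) by fastforce
          then show ?thesis using old[OF 1] 1 by (simp add: Kf'_def wh'_def)
        next
          case 2
          then show ?thesis using K' fr2 \<open>i = j\<close> by (simp add: Kf'_def wh'_def)
        qed
      qed
      moreover have "K \<inter> Kf i' = {}" if "i' < e" for i' using fr1[OF that] K by force
      then have "\<forall>i'<Suc e. \<forall>i''<Suc e. i' \<noteq> i'' \<longrightarrow> Kf' i' \<inter> Kf' i'' = {}"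
        using dis1 by (auto simp: Kf'_def less_Suc_eq Int_commute)
      ultimately have "collected (Suc e) j L J B C par ps \<tau> par2 (q1 @ q2) \<tau>2 Kf' wh'"
        using c st2 len unfolding collected_def by blast
      then show ?thesis by blast
    qed
  qed
qed

end

lemma min_cap:
  fixes a b :: nat
  assumes "I \<le> J"
  shows "min J a \<le> min J b \<Longrightarrow> min I a \<le> min I b"
    and "min J b \<le> Suc (min J a) \<Longrightarrow> min I b \<le> Suc (min I a)"
    and "min J a = min J b \<Longrightarrow> min I a = min I b"
  using assms by (auto simp: min_def split: if_splits)

context game
begin

text \<open>The maximal length of a joining path: two stretches of at least
  \<open>T + B + 1\<close>, up to \<open>Cmax\<close> more steps to find a main node, up to
  \<open>gap\<close> to avoid closed walks, and the new edge.\<close>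

definition span :: "nat \<Rightarrow> nat" where
  "span B = 2 * (T + B + 1) + Cmax + gap + 1"

text \<open>The subtree of \<open>x\<close>, on a main path below \<open>w1\<close>, is exchanged
  with that of \<open>y\<close>, an ancestor of \<open>w2\<close>. Then \<open>w2\<close> lies
  exactly \<open>l\<close> steps below \<open>w1\<close>, for a length \<open>l\<close> without
  closed walk at the common label \<open>a\<close>. Both nodes keep \<open>a\<close>, since the
  exchange is unseen. If the revealed path and all children on it had labels in
  \<open>pruned P j\<close>, these would form such a closed walk.\<close>

lemma join_fragments:
  assumes st: "state C par ps \<tau>" and jk: "j < k"
    and f1: "fragment par ps K1 j w1 B" and f2: "fragment par ps K2 j w2 B"
    and disj: "K1 \<inter> K2 = {}" and K\<tau>: "K1 \<union> K2 \<subseteq> {v. cmp v < \<tau>}"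
    and lab: "lb par ps w1 = lb par ps w2"
    and L: "length ps + (1 + \<delta>) * span B \<le> Lmax" and C: "2 * C \<le> Cmax"
  shows "\<exists>par' qs K i w. (\<forall>v. v \<notin> K1 \<union> K2 \<longrightarrow> par' v = par v) \<and>
    (\<forall>v. par' v \<in> K1 \<union> K2 \<longleftrightarrow> v \<in> K1 \<union> K2) \<and> state (2 * C) par' (ps @ qs) \<tau> \<and>
    set qs \<subseteq> K1 \<union> K2 \<and> length qs \<le> (1 + \<delta>) * span B \<and> i < j \<and> K \<subseteq> K1 \<union> K2 \<and>
    fragment par' (ps @ qs) K i w (B + 2 * span B + 2)"
proof -
  have F: "forest C par" and dps: "distinct ps" using st by (auto simp: state_def)
  define a where "a = lb par ps w1"
  have K1: "par v \<in> K1 \<longleftrightarrow> v \<in> K1" and K2: "par v \<in> K2 \<longleftrightarrow> v \<in> K2" for v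
    using f1 f2 by (auto simp: fragment_def)
  have w: "w1 \<in> K1" "w2 \<in> K2" "w1 \<in> set ps" "w2 \<in> set ps" "rk w1 \<ge> Suc j" "rk w2 \<ge> Suc j"
    and a: "a \<in> pruned P j - pruned P (Suc j)"
    and near: "\<And>s. s \<in> set ps \<Longrightarrow> s \<in> K1 \<Longrightarrow> s \<in> ball par B w1" "\<And>s. s \<in> set ps \<Longrightarrow> s \<in> K2 \<Longrightarrow> s \<in> ball par B w2"
    and nice: "nice (Suc j) par K1" "nice (Suc j) par K2"
    using f1 f2 unfolding fragment_def a_def by (auto simp del: pruned.simps)
  \<comment> \<open>Revealed nodes are within \<open>B\<close> of \<open>w1\<close> or
    \<open>w2\<close> and see \<open>T\<close> further.\<close>
  define d where "d = T + B + 1"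
  \<comment> \<open>\<open>forest_swap\<close> requires main nodes; \<open>C\<close> bounds the
    search for one above \<open>w2\<close>.\<close>
  obtain q where q: "d \<le> q" "q \<le> d + C" "main ((par ^^ q) w2)" using main_above[OF F] by blast
  \<comment> \<open>The lower bound on \<open>l\<close> leaves at least \<open>d\<close> steps for
    the stretch below \<open>w1\<close>.\<close>
  obtain l where l: "q + 1 + d \<le> l" "l \<le> q + 1 + d + gap" "(a, a) \<notin> steps P (pruned P j) ^^ l"
    using gap[OF jk a] by blast
  define p where "p = l - q - 1"
  have p: "d \<le> p" "l = q + 1 + p" using l(1) by (auto simp: p_def)
  have l_span: "l \<le> span B" using l(2) q(2) C by (simp add: span_def d_def)
  obtain \<beta> where \<beta>: "\<beta> 0 = w1" "\<And>i. par (\<beta> (Suc i)) = \<beta> i" "\<And>i. main (\<beta> (Suc i))"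
    using main_path[OF F, of w1] w by (metis less_le_trans zero_less_Suc)
  have \<beta>pow: "(par ^^ i) (\<beta> (i + e)) = \<beta> e" for i e
    by (induction i) (simp_all add: funpow_swap1 \<beta>)
  have \<beta>0: "(par ^^ i) (\<beta> i) = w1" for i using \<beta>pow[of i 0] \<beta> by simp
  have \<beta>K: "\<beta> i \<in> K1" for i
  proof (induction i)
    case (Suc i)
    then show ?case using K1[of "\<beta> (Suc i)"] \<beta>(2) by simp
  qed (use w \<beta> in simp)
  have upK: "(par ^^ i) w2 \<in> K2" for i using funpow_closed[of par K2, OF K2] w by blast
  have \<beta>inj: "i = i'" if "\<beta> i = \<beta> i'" for i i'
  proof -
    have "(par ^^ (i' + i)) (\<beta> i) = (par ^^ (i + i')) (\<beta> i')"
      using that by (simp add: add.commute)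
    then have "(par ^^ i') w1 = (par ^^ i) w1" by (simp only: funpow_add comp_apply \<beta>0)
    then show ?thesis using par_pow_inj[OF F, of i' w1 i] by simp
  qed
  define x where "x = \<beta> (Suc p)"
  define y where "y = (par ^^ q) w2"
  have px: "par x = \<beta> p" by (simp add: x_def \<beta>)
  have py: "par y = (par ^^ Suc q) w2" by (simp add: y_def)
  have xK: "x \<in> K1" "par x \<in> K1" and yK: "y \<in> K2" "par y \<in> K2"
    using \<beta>K upK K2 px by (auto simp: x_def y_def)
  have notK: "v \<in> K1 \<Longrightarrow> v \<notin> K2" for v using disj by blast
  have un: "(par ^^ i) x \<noteq> y" "(par ^^ i) y \<noteq> x" for i
    using funpow_closed[of par K1 i, OF K1] funpow_closed[of par K2 i, OF K2] xK yK notK by blast+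
  define par' where "par' = swap par x y"
  have mains: "main x" "main y" using \<beta> q by (auto simp: x_def y_def)
  have F': "forest (2 * C) par'" unfolding par'_def by (rule forest_swap[OF F mains un])
  have xy: "x \<noteq> y" using xK yK notK by blast
  have p'x: "par' x = par y" and p'y: "par' y = par x" using xy by (simp_all add: par'_def swap_def)
  have other: "par' v = par v" if "v \<noteq> x" "v \<noteq> y" for v using that by (simp add: par'_def swap_def)

  \<comment> \<open>The exchanged edges are unseen\<close>
  have far1: "i \<le> t" if bl: "\<beta> i \<in> ball par t w1" for i t
  proof (rule ccontr)
    assume "\<not> i \<le> t"
    obtain b c where bc: "b + c \<le> t" "(par ^^ b) (\<beta> i) = (par ^^ c) w1" using bl by (auto simp: ball_def)
    then have "(par ^^ b) (\<beta> (b + (i - b))) = (par ^^ c) w1" using \<open>\<not> i \<le> t\<close> by simp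
    then have "\<beta> (i - b) = (par ^^ c) w1" using \<beta>pow by metis
    then have "(par ^^ (i - b)) ((par ^^ c) w1) = w1" using \<beta>0 by metis
    then have "(par ^^ (i - b + c)) w1 = w1" by (simp only: funpow_add comp_apply)
    then show False using par_acyclic[OF F] bc \<open>\<not> i \<le> t\<close> by fastforce
  qed
  have far2: "i \<le> t" if bl: "(par ^^ i) w2 \<in> ball par t w2" for i t
  proof -
    obtain b c where bc: "b + c \<le> t" "(par ^^ b) ((par ^^ i) w2) = (par ^^ c) w2" using bl by (auto simp: ball_def)
    then have "(par ^^ (b + i)) w2 = (par ^^ c) w2" by (simp only: funpow_add comp_apply)
    then show ?thesis using par_pow_inj[OF F] bc by fastforce
  qed
  have sep1: "v \<in> ball par t u \<Longrightarrow> v \<in> K1 \<longleftrightarrow> u \<in> K1" and sep2: "v \<in> ball par t u \<Longrightarrow> v \<in> K2 \<longleftrightarrow> u \<in> K2" for v t u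
    using ball_closed[of par K1, OF K1] ball_closed[of par K2, OF K2] by blast+
  have far_w1: "v \<notin> ball par t w1" if "v \<in> {x, par x, y, par y}" "t < d" for v t
    using that far1[of p t] far1[of "Suc p" t] p sep1[of _ t w1] xK yK w notK unfolding px by (auto simp: x_def)
  have far_w2: "v \<notin> ball par t w2" if "v \<in> {x, par x, y, par y}" "t < d" for v t
    using that far2[of q t] far2[of "Suc q" t] q sep2[of _ t w2] xK yK w notK unfolding py by (auto simp: y_def)
  have unseen: "v \<notin> ball par T u" if v: "v \<in> {x, par x, y, par y}" and u: "u \<in> set ps" for v u
  proof
    assume vu: "v \<in> ball par T u"
    consider "v \<in> K1" | "v \<in> K2" using v xK yK by blast
    then show False
    proof cases
      case 1
      then have "u \<in> ball par B w1" using sep1[OF vu] near u by blast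
      from ball_trans[OF this vu] far_w1[OF v, of "B + T"] show False by (simp add: d_def)
    next
      case 2
      then have "u \<in> ball par B w2" using sep2[OF vu] near u by blast
      from ball_trans[OF this vu] far_w2[OF v, of "B + T"] show False by (simp add: d_def)
    qed
  qed
  have ball_ps: "ball par' T u = ball par T u" if "u \<in> set ps" for u
    unfolding par'_def using unseen that by (intro ball_swap) auto
  have ball_w1: "ball par' B w1 = ball par B w1"
    unfolding par'_def using far_w1[of _ B] by (intro ball_swap) (auto simp: d_def)
  have ball_w2: "ball par' B w2 = ball par B w2"
    unfolding par'_def using far_w2[of _ B] by (intro ball_swap) (auto simp: d_def)
  have lb_old: "lb par' (ps @ qs) u = lb par ps u" if u: "u \<in> set ps" for u qs
  proof -
    have "lb par' ps u = lb par ps u"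
      using u ball_ps unseen by (intro lb_cong other) auto
    then show ?thesis using lb_append u by simp
  qed

  \<comment> \<open>The joining path, upwards from \<open>w2\<close> to \<open>w1\<close>\<close>
  define pn where "pn = (\<lambda>t. (par' ^^ t) w2)"
  have pn_up: "pn t = (par ^^ t) w2" if "t \<le> q" for t
    unfolding pn_def
  proof (rule funpow_cong_orbit)
    fix i assume "i < t"
    then have "(par ^^ i) w2 \<noteq> y" using that par_pow_inj[OF F] by (fastforce simp: y_def)
    moreover have "(par ^^ i) w2 \<noteq> x" using upK xK notK by metis
    ultimately show "par' ((par ^^ i) w2) = par ((par ^^ i) w2)" by (intro other)
  qed
  have pn_down: "pn (q + 1 + i) = \<beta> (p - i)" if "i \<le> p" for i
    using that
  proof (induction i)
    case 0
    have "pn (Suc q) = par' (pn q)" by (simp add: pn_def)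
    also have "\<dots> = \<beta> p" using pn_up[of q] p'y px by (simp add: y_def)
    finally show ?case by simp
  next
    case (Suc i)
    have "pn (q + 1 + Suc i) = par' (pn (q + 1 + i))" by (simp add: pn_def)
    also have "\<dots> = par' (\<beta> (p - i))" using Suc by simp
    also have "p - i = Suc (p - Suc i)" using Suc.prems by simp
    also have "par' (\<beta> (Suc (p - Suc i))) = par (\<beta> (Suc (p - Suc i)))"
    proof (rule other)
      show "\<beta> (Suc (p - Suc i)) \<noteq> x" using \<beta>inj Suc.prems by (fastforce simp: x_def)
      show "\<beta> (Suc (p - Suc i)) \<noteq> y" using \<beta>K yK notK by metis
    qed
    finally show ?case using \<beta>(2) by simp
  qed
  have pn_l: "pn l = w1" using pn_down[of p] p \<beta> by simp
  have pn_Suc: "pn (Suc t) = par' (pn t)" for t by (simp add: pn_def)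
  have rk_up: "rk ((par ^^ t) w2) \<ge> Suc j" for t
  proof (induction t)
    case (Suc t)
    have "min (Suc j) (rk ((par ^^ t) w2)) \<le> min (Suc j) (rk (par ((par ^^ t) w2)))"
      using nice(2) upK unfolding nice_def by blast
    then show ?case using Suc by simp
  qed (use w in simp)
  have rk_down: "rk (\<beta> t) \<ge> Suc j" for t
  proof (induction t)
    case (Suc t)
    have "min (Suc j) (rk (par (\<beta> (Suc t)))) = min (Suc j) (rk (\<beta> (Suc t)))"
      using nice(1) \<beta>K \<beta>(3) unfolding nice_def by blast
    then show ?case using Suc \<beta>(2) by simp
  qed (use w \<beta> in simp)
  have rk_pn: "rk (pn t) \<ge> Suc j" if "t \<le> l" for t
  proof (cases "t \<le> q")
    case True
    then show ?thesis using pn_up rk_up by simp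
  next
    case False
    then have "t = q + 1 + (t - q - 1)" "t - q - 1 \<le> p" using that p by auto
    then show ?thesis using pn_down rk_down by metis
  qed

  \<comment> \<open>The component that contains both \<open>w1\<close> and \<open>w2\<close> after
    the exchange\<close>
  define K' where "K' = {v. \<exists>b c. (par' ^^ b) v = (par' ^^ c) w1}"
  have K'closed: "par' v \<in> K' \<longleftrightarrow> v \<in> K'" for v
  proof
    assume "par' v \<in> K'"
    then obtain b c where "(par' ^^ b) (par' v) = (par' ^^ c) w1" by (auto simp: K'_def)
    then have "(par' ^^ Suc b) v = (par' ^^ c) w1" by (simp add: funpow_swap1)
    then show "v \<in> K'" unfolding K'_def by blast
  next
    assume "v \<in> K'"
    then obtain b c where "(par' ^^ b) v = (par' ^^ c) w1" by (auto simp: K'_def)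
    then have "(par' ^^ b) (par' v) = (par' ^^ Suc c) w1" by (simp flip: funpow_swap1)
    then show "par' v \<in> K'" unfolding K'_def by blast
  qed
  have KK: "par' v \<in> K1 \<union> K2 \<longleftrightarrow> v \<in> K1 \<union> K2" for v
  proof (cases "v \<in> {x, y}")
    case True
    then show ?thesis using p'x p'y xK yK by auto
  next
    case False
    then show ?thesis using other[of v] K1 K2 by simp
  qed
  have K'sub: "K' \<subseteq> K1 \<union> K2"
  proof
    fix v assume "v \<in> K'"
    then obtain b c where bc: "(par' ^^ b) v = (par' ^^ c) w1" by (auto simp: K'_def)
    have "(par' ^^ c) w1 \<in> K1 \<union> K2" using funpow_closed[of par' "K1 \<union> K2", OF KK] w by blast
    then show "v \<in> K1 \<union> K2" using funpow_closed[of par' "K1 \<union> K2", OF KK] bc by metis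
  qed
  have w1K': "w1 \<in> K'" unfolding K'_def by blast
  have w1up: "(par' ^^ c) w1 = (par ^^ c) w1" for c
  proof (rule funpow_cong_orbit)
    fix i
    have inK: "(par ^^ i) w1 \<in> K1" using funpow_closed[of par K1, OF K1] w by blast
    have "(par ^^ i) w1 \<noteq> x"
    proof
      assume "(par ^^ i) w1 = x"
      then have "(par ^^ Suc p) ((par ^^ i) w1) = w1" using \<beta>0[of "Suc p"] by (simp only: x_def)
      then have "(par ^^ (Suc p + i)) w1 = w1" by (simp only: funpow_add comp_apply)
      then show False using par_acyclic[OF F] by fastforce
    qed
    moreover have "(par ^^ i) w1 \<noteq> y" using inK yK notK by metis
    ultimately show "par' ((par ^^ i) w1) = par ((par ^^ i) w1)" by (rule other)
  qed
  \<comment> \<open>\<open>x\<close> now hangs below the part of the second component above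
    \<open>y\<close>, which is cut off from \<open>w1\<close>.\<close>
  have xK': "x \<notin> K'"
  proof
    assume "x \<in> K'"
    then obtain b c where bc: "(par' ^^ b) x = (par ^^ c) w1" unfolding K'_def w1up by blast
    have inK: "(par ^^ c) w1 \<in> K1" using funpow_closed[of par K1, OF K1] w by blast
    show False
    proof (cases b)
      case 0
      then have "(par ^^ Suc p) ((par ^^ c) w1) = w1" using bc \<beta>0[of "Suc p"] by (simp only: x_def funpow_0)
      then have "(par ^^ (Suc p + c)) w1 = w1" by (simp only: funpow_add comp_apply)
      then show False using par_acyclic[OF F] by fastforce
    next
      case (Suc b')
      have "(par' ^^ b') (par y) = (par ^^ b') (par y)"
      proof (rule funpow_cong_orbit)
        fix i
        have eq: "(par ^^ i) (par y) = (par ^^ Suc i) y" by (simp add: funpow_swap1)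
        have "(par ^^ Suc i) y \<noteq> y" using par_acyclic[OF F] by blast
        then show "par' ((par ^^ i) (par y)) = par ((par ^^ i) (par y))" unfolding eq
          using un(2)[of "Suc i"] by (intro other)
      qed
      then have "(par ^^ b') (par y) = (par ^^ c) w1" using bc Suc p'x by (simp add: funpow_swap1)
      moreover have "(par ^^ b') (par y) \<in> K2" using funpow_closed[of par K2, OF K2] yK by blast
      ultimately show False using inK notK by metis
    qed
  qed
  \<comment> \<open>The only changed edge inside \<open>K'\<close> leads from \<open>y\<close> to
    \<open>\<beta> p\<close>. Both ends have rank above \<open>j\<close>, so their ranks coincide
    once capped at \<open>Suc i \<le> j\<close>; this is the reason for the cap.\<close>
  have nice': "nice (Suc i) par' K'" if "Suc i \<le> j" for i
    unfolding nice_def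
  proof (intro ballI)
    fix v assume v: "v \<in> K'"
    show "min (Suc i) (rk v) \<le> min (Suc i) (rk (par' v)) \<and>
        min (Suc i) (rk (par' v)) \<le> Suc (min (Suc i) (rk v)) \<and>
        (main v \<longrightarrow> min (Suc i) (rk (par' v)) = min (Suc i) (rk v))"
    proof (cases "v = y")
      case True
      have "rk y \<ge> Suc j" "rk (par' y) \<ge> Suc j" using rk_up rk_down p'y px by (auto simp: y_def)
      then show ?thesis using True that by (simp add: min_def)
    next
      case False
      have "v \<noteq> x" using v xK' by blast
      then have eq: "par' v = par v" using other False by blast
      have "min (Suc j) (rk v) \<le> min (Suc j) (rk (par v)) \<and>
          min (Suc j) (rk (par v)) \<le> Suc (min (Suc j) (rk v)) \<and>
          (main v \<longrightarrow> min (Suc j) (rk (par v)) = min (Suc j) (rk v))"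
        using v K'sub nice unfolding nice_def by blast
      moreover have "Suc i \<le> Suc j" using that by simp
      ultimately show ?thesis unfolding eq using min_cap[OF \<open>Suc i \<le> Suc j\<close>] by blast
    qed
  qed
  \<comment> \<open>\<open>pn 0 = w2\<close> is already revealed. The nodes above it up to
    \<open>w1\<close> come with all children, as \<open>lb_feasible\<close> demands.\<close>
  define Z where "Z = (\<Union>t\<in>{1..l}. insert (pn t) {c. par' c = pn t})"
  have ch: "finite {c. par' c = v}" "card {c. par' c = v} \<le> \<delta>" for v
  proof -
    show "finite {c. par' c = v}" by (rule finite_children[OF F'])
    show "card {c. par' c = v} \<le> \<delta>"
    proof (cases "rk v > 0")
      case False
      then have "par' c \<noteq> v" for c using rk_par[OF F', of c] by auto
      then show ?thesis by simp
    qed (use card_children[OF F'] in simp)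
  qed
  have finZ: "finite Z" using ch by (simp add: Z_def)
  have "card Z \<le> (\<Sum>t\<in>{1..l}. card (insert (pn t) {c. par' c = pn t}))"
    unfolding Z_def by (rule card_UN_le) simp
  also have "\<dots> \<le> (\<Sum>t\<in>{1..l}. 1 + \<delta>)"
    using ch by (intro sum_mono) (simp add: card_insert_if le_SucI)
  also have "\<dots> = l * (1 + \<delta>)" by simp
  also have "\<dots> \<le> (1 + \<delta>) * span B" by (subst mult.commute) (rule mult_le_mono2[OF l_span])
  finally have cardZ: "card Z \<le> (1 + \<delta>) * span B" .
  have pnK': "pn t \<in> K'" if "t \<le> l" for t
  proof -
    have "(par' ^^ (l - t)) (pn t) = w1"
      using that pn_l by (simp add: pn_def flip: funpow_add comp_apply[of "par' ^^ (l - t)"])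
    then have "(par' ^^ (l - t)) (pn t) \<in> K'" using w1K' by simp
    then show ?thesis using funpow_closed[of par' K', OF K'closed] by blast
  qed
  have ZK': "Z \<subseteq> K'"
    using pnK' K'closed by (fastforce simp: Z_def)
  define qs where "qs = sorted_list_of_set (Z - set ps)"
  have qs: "set qs = Z - set ps" "distinct qs" using finZ by (auto simp: qs_def)
  have lenqs: "length qs \<le> (1 + \<delta>) * span B"
    using cardZ card_mono[OF finZ, of "Z - set ps"] by (simp add: qs_def)
  have st': "state (2 * C) par' (ps @ qs) \<tau>"
    unfolding state_def
  proof (intro conjI allI impI F')
    show "distinct (ps @ qs)" using dps qs by auto
    show "\<forall>u\<in>set (ps @ qs). cmp u < \<tau>"
      using st qs ZK' K'sub K\<tau> by (auto simp: state_def)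
    fix v
    show "cmp (par' v) < \<tau> \<longleftrightarrow> cmp v < \<tau>"
    proof (cases "v \<in> K1 \<union> K2")
      case True
      then show ?thesis using KK K\<tau> by blast
    next
      case False
      then have "par' v = par v" using xK yK by (intro other) auto
      then show ?thesis using st by (simp add: state_def)
    qed
    assume "\<tau> \<le> cmp v"
    then have "v \<notin> K1 \<union> K2" using K\<tau> by auto
    then have "par' v = par v" using xK yK by (intro other) auto
    then show "par' v = par0 v" using st \<open>\<tau> \<le> cmp v\<close> by (simp add: state_def)
  qed

  \<comment> \<open>A label lost in an earlier round\<close>
  have lenps: "length (ps @ qs) \<le> Lmax" using L lenqs by simp
  define lab' where "lab' = lb par' (ps @ qs)"
  have dist': "distinct (ps @ qs)" using st' by (simp add: state_def)
  note feas = lb_feasible[OF F' C dist' lenps, folded lab'_def]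
  have Zps: "Z \<subseteq> set (ps @ qs)" using qs by auto
  have "\<exists>w\<in>Z. lab' w \<notin> pruned P j"
  proof (rule ccontr)
    assume "\<not> ?thesis"
    then have good: "lab' w \<in> pruned P j" if "w \<in> Z" for w using that by blast
    have step: "(lab' (pn (Suc t)), lab' (pn t)) \<in> steps P (pruned P j)" if "t < l" for t
    proof -
      have t: "Suc t \<in> {1..l}" using that by simp
      then have Zt: "pn (Suc t) \<in> Z" "{c. par' c = pn (Suc t)} \<subseteq> Z"
        unfolding Z_def by blast+
      have "rk (pn (Suc t)) > 0" using rk_pn[of "Suc t"] that by simp
      then obtain us where us: "set us = {c. par' c = pn (Suc t)}"
        "(lab' (pn (Suc t)), map lab' us) \<in> configs P" using feas Zt Zps by (meson subset_trans subsetD)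
      have "pn t \<in> set us" using us(1) pn_Suc by simp
      moreover have "set (map lab' us) \<subseteq> pruned P j" using us(1) Zt(2) good by auto
      moreover have "lab' (pn t) \<in> set (map lab' us)" using calculation(1) by simp
      ultimately show ?thesis using good[OF Zt(1)] us(2) unfolding steps_def by blast
    qed
    have "(lab' (pn t), lab' w2) \<in> steps P (pruned P j) ^^ t" if "t \<le> l" for t
      using that
    proof (induction t)
      case 0
      then show ?case by (simp add: pn_def)
    next
      case (Suc t)
      then show ?case using step[of t] by (intro relpow_Suc_I2) auto
    qed
    from this[of l] have "(lab' w1, lab' w2) \<in> steps P (pruned P j) ^^ l" using pn_l by simp
    moreover have "lab' w1 = a" "lab' w2 = a" using lb_old w lab by (auto simp: lab'_def a_def)
    ultimately show False using l(3) by simp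
  qed
  then obtain v where v: "v \<in> Z" "lab' v \<notin> pruned P j" by blast
  have "lab' v \<in> labels P" using feas v Zps by blast
  then obtain i where i: "i < j" "lab' v \<in> pruned P i - pruned P (Suc i)" using lost_level v(2) by blast
  \<comment> \<open>The capped rank drops by at most one from a path node to its child, so it stays
    at least \<open>j \<ge> Suc i\<close>. For \<open>y\<close>, whose parent has changed, the rank
    is known directly.\<close>
  have rk_v: "rk v \<ge> Suc i"
  proof -
    obtain t where t: "t \<in> {1..l}" "v = pn t \<or> par' v = pn t" using v(1) by (auto simp: Z_def)
    show ?thesis
    proof (cases "v = pn t \<or> v = y")
      case True
      then have "rk v \<ge> Suc j" using rk_pn[of t] t rk_up by (auto simp: y_def)
      then show ?thesis using i by simp
    next
      case False
      have "v \<in> K'" using v ZK' by blast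
      then have "v \<noteq> x" using xK' by blast
      then have "par v = pn t" using other False t by auto
      moreover have "min (Suc j) (rk (par v)) \<le> Suc (min (Suc j) (rk v))"
        using \<open>v \<in> K'\<close> K'sub nice unfolding nice_def by blast
      moreover have "rk (pn t) \<ge> Suc j" using rk_pn t by simp
      ultimately show ?thesis using i by simp
    qed
  qed
  have Zball: "z \<in> ball par' (l + 1) w2" if z: "z \<in> Z" for z
  proof -
    obtain t where t: "t \<in> {1..l}" "z = pn t \<or> par' z = pn t" using z by (auto simp: Z_def)
    have pt: "pn t \<in> ball par' l w2" using t unfolding pn_def by (intro ball_ancestor) auto
    show ?thesis
    proof (cases "z = pn t")
      case True
      then show ?thesis using pt ball_mono[of l "l + 1" par' w2] by auto
    next
      case False
      then have "z \<in> ball par' 1 (pn t)" using t ball_descendant[of 1 par' z "pn t" 1] by simp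
      then show ?thesis using ball_trans[OF pt] by blast
    qed
  qed
  have psball: "s \<in> ball par' (l + B) w2" if s: "s \<in> set ps" "s \<in> K'" for s
  proof -
    have "s \<in> K1 \<or> s \<in> K2" using s K'sub by blast
    then show ?thesis
    proof
      assume "s \<in> K1"
      then have "s \<in> ball par' B w1" using near s ball_w1 by simp
      moreover have "w1 \<in> ball par' l w2" unfolding pn_l[symmetric] pn_def by (rule ball_ancestor) simp
      ultimately show ?thesis by (rule ball_trans[rotated])
    next
      assume "s \<in> K2"
      then have "s \<in> ball par' B w2" using near s ball_w2 by simp
      then show ?thesis using ball_mono[of B "l + B" par' w2] by auto
    qed
  qed
  \<comment> \<open>The detour through \<open>w2\<close> takes at most \<open>l + 1\<close> and
    \<open>l + B + 1\<close> steps.\<close>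
  have "s \<in> ball par' (B + 2 * span B + 2) v" if s: "s \<in> set (ps @ qs)" "s \<in> K'" for s
  proof -
    have "s \<in> ball par' (l + B + 1) w2"
    proof (cases "s \<in> set ps")
      case True
      then show ?thesis using psball s ball_mono[of "l + B" "l + B + 1" par' w2] by auto
    next
      case False
      then show ?thesis using Zball[of s] s qs ball_mono[of "l + 1" "l + B + 1" par' w2] by auto
    qed
    moreover have "w2 \<in> ball par' (l + 1) v" using ball_sym[OF Zball[OF v(1)]] .
    ultimately have "s \<in> ball par' (l + 1 + (l + B + 1)) v" by (rule ball_trans[rotated])
    then show ?thesis using ball_mono[of "l + 1 + (l + B + 1)" "B + 2 * span B + 2" par' v] l_span by auto
  qed
  then have "fragment par' (ps @ qs) K' i v (B + 2 * span B + 2)"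
    using K'closed nice'[of i] v ZK' Zps rk_v i unfolding fragment_def lab'_def
    by (auto simp del: pruned.simps set_append)
  moreover have "\<forall>v. v \<notin> K1 \<union> K2 \<longrightarrow> par' v = par v"
  proof (intro allI impI)
    fix v assume "v \<notin> K1 \<union> K2"
    then show "par' v = par v" using xK yK by (intro other) auto
  qed
  moreover have "set qs \<subseteq> K1 \<union> K2" using qs ZK' K'sub by blast
  ultimately show ?thesis using KK st' lenqs i(1) K'sub by blast
qed

text \<open>Among one more fragment than there are labels, two carry the same label and can be
  joined. The single exchange adds 1 to the exponent of the bound on \<open>C\<close>.\<close>

lemma enforces_step:
  assumes jk: "j < k" and enf: "enforces (Suc j) L J B"
  shows "enforces j (Suc (card (labels P)) * L + (1 + \<delta>) * span B) (Suc (card (labels P)) * J + 1) (B + 2 * span B + 2)"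
  unfolding enforces_def
proof (intro allI impI)
  fix C par ps \<tau>
  define e where "e = Suc (card (labels P))"
  assume st: "state C par ps \<tau>"
    and "length ps + (Suc (card (labels P)) * L + (1 + \<delta>) * span B) \<le> Lmax"
    and "C * 2 ^ (Suc (card (labels P)) * J + 1) \<le> Cmax"
  then have L: "length ps + e * L + (1 + \<delta>) * span B \<le> Lmax" and C: "2 * (C * 2 ^ (e * J)) \<le> Cmax"
    by (simp_all only: e_def add.assoc power_add power_one_right mult.assoc mult.commute mult.left_commute)
  have L': "length ps + e * L \<le> Lmax" and C': "C * 2 ^ (e * J) \<le> Cmax" using L C by auto
  have eq: "C * 2 ^ (e * J + 1) = 2 * (C * 2 ^ (e * J))" by simp
  let ?B = "B + 2 * span B + 2"
  have "reachable j (e * L + (1 + \<delta>) * span B) (e * J + 1) ?B C par ps \<tau>"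
    using collect_fragments[OF enf st L' C']
  proof
    assume "reachable j (e * L) (e * J) B C par ps \<tau>"
    then obtain par' qs \<tau>' K i w where r: "continues par \<tau> par' qs \<tau>'" "state (C * 2 ^ (e * J)) par' (ps @ qs) \<tau>'"
      "length qs \<le> e * L" "i < j" "K \<subseteq> {v. \<tau> \<le> cmp v \<and> cmp v < \<tau>'}" "fragment par' (ps @ qs) K i w B"
      unfolding reachable_def by blast
    have "fragment par' (ps @ qs) K i w ?B"
      using r(6) ball_mono[of B ?B par' w] unfolding fragment_def by auto
    moreover have "state (C * 2 ^ (e * J + 1)) par' (ps @ qs) \<tau>'" using state_mono[OF r(2)] eq by simp
    ultimately show ?thesis
      unfolding reachable_def using r
      by (intro exI[of _ par'] exI[of _ qs] exI[of _ \<tau>'] exI[of _ K] exI[of _ i] exI[of _ w]) auto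
  next
    assume "\<exists>par' qs \<tau>' Kf wh. collected e j L J B C par ps \<tau> par' qs \<tau>' Kf wh"
    then obtain par1 q1 \<tau>1 Kf wh where "collected e j L J B C par ps \<tau> par1 q1 \<tau>1 Kf wh" by blast
    then have c1: "continues par \<tau> par1 q1 \<tau>1"
      and st1: "state (C * 2 ^ (e * J)) par1 (ps @ q1) \<tau>1" and len1: "length q1 \<le> e * L"
      and fr1: "\<And>i. i < e \<Longrightarrow> Kf i \<subseteq> {v. \<tau> \<le> cmp v \<and> cmp v < \<tau>1} \<and> fragment par1 (ps @ q1) (Kf i) j (wh i) B"
      and dis1: "\<And>i i'. i < e \<Longrightarrow> i' < e \<Longrightarrow> i \<noteq> i' \<Longrightarrow> Kf i \<inter> Kf i' = {}"
      unfolding collected_def by blast+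
    define lab where "lab = (\<lambda>i. lb par1 (ps @ q1) (wh i))"
    have "lab ` {..<e} \<subseteq> labels P"
    proof
      fix l assume "l \<in> lab ` {..<e}"
      then obtain i where i: "i < e" "l = lab i" by blast
      then have "l \<in> pruned P j" using fr1[OF i(1)] by (simp add: fragment_def lab_def)
      then show "l \<in> labels P" by (rule subsetD[OF pruned_labels])
    qed
    then have "card (lab ` {..<e}) < card {..<e}"
      using card_mono[OF is_lclD(2)[OF P]] by (simp add: e_def less_Suc_eq_le)
    then have "\<not> inj_on lab {..<e}" using card_image by fastforce
    then obtain i1 i2 where i12: "i1 < e" "i2 < e" "i1 \<noteq> i2" "lab i1 = lab i2" by (auto simp: inj_on_def)
    let ?U = "Kf i1 \<union> Kf i2"
    have U: "?U \<subseteq> {v. \<tau> \<le> cmp v \<and> cmp v < \<tau>1}" using fr1 i12 by blast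
    have "length (ps @ q1) + (1 + \<delta>) * span B \<le> Lmax" using L len1 by simp
    from join_fragments[OF st1 jk conjunct2[OF fr1[OF i12(1)]] conjunct2[OF fr1[OF i12(2)]] dis1[OF i12(1-3)] _ _ this C]
    obtain par2 q2 K i w where r: "\<forall>v. v \<notin> ?U \<longrightarrow> par2 v = par1 v" "\<forall>v. par2 v \<in> ?U \<longleftrightarrow> v \<in> ?U"
      "state (2 * (C * 2 ^ (e * J))) par2 ((ps @ q1) @ q2) \<tau>1" "set q2 \<subseteq> ?U" "length q2 \<le> (1 + \<delta>) * span B"
      "i < j" "K \<subseteq> ?U" "fragment par2 ((ps @ q1) @ q2) K i w ?B"
      using U i12(4) unfolding lab_def by blast
    have "continues par \<tau> par2 (q1 @ q2) \<tau>1"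
      unfolding continues_def
    proof (intro conjI allI impI)
      show "\<tau> \<le> \<tau>1" using c1 by (simp add: continues_def)
      show "\<forall>q\<in>set (q1 @ q2). \<tau> \<le> cmp q \<and> cmp q < \<tau>1"
        using c1 r(4) U by (auto simp: continues_def)
      fix v
      show "cmp (par2 v) < \<tau> \<longleftrightarrow> cmp v < \<tau>"
      proof (cases "v \<in> ?U")
        case True
        then have "par2 v \<in> ?U" using r(2) by blast
        then show ?thesis using True U by fastforce
      next
        case False
        then have "par2 v = par1 v" using r(1) by blast
        then show ?thesis using c1 by (simp add: continues_def)
      qed
      assume "cmp v < \<tau>"
      then have "v \<notin> ?U" using U by fastforce
      then show "par2 v = par v" using r(1) c1 \<open>cmp v < \<tau>\<close> by (simp add: continues_def)
    qed
    moreover have "length (q1 @ q2) \<le> e * L + (1 + \<delta>) * span B" using len1 r(5) by simp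
    moreover have "K \<subseteq> {v. \<tau> \<le> cmp v \<and> cmp v < \<tau>1}" using r(7) U by blast
    ultimately show ?thesis
      unfolding reachable_def eq using r(3,6,8)
      by (intro exI[of _ par2] exI[of _ "q1 @ q2"] exI[of _ \<tau>1] exI[of _ K] exI[of _ i] exI[of _ w]) simp
  qed
  then show "reachable j (Suc (card (labels P)) * L + (1 + \<delta>) * span B) (Suc (card (labels P)) * J + 1) ?B C par ps \<tau>"
    by (simp only: e_def)
qed

end

section \<open>A forest of caterpillars\<close>

text \<open>A node of component \<open>t\<close> is given by its position \<open>z\<close> on the bi-infinite spine of
  maximal rank and a list of pairs \<open>(j, m)\<close>, deepest first: descend to the \<open>j\<close>-th path of the
  next lower rank, and then \<open>m\<close> steps down that path.\<close>

type_synonym address = "nat \<times> int \<times> (nat \<times> nat) list"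

text \<open>\<open>d - 1\<close> paths of lower rank start at each node, beside the main child. The
  last condition cuts paths of rank 0 down to one leaf.\<close>

definition addresses :: "nat \<Rightarrow> nat \<Rightarrow> address set" where
  "addresses d R = {(t, z, l). length l \<le> R \<and> (\<forall>(j, m)\<in>set l. j < d - 1) \<and>
     (length l = R \<longrightarrow> l \<noteq> [] \<longrightarrow> snd (hd l) = 0)}"

fun parent :: "address \<Rightarrow> address" where
  "parent (t, z, []) = (t, z - 1, [])"
| "parent (t, z, (j, 0) # l) = (t, z, l)"
| "parent (t, z, (j, Suc m) # l) = (t, z, (j, m) # l)"

fun spinal :: "address \<Rightarrow> bool" where
  "spinal (t, z, []) = True"
| "spinal (t, z, (j, m) # l) = (m > 0)"

text \<open>A depth function that rules out cycles: every step to the parent lowers it by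
  one.\<close>

definition height :: "address \<Rightarrow> int" where
  "height = (\<lambda>(t, z, l). z + (\<Sum>(j, m)\<leftarrow>l. int m + 1))"

definition rank :: "nat \<Rightarrow> address \<Rightarrow> nat" where
  "rank R = (\<lambda>(t, z, l). R - length l)"

lemma parent_in_addresses: "v \<in> addresses d R \<Longrightarrow> parent v \<in> addresses d R"
  by (cases v rule: parent.cases) (auto simp: addresses_def)

lemma height_parent: "height (parent v) = height v - 1"
  by (cases v rule: parent.cases) (auto simp: height_def)

lemma fst_parent: "fst (parent v) = fst v"
  by (cases v rule: parent.cases) auto

lemma rank_parent:
  assumes "v \<in> addresses d R"
  shows "rank R (parent v) = (if spinal v then rank R v else Suc (rank R v))"
  using assms by (cases v rule: parent.cases) (auto simp: addresses_def rank_def)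

lemma spinal_rank: "v \<in> addresses d R \<Longrightarrow> R \<ge> 1 \<Longrightarrow> spinal v \<Longrightarrow> rank R v > 0"
  by (cases v rule: parent.cases) (auto simp: addresses_def rank_def le_less)

fun spine_child :: "address \<Rightarrow> address" where
  "spine_child (t, z, []) = (t, z + 1, [])"
| "spine_child (t, z, (j, m) # l) = (t, z, (j, Suc m) # l)"

lemma parent_eq_iff:
  "parent w = (t, z, l) \<longleftrightarrow> w = spine_child (t, z, l) \<or> (\<exists>j. w = (t, z, (j, 0) # l))"
  by (cases w rule: parent.cases; cases "(t, z, l)" rule: spine_child.cases) auto

lemma children_addresses:
  assumes v: "(t, z, l) \<in> addresses d R" and R: "R \<ge> 1" and r: "rank R (t, z, l) > 0"
  shows "{w \<in> addresses d R. parent w = (t, z, l)} =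
    insert (spine_child (t, z, l)) ((\<lambda>j. (t, z, (j, 0) # l)) ` {..<d - 1})"
proof -
  have spine: "spine_child (t, z, l) \<in> addresses d R"
    using v r R by (cases "(t, z, l)" rule: spine_child.cases) (auto simp: addresses_def rank_def)
  have light: "(t, z, (j, 0) # l) \<in> addresses d R \<longleftrightarrow> j < d - 1" for j
    using v r by (auto simp: addresses_def rank_def)
  have "w \<in> addresses d R \<and> parent w = (t, z, l) \<longleftrightarrow>
      w = spine_child (t, z, l) \<or> (\<exists>j<d - 1. w = (t, z, (j, 0) # l))" for w
    using spine light unfolding parent_eq_iff by blast
  then show ?thesis by (simp only:) blast
qed

lemma no_children_addresses:
  assumes v: "v \<in> addresses d R" and R: "R \<ge> 1" and r: "rank R v = 0"
  shows "{w \<in> addresses d R. parent w = v} = {}"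
proof -
  obtain t z l where v_eq: "v = (t, z, l)" by (cases v)
  have len: "length l = R" using v r by (auto simp: addresses_def rank_def v_eq)
  then obtain j m l' where "l = (j, m) # l'" using R by (cases l) auto
  then have "spine_child (t, z, l) \<notin> addresses d R" using len by (auto simp: addresses_def)
  moreover have "(t, z, (j, 0) # l) \<notin> addresses d R" for j using len by (auto simp: addresses_def)
  ultimately show ?thesis unfolding v_eq by (auto simp: parent_eq_iff)
qed

lemma spinal_children:
  "spinal (spine_child v)" "\<not> spinal (t, z, (j, 0) # l)"
  by (cases v rule: spine_child.cases) auto

lemma caterpillar_forest:
  assumes d: "d \<ge> 1" and R: "R \<ge> 1"
  shows "\<exists>rk main par cmp. ranked d rk main \<and> ranked.forest d rk main R par \<and>
    (\<forall>v. cmp (par v) = cmp v \<and> rk v \<le> rk (par v) \<and> rk (par v) \<le> Suc (rk v) \<and> (main v \<longrightarrow> rk (par v) = rk v)) \<and>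
    (\<forall>t :: nat. \<exists>v. cmp v = t \<and> rk v \<ge> R)"
proof -
  define V where "V = addresses d R"
  define f where "f = from_nat_into V"
  define g where "g = to_nat_on V"
  have top: "(t, z, []) \<in> V" for t z by (simp add: V_def addresses_def)
  have "infinite V"
  proof
    assume "finite V"
    moreover have "range (\<lambda>t :: nat. (t, 0, []) :: address) \<subseteq> V" using top by (intro image_subsetI)
    ultimately have "finite (range (\<lambda>t :: nat. (t, 0, []) :: address))" by (rule finite_subset[rotated])
    moreover have "inj (\<lambda>t :: nat. (t, 0, []) :: address)" by (auto intro: injI)
    ultimately show False by (meson finite_imageD infinite_UNIV_nat)
  qed
  moreover have "countable V" by simp
  ultimately have gf: "g (f n) = n" and fg: "v \<in> V \<Longrightarrow> f (g v) = v" and fV: "f n \<in> V" for n v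
    unfolding f_def g_def using from_nat_into[of V n] by (auto simp: to_nat_on_from_nat_into_infinite)
  define par where "par = (\<lambda>n. g (parent (f n)))"
  define rk where "rk = (\<lambda>n. rank R (f n))"
  define main where "main = (\<lambda>n. spinal (f n))"
  define cmp where "cmp = (\<lambda>n. fst (f n))"
  have pV: "parent (f n) \<in> V" for n using fV parent_in_addresses unfolding V_def by blast
  have fpar: "f (par n) = parent (f n)" for n using fg[OF pV] by (simp add: par_def)
  interpret ranked d rk main
    using d spinal_rank[OF fV[unfolded V_def] R] by unfold_locales (auto simp: main_def rk_def)
  have rkp: "rk (par n) = (if main n then rk n else Suc (rk n))" for n
    using rank_parent[of "f n" d R] fV by (simp add: rk_def main_def fpar V_def)
  have acyc: "(par ^^ k) n \<noteq> n" if "k > 0" for k n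
  proof -
    have "height (f ((par ^^ k) n)) = height (f n) - int k" for k
      by (induction k) (simp_all add: fpar height_parent)
    from this[of k] show ?thesis using that by auto
  qed
  have ch: "{c. par c = n} = g ` {w \<in> V. parent w = f n}" for n
  proof (intro equalityI subsetI)
    fix c assume "c \<in> {c. par c = n}"
    then have "parent (f c) = f n" using fpar by auto
    then show "c \<in> g ` {w \<in> V. parent w = f n}" using fV gf by (intro image_eqI[of _ _ "f c"]) auto
  next
    fix c assume "c \<in> g ` {w \<in> V. parent w = f n}"
    then obtain w where "w \<in> V" "parent w = f n" "c = g w" by auto
    then show "c \<in> {c. par c = n}" using fg gf by (simp add: par_def)
  qed
  have inj_g: "inj_on g V" using fg by (metis inj_onI)
  \<comment> \<open>The rank itself is the potential: constant along main edges, one larger above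
    any other node, and at most \<open>R\<close>.\<close>
  have F: "forest R par"
    unfolding forest_def
  proof (intro conjI allI impI exI[of _ rk])
    fix n assume pos: "0 < rk n"
    obtain t z l where v: "f n = (t, z, l)" by (cases "f n")
    have chV: "{w \<in> V. parent w = f n} = insert (spine_child (t, z, l)) ((\<lambda>j. (t, z, (j, 0) # l)) ` {..<d - 1})"
      using children_addresses[of t z l d R] fV[of n] pos R by (simp add: v V_def rk_def)
    have "spine_child (t, z, l) \<notin> (\<lambda>j. (t, z, (j, 0) # l)) ` {..<d - 1}"
    proof
      assume "spine_child (t, z, l) \<in> (\<lambda>j. (t, z, (j, 0) # l)) ` {..<d - 1}"
      then obtain j where "spine_child (t, z, l) = (t, z, (j, 0) # l)" by blast
      then show False using spinal_children(1)[of "(t, z, l)"] spinal_children(2) by simp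
    qed
    then have "card {w \<in> V. parent w = f n} = d"
      unfolding chV using d by (simp add: card_image inj_on_def)
    moreover have "card {c. par c = n} = card {w \<in> V. parent w = f n}"
      unfolding ch by (rule card_image) (rule inj_on_subset[OF inj_g], auto)
    ultimately show "card {c. par c = n} = d" by simp
    have sV: "spine_child (t, z, l) \<in> V" "parent (spine_child (t, z, l)) = f n" using chV by blast+
    show "\<exists>!c. par c = n \<and> main c"
    proof (rule ex1I[of _ "g (spine_child (t, z, l))"])
      show "par (g (spine_child (t, z, l))) = n \<and> main (g (spine_child (t, z, l)))"
        using sV fg gf spinal_children(1) by (simp add: par_def main_def)
      fix c assume c: "par c = n \<and> main c"
      then have "f c \<in> {w \<in> V. parent w = f n}" using fpar fV by auto
      moreover have "spinal (f c)" using c by (simp add: main_def)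
      ultimately have "f c = spine_child (t, z, l)" unfolding chV by (auto simp del: spine_child.simps)
      then show "c = g (spine_child (t, z, l))" using gf by metis
    qed
  next
    fix n assume "rk n = 0"
    then show "{c. par c = n} = {}"
      unfolding ch using no_children_addresses[of "f n" d R] fV R by (simp add: rk_def V_def)
  next
    fix n
    show "rk n \<le> R" by (simp add: rk_def rank_def split: prod.split)
  qed (use acyc rkp in auto)
  have "\<exists>v. cmp v = t \<and> R \<le> rk v" for t
    by (rule exI[of _ "g (t, 0, [])"]) (simp add: cmp_def rk_def fg[OF top] rank_def)
  moreover have "cmp (par v) = cmp v" for v by (simp add: cmp_def fpar fst_parent)
  ultimately show ?thesis
    using ranked_axioms F rkp
    by (intro exI[of _ rk] exI[of _ main] exI[of _ par] exI[of _ cmp]) auto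
qed


section \<open>The lower bound\<close>

text \<open>The recurrence of \<open>enforces_step\<close> after \<open>s\<close> levels; the inner
  term is \<open>span\<close> with \<open>c = Cmax + gap + 1\<close>.\<close>

primrec radius_budget :: "nat \<Rightarrow> nat \<Rightarrow> nat \<Rightarrow> nat" where
  "radius_budget T c 0 = 0"
| "radius_budget T c (Suc s) = radius_budget T c s + 2 * (2 * (T + radius_budget T c s + 1) + c) + 2"

primrec node_budget :: "nat \<Rightarrow> nat \<Rightarrow> nat \<Rightarrow> nat \<Rightarrow> nat \<Rightarrow> nat" where
  "node_budget g d T c 0 = 1"
| "node_budget g d T c (Suc s) =
     Suc g * node_budget g d T c s + (1 + d) * (2 * (T + radius_budget T c s + 1) + c)"

text \<open>Independent of all radii, so \<open>Cmax\<close> can be fixed first; the other budgets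
  contain it through \<open>c\<close>.\<close>

primrec swap_budget :: "nat \<Rightarrow> nat \<Rightarrow> nat" where
  "swap_budget g 0 = 0"
| "swap_budget g (Suc s) = Suc g * swap_budget g s + 1"

lemma radius_budget_linear: "\<exists>a. \<forall>T. radius_budget T c s \<le> a * (T + 1)"
proof (induction s)
  case (Suc s)
  then obtain a where a: "radius_budget T c s \<le> a * (T + 1)" for T by blast
  have "radius_budget T c (Suc s) \<le> (5 * a + 2 * c + 6) * (T + 1)" for T
    using a[of T] by (simp add: algebra_simps)
  then show ?case by blast
qed auto

lemma node_budget_linear: "\<exists>a. \<forall>T. node_budget g d T c s \<le> a * (T + 1)"
proof (induction s)
  case (Suc s)
  then obtain a where a: "node_budget g d T c s \<le> a * (T + 1)" for T by blast
  obtain b where b: "radius_budget T c s \<le> b * (T + 1)" for T using radius_budget_linear by blast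
  have "node_budget g d T c (Suc s) \<le> (Suc g * a + (1 + d) * (2 * b + c + 2)) * (T + 1)" for T
  proof -
    have "2 * (T + radius_budget T c s + 1) + c \<le> (2 * b + c + 2) * (T + 1)"
      using b[of T] by (simp add: algebra_simps)
    then have "(1 + d) * (2 * (T + radius_budget T c s + 1) + c) \<le> (1 + d) * ((2 * b + c + 2) * (T + 1))"
      by (rule mult_le_mono2)
    moreover have "Suc g * node_budget g d T c s \<le> Suc g * (a * (T + 1))" using a by (rule mult_le_mono2)
    ultimately show ?thesis by (simp only: node_budget.simps distrib_right mult.assoc add_mono)
  qed
  then show ?case by blast
next
  case 0
  have "node_budget g d T c 0 \<le> 1 * (T + 1)" for T by simp
  then show ?case by blast
qed

lemma uniform_gap:
  assumes "finite (labels P)"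
  shows "\<exists>c. \<forall>j<k. \<forall>a\<in>pruned P j - pruned P (Suc j). \<forall>X.
    \<exists>l. X \<le> l \<and> l \<le> X + c \<and> (a, a) \<notin> steps P (pruned P j) ^^ l"
proof -
  have "\<exists>c. \<forall>X. \<exists>l. X \<le> l \<and> l \<le> X + c \<and> (a, a) \<notin> steps P (pruned P j) ^^ l"
    if "a \<in> pruned P j - pruned P (Suc j)" for a j
    using that by (intro not_flexible_gap) simp
  then obtain c where c: "a \<in> pruned P j - pruned P (Suc j) \<Longrightarrow>
      \<exists>l. X \<le> l \<and> l \<le> X + c a j \<and> (a, a) \<notin> steps P (pruned P j) ^^ l" for a j X
    by metis
  define M where "M = Max (case_prod c ` (labels P \<times> {..<k}))"
  have "c a j \<le> M" if "a \<in> pruned P j" "j < k" for a j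
  proof -
    have "a \<in> labels P" using that(1) pruned_labels[of P j] by blast
    then have "c a j \<in> case_prod c ` (labels P \<times> {..<k})" using that(2) by force
    then show ?thesis unfolding M_def using assms by (intro Max_ge) auto
  qed
  then have "\<exists>l. X \<le> l \<and> l \<le> X + M \<and> (a, a) \<notin> steps P (pruned P j) ^^ l"
    if "j < k" "a \<in> pruned P j - pruned P (Suc j)" for j a X
    using c[OF that(2), of X] that by (meson DiffD1 add_left_mono le_trans)
  then show ?thesis by blast
qed

text \<open>If the budgets fitted into \<open>n\<close> nodes, \<open>enforces_step\<close> could be
  iterated down to level 0, which promises a label lost in a round below 0. The node budget is
  linear in \<open>T\<close> and \<open>Cmax\<close> is constant, so the room needed is polynomial
  in \<open>T\<close>.\<close>

lemma online_lower_bound: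
  assumes P: "is_lcl P" and empty: "pruned P k = {}"
  shows "\<exists>a e. \<forall>A T n. solves_online P A T \<longrightarrow> n \<in> input_sizes P \<longrightarrow> n < a * (T n + 1) ^ e"
proof -
  \<comment> \<open>\<open>Suc k\<close>, since the caterpillars need positive maximal rank even for
    \<open>k = 0\<close>.\<close>
  define R where "R = Suc k"
  define d where "d = arity P"
  define g where "g = card (labels P)"
  have d: "d \<ge> 1" using is_lclD(1)[OF P] by (simp add: d_def)
  obtain rk main par cmp where rkd: "ranked d rk main" and F: "ranked.forest d rk main R par"
    and par: "\<And>v. cmp (par v) = cmp v \<and> rk v \<le> rk (par v) \<and> rk (par v) \<le> Suc (rk v) \<and> (main v \<longrightarrow> rk (par v) = rk v)"
    and sup: "\<And>t :: nat. \<exists>v. cmp v = t \<and> rk v \<ge> R"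
    using caterpillar_forest[OF d, of R] by (auto simp: R_def)
  obtain gap where gap: "\<And>j a X. j < k \<Longrightarrow> a \<in> pruned P j - pruned P (Suc j) \<Longrightarrow>
      \<exists>l. X \<le> l \<and> l \<le> X + gap \<and> (a, a) \<notin> steps P (pruned P j) ^^ l"
    using uniform_gap[OF is_lclD(2)[OF P], of k] by blast
  define Cmax where "Cmax = R * 2 ^ swap_budget g k"
  define c where "c = Cmax + gap + 1"
  define size where "size = (\<lambda>T. (3 * d + 1) * (node_budget g d T c k * ((T + 1) ^ (Cmax + 2) * d ^ Cmax)))"
  have less: "n < size (T n)" if A: "solves_online P A T" and n: "n \<in> input_sizes P" for A T n
  proof (rule ccontr)
    assume "\<not> n < size (T n)"
    obtain m where m: "n = 1 + d * m" using n regular_tree_card by (force simp: input_sizes_def d_def)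
    have solves: "feasible P G (online_output A (T n) G vs)"
      if "regular_tree d G" "card (verts G) = n" "distinct vs" "set vs = verts G" for G vs
      using A that unfolding solves_online_def d_def by blast
    define Lmax where "Lmax = node_budget g d (T n) c k"
    interpret game d rk main P A n m "T n" Lmax Cmax gap k par cmp
    proof (intro game.intro[OF rkd] game_axioms.intro)
      show "(3 * d + 1) * (Lmax * ((T n + 1) ^ (Cmax + 2) * d ^ Cmax)) \<le> n"
        using \<open>\<not> n < size (T n)\<close> by (simp add: size_def Lmax_def)
      show "\<exists>v. cmp v = t \<and> k \<le> rk v" for t using sup[of t] by (auto simp: R_def)
    qed (use P m solves gap empty par in \<open>auto simp: d_def simp del: pruned.simps\<close>)
    have "enforces (k - s) (node_budget g d (T n) c s) (swap_budget g s) (radius_budget (T n) c s)"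
      if "s \<le> k" for s
      using that
    proof (induction s)
      case 0
      then show ?case using enforces_top by simp
    next
      case (Suc s)
      have span: "span (radius_budget (T n) c s) = 2 * (T n + radius_budget (T n) c s + 1) + c"
        by (simp add: span_def c_def)
      have "Suc (k - Suc s) = k - s" using Suc.prems by simp
      then have "enforces (Suc (k - Suc s)) (node_budget g d (T n) c s) (swap_budget g s) (radius_budget (T n) c s)"
        using Suc by simp
      from enforces_step[OF _ this] Suc.prems show ?case by (simp add: span g_def)
    qed
    from this[of k] have "enforces 0 Lmax (swap_budget g k) (radius_budget (T n) c k)" by (simp add: Lmax_def)
    moreover have "state R par [] 0" using F by (simp add: state_def)
    ultimately have "reachable 0 Lmax (swap_budget g k) (radius_budget (T n) c k) R par [] 0"
      unfolding enforces_def by (simp add: Cmax_def)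
    then show False by (simp add: reachable_def)
  qed
  obtain a where a: "node_budget g d T c k \<le> a * (T + 1)" for T using node_budget_linear by blast
  have "size T \<le> (3 * d + 1) * a * d ^ Cmax * (T + 1) ^ (Cmax + 3)" for T
  proof -
    have "size T \<le> (3 * d + 1) * (a * (T + 1) * ((T + 1) ^ (Cmax + 2) * d ^ Cmax))"
      unfolding size_def using a by (intro mult_le_mono2 mult_le_mono1)
    also have "\<dots> = (3 * d + 1) * a * d ^ Cmax * ((T + 1) * (T + 1) ^ (Cmax + 2))"
      by (simp only: mult.assoc mult.left_commute mult.commute)
    also have "(T + 1) * (T + 1) ^ (Cmax + 2) = (T + 1) ^ (Cmax + 3)"
      by (simp only: power_Suc[symmetric]) (simp add: numeral_3_eq_3)
    finally show ?thesis .
  qed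
  then show ?thesis using less by (meson less_le_trans)
qed

lemma online_polynomial:
  assumes P: "is_lcl P" and empty: "pruned P k = {}"
  shows "polynomial_locality P (locality_online P)"
proof -
  obtain a0 e0 where ae0: "solves_online P A T \<Longrightarrow> n \<in> input_sizes P \<Longrightarrow> n < a0 * (T n + 1) ^ e0" for A T n
    using online_lower_bound[OF P empty] by blast
  define a where "a = Suc a0"
  define e where "e = Suc e0"
  have ae: "n < a * (T n + 1) ^ e" if "solves_online P A T" "n \<in> input_sizes P" for A T n
  proof -
    have "a0 * (T n + 1) ^ e0 \<le> a * (T n + 1) ^ e"
      unfolding a_def e_def by (intro mult_le_mono power_increasing) auto
    then show ?thesis using ae0[OF that] by linarith
  qed
  define \<alpha> where "\<alpha> = 1 / real e"
  \<comment> \<open>The factor \<open>1 / 2\<close> pays for the \<open>1\<close> in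
    \<open>real t + 1\<close>, as soon as \<open>c * real n powr \<alpha>\<close> exceeds 1.\<close>
  define c where "c = (1 / real a) powr \<alpha> / 2"
  have pos: "\<alpha> > 0" "c > 0" by (auto simp: \<alpha>_def c_def a_def e_def)
  have "\<forall>\<^sub>F n in sequentially. 1 / c < real n powr \<alpha>" by (rule eventually_less_powr[OF pos(1)])
  then have "\<forall>\<^sub>F n in sequentially. n \<in> input_sizes P \<longrightarrow>
      ereal (c * real n powr \<alpha>) \<le> ereal_of_enat (locality_online P n)"
  proof eventually_elim
    case (elim n)
    show ?case
    proof
      assume n: "n \<in> input_sizes P"
      \<comment> \<open>The least value compatible with the bound at this \<open>n\<close> lies
        below every solver's locality, hence below the pointwise infimum, which is infinite if there
        is no solver.\<close>
      define t where "t = (LEAST t. n < a * (t + 1) ^ e)"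
      have "n < a * (n + 1) ^ e"
        using self_le_power[of "n + 1" e] by (simp add: a_def e_def)
      then have t: "n < a * (t + 1) ^ e" unfolding t_def by (rule LeastI)
      have "t \<le> T n" if "solves_online P A T" for A T
        unfolding t_def using ae[OF that n] by (rule Least_le)
      then have le: "enat t \<le> locality_online P n"
        unfolding locality_online_def Inf_apply image_image by (intro INF_greatest) auto
      have "real n / real a < real (t + 1) ^ e"
      proof -
        have "real n < real (a * (t + 1) ^ e)" using t by (simp only: of_nat_less_iff)
        then show ?thesis by (simp add: a_def field_simps)
      qed
      then have "(real n / real a) powr \<alpha> < (real (t + 1) ^ e) powr \<alpha>"
        using pos by (intro powr_less_mono2) auto
      also have "(real (t + 1) ^ e) powr \<alpha> = real (t + 1)"
      proof -
        have "real (t + 1) ^ e = real (t + 1) powr real e" by (rule powr_realpow[symmetric]) simp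
        then show ?thesis by (simp only: powr_powr \<alpha>_def) (simp add: e_def)
      qed
      finally have "2 * c * real n powr \<alpha> < real t + 1"
        by (simp add: c_def powr_divide)
      moreover have "1 < c * real n powr \<alpha>" using elim pos by (simp add: field_simps)
      ultimately have "c * real n powr \<alpha> \<le> real t" by simp
      then have "ereal (c * real n powr \<alpha>) \<le> ereal_of_enat (enat t)" by simp
      also have "\<dots> \<le> ereal_of_enat (locality_online P n)" using le by (simp only: ereal_of_enat_le_iff)
      finally show "ereal (c * real n powr \<alpha>) \<le> ereal_of_enat (locality_online P n)" .
    qed
  qed
  then show ?thesis unfolding polynomial_locality_def eventually_inf_principal using pos by blast
qed

theorem theorem5p3:
  fixes P :: "'l lcl" and N :: "nat \<Rightarrow> nat" and k :: nat
  assumes "is_lcl P"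
    and "\<And>n. n \<le> N n"
    and "(\<lambda>n. real (N n)) \<in> O(\<lambda>n. real n ^ k)"
  shows "polynomial_locality P (locality_local N P) \<longleftrightarrow>
         polynomial_locality P (locality_online P)"
proof
  assume "polynomial_locality P (locality_online P)"
  then show "polynomial_locality P (locality_local N P)"
    using locality_online_le_local[OF assms(2)] by (rule polynomial_locality_mono)
next
  assume poly: "polynomial_locality P (locality_local N P)"
  obtain i where i: "pruned P (Suc i) = pruned P i"
    using pruned_stabilizes[OF is_lclD(2)[OF assms(1)]] by blast
  show "polynomial_locality P (locality_online P)"
  proof (cases "pruned P i = {}")
    case True
    then show ?thesis using online_polynomial assms(1) by blast
  next
    case False
    then obtain S s \<kappa> where "certificate P S s \<kappa>" using certificate_exists[OF assms(1) i] by blast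
    \<comment> \<open>The filter is trivial here, so any lower bound holds along it.\<close>
    from certificate_not_polynomial[OF assms(1) this assms(3) poly]
    show ?thesis unfolding polynomial_locality_def by (simp add: exI[of _ 1])
  qed
qed

end
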